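(* For any $\epsilon>0$, there exists a polynomial-time algorithm that achieves a $$\Big(\big(1-e^{-\Omega(W^2/(n w_{\max}^2))}\big)\cdot 0.316-\epsilon\Big)\text{-approximation}$$ for sequential selection with expirations (SSE) with a knapsack constraint, relative to the online optimum. That is, there is an absolute constant $c>0$ such that for every $\epsilon>0$ there is a polynomial-time algorithm which, on every instance with $n$ options, capacity $W$ and maximum weight $w_{\max}=\max_j w_j$, implements an online policy respecting the knapsack constraint whose expected total value is at least $\big((1-e^{-cW^2/(n w_{\max}^2)})\cdot 0.316-\epsilon\big)$ times the maximum expected total value of an online policy respecting the knapsack constraint.
   Context: SSE problem with a knapsack constraint. An instance consists of $n$ options and a capacity $W$. Option $j\in[n]=\{1,\dots,n\}$ has a deterministic value $v_j>0$, a deterministic weight $w_j\ge0$, a random evaluation time $S_j$ and a random expiration time $E_j$, both taking positive integer values; all these $2n$ random variables are mutually independent, with known distributions and initially unknown realizations. Write $\overline F_{S_j}(t)=\Pr(S_j>t)$ and $p_j(t)=\Pr(E_j>t)$. Standing assumptions: there is $T\in\mathbb N$ with $\overline F_{S_j}(T)=0$ for all $j$, and $p_j(t)>0$ for all $t\ge 1$ and all $j$. Time is discrete, $t=1,2,\dots$. Option $j$ is unexpired at time $t$ iff $E_j>t$; all options are available at time $1$ (so $p_j(1)=1$). A decision-maker (DM) evaluates one option at a time. The DM is free at time 1. If the DM is free at time $t$, it may select one option $j$ that is unexpired at time $t$ and has not been selected before; it is then busy for $S_j$ time units (free again at time $t+S_j$) and obtains value $v_j$. A selected option cannot be preempted and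 cannot expire. Meanwhile other options may expire. If the DM selects nothing at $t$, it is still free at $t+1$. The total weight $\sum w_j$ of all selected options must not exceed $W$. An online policy decides, when the DM is free, which available option (if any) to select, using only the information revealed so far (past decisions, realized evaluation times of completed options, which options have expired), and possibly internal randomness. Its value is the expected sum of the values of the selected options. Polynomial time means that the running time is polynomial in $n$, $T$ and $1/\epsilon$, with the distributions given explicitly. *)

theory Defs
  imports "HOL-Probability.Probability"
begin

section \<open>Instances\<close>

text \<open>Options are numbered 1, \dots, \<open>num_opts\<close>; the fields indexed by options are irrelevant
  outside that range.\<close>

record sse_instance =
  num_opts :: nat
  max_eval :: nat
  capacity :: real
  val :: "nat \<Rightarrow> real"
  wgt :: "nat \<Rightarrow> real"
  eval_dist :: "nat \<Rightarrow> nat pmf"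
  exp_dist :: "nat \<Rightarrow> nat pmf"

abbreviation opts :: "sse_instance \<Rightarrow> nat set" where
  "opts I \<equiv> {1..num_opts I}"

definition tail :: "nat pmf \<Rightarrow> nat \<Rightarrow> real" where
  "tail D t = measure_pmf.prob D {x. x > t}"

definition valid_instance :: "sse_instance \<Rightarrow> bool" where
  "valid_instance I \<longleftrightarrow> num_opts I \<ge> 1 \<and> capacity I \<ge> 0 \<and>
     (\<forall>j\<in>opts I. val I j > 0 \<and> wgt I j \<ge> 0 \<and>
        0 \<notin> set_pmf (eval_dist I j) \<and> tail (eval_dist I j) (max_eval I) = 0 \<and>
        0 \<notin> set_pmf (exp_dist I j) \<and> tail (exp_dist I j) 1 = 1 \<and>
        (\<forall>t\<ge>1. tail (exp_dist I j) t > 0))"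

definition w_max :: "sse_instance \<Rightarrow> real" where
  "w_max I = Max (wgt I ` opts I)"

text \<open>The joint law of all evaluation times and expiration times, mutually independent.\<close>

definition scenarios :: "sse_instance \<Rightarrow> ((nat \<Rightarrow> nat) \<times> (nat \<Rightarrow> nat)) pmf" where
  "scenarios I = pair_pmf (Pi_pmf (opts I) 0 (eval_dist I)) (Pi_pmf (opts I) 0 (exp_dist I))"

section \<open>Online policies\<close>

text \<open>What the decision-maker has seen when it is free at time \<open>now\<close>: the list \<open>past\<close> of all
  selections made so far, as triples (option, selection time, completion time), and, for each
  option in order, its expiration time if it has expired unselected (\<open>None\<close> otherwise).\<close>

datatype history =
  History (now: nat) (past: "(nat \<times> nat \<times> nat) list") (expired: "nat option list")

text \<open>Internal randomness is an infinite sequence of independent uniform numbers in the unit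
  interval, drawn once and available at every decision.\<close>

definition seed :: "(nat \<Rightarrow> real) measure" where
  "seed = (\<Pi>\<^sub>M i\<in>UNIV. restrict_space lborel {0..1})"

type_synonym policy = "(nat \<Rightarrow> real) \<Rightarrow> history \<Rightarrow> nat option"

definition observe ::
  "sse_instance \<Rightarrow> (nat \<Rightarrow> nat) \<Rightarrow> (nat \<Rightarrow> nat) \<Rightarrow> (nat \<times> nat) list \<Rightarrow> nat \<Rightarrow> history" where
  "observe I s e L t = History t (map (\<lambda>(j, r). (j, r, r + s j)) L)
     (map (\<lambda>j. if j \<in> fst ` set L \<or> e j > t then None else Some (e j)) [1..<Suc (num_opts I)])"

definition free :: "(nat \<Rightarrow> nat) \<Rightarrow> (nat \<times> nat) list \<Rightarrow> nat \<Rightarrow> bool" where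
  "free s L t \<longleftrightarrow> (\<forall>(j, r)\<in>set L. r + s j \<le> t)"

text \<open>\<open>selections I d s e t\<close> lists the pairs (option, selection time) for all selections made
  at times 1, \dots, \<open>t\<close> under the decision rule \<open>d\<close>, when \<open>s\<close> and \<open>e\<close> are the realized
  evaluation and expiration times.\<close>

primrec selections ::
  "sse_instance \<Rightarrow> (history \<Rightarrow> nat option) \<Rightarrow> (nat \<Rightarrow> nat) \<Rightarrow> (nat \<Rightarrow> nat) \<Rightarrow> nat
     \<Rightarrow> (nat \<times> nat) list" where
  "selections I d s e 0 = []"
| "selections I d s e (Suc t) =
     (let L = selections I d s e t in
      if free s L (Suc t)
      then (case d (observe I s e L (Suc t)) of None \<Rightarrow> L | Some j \<Rightarrow> L @ [(j, Suc t)])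
      else L)"

definition selected ::
  "sse_instance \<Rightarrow> (history \<Rightarrow> nat option) \<Rightarrow> (nat \<Rightarrow> nat) \<Rightarrow> (nat \<Rightarrow> nat) \<Rightarrow> nat set" where
  "selected I d s e = {j \<in> opts I. \<exists>t. j \<in> fst ` set (selections I d s e t)}"

definition selectable ::
  "sse_instance \<Rightarrow> (nat \<Rightarrow> nat) \<Rightarrow> (nat \<times> nat) list \<Rightarrow> nat \<Rightarrow> nat \<Rightarrow> bool" where
  "selectable I e L t j \<longleftrightarrow> j \<in> opts I \<and> j \<notin> fst ` set L \<and> e j > t \<and>
     (\<Sum>(i, r)\<leftarrow>L. wgt I i) + wgt I j \<le> capacity I"

definition online_policy :: "sse_instance \<Rightarrow> policy \<Rightarrow> bool" where
  "online_policy I \<pi> \<longleftrightarrow>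
     (\<forall>h. (\<lambda>u. \<pi> u h) \<in> measurable seed (count_space UNIV)) \<and>
     (\<forall>u\<in>space seed. \<forall>(s, e)\<in>set_pmf (scenarios I). \<forall>t.
        let L = selections I (\<pi> u) s e t in
        free s L (Suc t) \<longrightarrow>
        (\<forall>j. \<pi> u (observe I s e L (Suc t)) = Some j \<longrightarrow> selectable I e L (Suc t) j))"

definition expected_value :: "sse_instance \<Rightarrow> policy \<Rightarrow> real" where
  "expected_value I \<pi> =
     (\<integral>x. (case x of ((s, e), u) \<Rightarrow> \<Sum>j\<in>selected I (\<pi> u) s e. val I j)
        \<partial>(measure_pmf (scenarios I) \<Otimes>\<^sub>M seed))"

definition online_opt :: "sse_instance \<Rightarrow> real" where
  "online_opt I = (\<Squnion>\<pi>\<in>{\<pi>. online_policy I \<pi>}. expected_value I \<pi>)"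

section \<open>Real random-access machine programs\<close>

text \<open>Running times are to be polynomial in \<open>n\<close>, \<open>T\<close> and \<open>1/\<epsilon>\<close> only, not in the bit length of the
  numbers, so real arithmetic is counted at unit cost. Programs work on an integer memory and a
  real memory, with indirect addressing, and may read the random seed. There is
  neither integer multiplication nor rounding of reals: with unit costs these would let
  polynomially many steps manipulate exponentially long bit strings.\<close>

datatype nexp = NConst nat | NMem nexp | NAdd nexp nexp | NSub nexp nexp

datatype rexp = ROfNat nexp | RMem nexp | Rand nexp
  | RAdd rexp rexp | RSub rexp rexp | RMul rexp rexp | RDiv rexp rexp

datatype bexp = NLess nexp nexp | RLess rexp rexp | BNot bexp | BAnd bexp bexp

datatype prog = NStore nexp nexp | RStore nexp rexp | Seq prog prog
  | Cond bexp prog prog | While bexp prog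

type_synonym store = "(nat \<Rightarrow> nat) \<times> (nat \<Rightarrow> real)"

primrec nval :: "store \<Rightarrow> nexp \<Rightarrow> nat" where
  "nval \<sigma> (NConst c) = c"
| "nval \<sigma> (NMem a) = fst \<sigma> (nval \<sigma> a)"
| "nval \<sigma> (NAdd a b) = nval \<sigma> a + nval \<sigma> b"
| "nval \<sigma> (NSub a b) = nval \<sigma> a - nval \<sigma> b"

primrec rval :: "(nat \<Rightarrow> real) \<Rightarrow> store \<Rightarrow> rexp \<Rightarrow> real" where
  "rval u \<sigma> (ROfNat a) = real (nval \<sigma> a)"
| "rval u \<sigma> (RMem a) = snd \<sigma> (nval \<sigma> a)"
| "rval u \<sigma> (Rand a) = u (nval \<sigma> a)"
| "rval u \<sigma> (RAdd x y) = rval u \<sigma> x + rval u \<sigma> y"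
| "rval u \<sigma> (RSub x y) = rval u \<sigma> x - rval u \<sigma> y"
| "rval u \<sigma> (RMul x y) = rval u \<sigma> x * rval u \<sigma> y"
| "rval u \<sigma> (RDiv x y) = rval u \<sigma> x / rval u \<sigma> y"

primrec bval :: "(nat \<Rightarrow> real) \<Rightarrow> store \<Rightarrow> bexp \<Rightarrow> bool" where
  "bval u \<sigma> (NLess a b) = (nval \<sigma> a < nval \<sigma> b)"
| "bval u \<sigma> (RLess x y) = (rval u \<sigma> x < rval u \<sigma> y)"
| "bval u \<sigma> (BNot p) = (\<not> bval u \<sigma> p)"
| "bval u \<sigma> (BAnd p q) = (bval u \<sigma> p \<and> bval u \<sigma> q)"

primrec ncost :: "nexp \<Rightarrow> nat" where
  "ncost (NConst c) = 1"
| "ncost (NMem a) = ncost a + 1"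
| "ncost (NAdd a b) = ncost a + ncost b + 1"
| "ncost (NSub a b) = ncost a + ncost b + 1"

primrec rcost :: "rexp \<Rightarrow> nat" where
  "rcost (ROfNat a) = ncost a + 1"
| "rcost (RMem a) = ncost a + 1"
| "rcost (Rand a) = ncost a + 1"
| "rcost (RAdd x y) = rcost x + rcost y + 1"
| "rcost (RSub x y) = rcost x + rcost y + 1"
| "rcost (RMul x y) = rcost x + rcost y + 1"
| "rcost (RDiv x y) = rcost x + rcost y + 1"

primrec bcost :: "bexp \<Rightarrow> nat" where
  "bcost (NLess a b) = ncost a + ncost b + 1"
| "bcost (RLess x y) = rcost x + rcost y + 1"
| "bcost (BNot p) = bcost p + 1"
| "bcost (BAnd p q) = bcost p + bcost q + 1"

text \<open>\<open>exec u P \<sigma> k \<tau>\<close>: with random seed \<open>u\<close>, program \<open>P\<close> started in store \<open>\<sigma>\<close> halts in store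
  \<open>\<tau>\<close> after exactly \<open>k\<close> elementary steps.\<close>

inductive exec :: "(nat \<Rightarrow> real) \<Rightarrow> prog \<Rightarrow> store \<Rightarrow> nat \<Rightarrow> store \<Rightarrow> bool" for u where
  NStore: "exec u (NStore a b) \<sigma> (ncost a + ncost b + 1)
             ((fst \<sigma>)(nval \<sigma> a := nval \<sigma> b), snd \<sigma>)"
| RStore: "exec u (RStore a x) \<sigma> (ncost a + rcost x + 1)
             (fst \<sigma>, (snd \<sigma>)(nval \<sigma> a := rval u \<sigma> x))"
| Seq: "exec u P \<sigma> k \<rho> \<Longrightarrow> exec u Q \<rho> l \<tau> \<Longrightarrow> exec u (Seq P Q) \<sigma> (k + l) \<tau>"
| CondTrue: "bval u \<sigma> b \<Longrightarrow> exec u P \<sigma> k \<tau> \<Longrightarrow> exec u (Cond b P Q) \<sigma> (bcost b + k) \<tau>"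
| CondFalse: "\<not> bval u \<sigma> b \<Longrightarrow> exec u Q \<sigma> k \<tau> \<Longrightarrow> exec u (Cond b P Q) \<sigma> (bcost b + k) \<tau>"
| WhileFalse: "\<not> bval u \<sigma> b \<Longrightarrow> exec u (While b P) \<sigma> (bcost b) \<sigma>"
| WhileTrue: "bval u \<sigma> b \<Longrightarrow> exec u P \<sigma> k \<rho> \<Longrightarrow> exec u (While b P) \<rho> l \<tau> \<Longrightarrow>
             exec u (While b P) \<sigma> (bcost b + k + l) \<tau>"

section \<open>Polynomial-time implementation of a policy\<close>

text \<open>Expiration times are at least 2 in a valid instance, so 0 can mark unexpired options.\<close>

definition nat_input :: "sse_instance \<Rightarrow> history \<Rightarrow> nat list" where
  "nat_input I h = [num_opts I, max_eval I, now h, length (past h)] @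
     concat (map (\<lambda>(j, r, f). [j, r, f]) (past h)) @
     map (\<lambda>x. case x of None \<Rightarrow> 0 | Some t \<Rightarrow> t) (expired h)"

text \<open>Expiration times have unbounded support, so an explicit description has to be cut off
  somewhere; the program is given the survival probabilities up to time \<open>n T\<close>, which is how long it
  takes at most to evaluate all options.\<close>

definition real_input :: "sse_instance \<Rightarrow> real list" where
  "real_input I =
     (let n = num_opts I; T = max_eval I; js = [1..<Suc n] in
      [capacity I] @ map (val I) js @ map (wgt I) js @
      concat (map (\<lambda>j. map (pmf (eval_dist I j)) [1..<Suc T]) js) @
      concat (map (\<lambda>j. map (tail (exp_dist I j)) [1..<Suc (n * T)]) js))"

definition initial_store :: "sse_instance \<Rightarrow> history \<Rightarrow> store" where
  "initial_store I h =
     (\<lambda>i. if i < length (nat_input I h) then nat_input I h ! i else 0,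
      \<lambda>i. if i < length (real_input I) then real_input I ! i else 0)"

text \<open>The program is run afresh, on the instance, the history and the same seed, at each time the
  decision-maker is free; integer cell 0 finally holds the option to select, or 0 for none.
  Every run takes at most \<open>B\<close> steps. Nothing is selected after time \<open>B\<close>, so at most \<open>B\<close> runs
  are needed and the total running time is polynomial if \<open>B\<close> is.\<close>

definition implements_within :: "sse_instance \<Rightarrow> prog \<Rightarrow> policy \<Rightarrow> real \<Rightarrow> bool" where
  "implements_within I P \<pi> B \<longleftrightarrow>
     (\<forall>u\<in>space seed. \<forall>(s, e)\<in>set_pmf (scenarios I). \<forall>t.
        let L = selections I (\<pi> u) s e t; h = observe I s e L (Suc t) in
        free s L (Suc t) \<longrightarrow>
        (\<exists>k m r. exec u P (initial_store I h) k (m, r) \<and> real k \<le> B \<and>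
           \<pi> u h = (if m 0 = 0 then None else Some (m 0))) \<and>
        (\<pi> u h \<noteq> None \<longrightarrow> real (Suc t) \<le> B))"

text \<open>If all weights are zero, the exponent \<open>W\<^sup>2 / (n w_max\<^sup>2)\<close> is read as infinity: the knapsack
  constraint is then void.\<close>

definition knapsack_factor :: "real \<Rightarrow> sse_instance \<Rightarrow> real" where
  "knapsack_factor c I =
     (if w_max I = 0 then 1
      else 1 - exp (- c * (capacity I)\<^sup>2 / (real (num_opts I) * (w_max I)\<^sup>2)))"

end

theory Submission
  imports Defs
begin

text \<open>Write \<open>y\<^sub>j\<^sub>t\<close> for the probability that a policy selects option \<open>j\<close> at time \<open>t\<close>, divided by
  \<open>Pr(E\<^sub>j > t)\<close>. Up to idle time, these numbers satisfy linear constraints: each option is selected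
  once, one option is evaluated at a time, and the capacity holds in expectation. So the optimal
  policy is worth at most the linear program, which a multiplicative-weights method solves up to a
  factor \<open>0.93\<close>.

  From a solution \<open>y\<close>, draw independent intended times \<open>\<tau>\<^sub>j\<close> with \<open>Pr(\<tau>\<^sub>j = t) = 4/5 y\<^sub>j\<^sub>t f(m\<^sub>j\<^sub>t)\<close>,
  where \<open>m\<^sub>j\<^sub>t\<close> is \<open>4/5\<close> of the busy mass of \<open>j\<close> at time \<open>t\<close> and \<open>f(m)\<close> is close to \<open>exp(-m)\<close>. An
  option that is unexpired at its intended time is a candidate, and blocks all others for its
  evaluation time, even if it is not selected; in that case the policy simulates the evaluation time.
  A candidate is selected if no other option blocks and the candidates fit into the capacity. As
  the options behave independently and the busy masses add up to at most \<open>4/5\<close>, the others do not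
  block with probability at least \<open>exp(m\<^sub>j\<^sub>t - 4/5)\<close>. The factor \<open>f(m\<^sub>j\<^sub>t)\<close> evens this out, so that
  \<open>j\<close> is selected with probability at least \<open>4/5 y\<^sub>j\<^sub>t f(4/5) Pr(E\<^sub>j > t)\<close>, up to the capacity. The
  expected weight of the candidates is at most \<open>4/5\<close> of the capacity, so that a Hoeffding bound
  handles the capacity if all weights are at most \<open>W/10\<close>. Otherwise \<open>W\<^sup>2 / w\<^sub>m\<^sub>a\<^sub>x\<^sup>2 < 100\<close>, the
  required factor is at most \<open>1/n\<close>, and the best single option suffices. The constants leave
  enough slack for \<open>\<epsilon>\<close> to play no role.\<close>

section \<open>Multiplicative weights for packing programs\<close>

text \<open>Origin of the constants. Planning with the full LP mass would give a selection
  probability of about 1/e, but the candidates could then fill the capacity W in expectation, and no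
  exponential bound could hold. The factor 4/5 gives \<open>4/5 * thin (4/5) > 0.3477\<close> and
  leaves W/5 of the capacity: W/10 for the option itself, W/10 as the deviation in the Chernoff
  bound. This yields the exponent 1/50; the case of a weight above W/10 yields 1/100. Finally
  \<open>0.3477 * 0.93 > 0.316\<close>. Obstacles. A policy may idle without limit, so the LP
  indexes selections by accumulated evaluation time; this only moves them to earlier times, where
  survival is more likely. A candidate that is not selected must block like an evaluated one, but
  its evaluation time is never seen; a measure-preserving exchange of real and simulated times
  reduces the policy to independent options. The program keeps no state between decisions: it
  recomputes the LP solution and the intended times from the same seed, always with the same
  result.\<close>

primrec best :: "(nat \<Rightarrow> real) \<Rightarrow> nat \<Rightarrow> real \<times> nat" where
  "best f 0 = (0, 0)"
| "best f (Suc k) = (if fst (best f k) < f k then (f k, k) else best f k)"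

lemma best_upper: "i < k \<Longrightarrow> f i \<le> fst (best f k)"
  by (induction k) (auto simp: less_Suc_eq)

lemma best_nonneg: "0 \<le> fst (best f k)"
  by (induction k) auto

text \<open>The search starts from value 0 at the dummy index 0, so the index is meaningful only if
  some entry is positive.\<close>

lemma best_attained: "fst (best f k) > 0 \<Longrightarrow> snd (best f k) < k \<and> f (snd (best f k)) = fst (best f k)"
  by (induction k) (auto split: if_splits)

lemma best_snd_bound: "k > 0 \<Longrightarrow> snd (best f k) < k"
  by (induction k) (auto simp: less_Suc_eq split: if_splits)

text \<open>A packing program with rows \<open>c < m\<close> and columns \<open>q < Q\<close> is given by its coefficients
  \<open>A q c\<close>, all right-hand sides being 1, and its objective \<open>b\<close>.\<close>

definition col_len :: "nat \<Rightarrow> (nat \<Rightarrow> nat \<Rightarrow> real) \<Rightarrow> (nat \<Rightarrow> real) \<Rightarrow> nat \<Rightarrow> real" where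
  "col_len m A y q = (\<Sum>c<m. y c * A q c)"

definition pack_col where
  "pack_col m Q A b y = snd (best (\<lambda>q. b q / col_len m A y q) Q)"

type_synonym pack_state = "(nat \<Rightarrow> real) \<times> (nat \<Rightarrow> real) \<times> (nat \<Rightarrow> real)"

text \<open>One step of the packing algorithm of Garg and Koenemann with step size 1/20. The state
  consists of the dual prices of the rows, the units bought of each column, and the loads of the
  rows. A whole unit is bought at once because the largest coefficient of a column is 1.\<close>

definition pack_step ::
  "nat \<Rightarrow> nat \<Rightarrow> (nat \<Rightarrow> nat \<Rightarrow> real) \<Rightarrow> (nat \<Rightarrow> real) \<Rightarrow> pack_state \<Rightarrow> pack_state" where
  "pack_step m Q A b = (\<lambda>(y, N, L). let q = pack_col m Q A b y in
     (\<lambda>c. if c < m then y c * (1 + A q c / 20) else y c, N(q := N q + 1),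
      \<lambda>c. if c < m then L c + A q c else L c))"

text \<open>Prices outside the rows are 0, so that the states equal, as functions on all of
  \<open>nat\<close>, the arrays of a program started on cleared memory.\<close>

primrec pack :: "nat \<Rightarrow> nat \<Rightarrow> (nat \<Rightarrow> nat \<Rightarrow> real) \<Rightarrow> (nat \<Rightarrow> real) \<Rightarrow> nat \<Rightarrow> pack_state" where
  "pack m Q A b 0 = (\<lambda>c. if c < m then 1 else 0, \<lambda>_. 0, \<lambda>_. 0)"
| "pack m Q A b (Suc k) = pack_step m Q A b (pack m Q A b k)"

text \<open>\<open>A_tight\<close> makes the number of rounds independent of the data, since each
  purchase loads some row fully. It also keeps \<open>col_len\<close> positive, so that no division
  by 0 occurs.\<close>

locale packing =
  fixes m Q :: nat and A :: "nat \<Rightarrow> nat \<Rightarrow> real" and b :: "nat \<Rightarrow> real"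
  assumes A_range: "q < Q \<Longrightarrow> c < m \<Longrightarrow> A q c \<in> {0..1}"
    and A_tight: "q < Q \<Longrightarrow> \<exists>c<m. A q c = 1"
    and b_pos: "q < Q \<Longrightarrow> b q > 0"
    and Q_pos: "Q > 0"
begin

abbreviation "Y k \<equiv> fst (pack m Q A b k)"
abbreviation "N k \<equiv> fst (snd (pack m Q A b k))"
abbreviation "L k \<equiv> snd (snd (pack m Q A b k))"
abbreviation "qc k \<equiv> pack_col m Q A b (Y k)"

lemma Y_Suc: "c < m \<Longrightarrow> Y (Suc k) c = Y k c * (1 + A (qc k) c / 20)"
  by (simp add: pack_step_def Let_def split: prod.splits)

lemma N_Suc: "N (Suc k) = (N k)(qc k := N k (qc k) + 1)"
  by (simp add: pack_step_def Let_def split: prod.splits)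

lemma L_Suc: "c < m \<Longrightarrow> L (Suc k) c = L k c + A (qc k) c"
  by (simp add: pack_step_def Let_def split: prod.splits)

declare pack.simps(2) [simp del]

lemma m_pos: "m > 0"
  using A_tight[OF Q_pos] by auto

lemma qc_less: "qc k < Q"
  unfolding pack_col_def using Q_pos by (rule best_snd_bound)

lemma Y_pos: "c < m \<Longrightarrow> Y k c > 0"
proof (induction k)
  case (Suc k)
  have "A (qc k) c \<ge> 0" using A_range[OF qc_less Suc.prems] by auto
  then show ?case using Suc by (subst Y_Suc) auto
qed simp

lemma N_nonneg: "N k q \<ge> 0"
  by (induction k) (auto simp: N_Suc)

lemma L_eq: "c < m \<Longrightarrow> L k c = (\<Sum>q<Q. N k q * A q c)"
proof (induction k)
  case (Suc k)
  have "(\<Sum>q<Q. N (Suc k) q * A q c) = (\<Sum>q<Q. N k q * A q c + (if q = qc k then A q c else 0))"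
    by (intro sum.cong) (auto simp: N_Suc algebra_simps)
  also have "\<dots> = (\<Sum>q<Q. N k q * A q c) + A (qc k) c"
    using qc_less by (simp add: sum.distrib)
  finally show ?case using Suc by (subst L_Suc) auto
qed simp

lemma col_len_pos: assumes "q < Q" shows "col_len m A (Y k) q > 0"
proof -
  obtain c where c: "c < m" "A q c = 1" using A_tight[OF assms] by auto
  have "0 < Y k c * A q c" using c Y_pos by simp
  also have "\<dots> \<le> (\<Sum>c<m. Y k c * A q c)"
    using c A_range[OF assms] Y_pos
    by (intro member_le_sum mult_nonneg_nonneg) (auto simp: less_imp_le)
  finally show ?thesis by (simp add: col_len_def)
qed

text \<open>Weak duality: the column picked by the algorithm is the cheapest one per unit of value.\<close>

lemma col_len_bound:
  assumes x: "\<And>q. q < Q \<Longrightarrow> x q \<ge> 0" "\<And>c. c < m \<Longrightarrow> (\<Sum>q<Q. x q * A q c) \<le> 1"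
  shows "(\<Sum>q<Q. b q * x q) * col_len m A (Y k) (qc k) \<le> b (qc k) * (\<Sum>c<m. Y k c)"
proof -
  let ?l = "col_len m A (Y k)"
  have cheap: "b q * ?l (qc k) \<le> b (qc k) * ?l q" if "q < Q" for q
  proof -
    have ub: "b q / ?l q \<le> fst (best (\<lambda>q. b q / ?l q) Q)"
      using that by (rule best_upper)
    have "0 < b q / ?l q" using b_pos[OF that] col_len_pos[OF that] by simp
    then have "fst (best (\<lambda>q. b q / ?l q) Q) = b (qc k) / ?l (qc k)"
      using ub best_attained[of "\<lambda>q. b q / ?l q" Q] unfolding pack_col_def by simp
    then show ?thesis using ub col_len_pos[OF that] col_len_pos[OF qc_less]
      by (simp add: field_simps)
  qed
  have "(\<Sum>q<Q. b q * x q) * ?l (qc k) = (\<Sum>q<Q. x q * (b q * ?l (qc k)))"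
    by (simp add: sum_distrib_right mult_ac)
  also have "\<dots> \<le> (\<Sum>q<Q. x q * (b (qc k) * ?l q))"
    using x cheap by (intro sum_mono mult_left_mono) auto
  also have "\<dots> = b (qc k) * (\<Sum>q<Q. \<Sum>c<m. Y k c * (x q * A q c))"
    by (simp add: col_len_def sum_distrib_left mult_ac)
  also have "(\<Sum>q<Q. \<Sum>c<m. Y k c * (x q * A q c)) = (\<Sum>c<m. Y k c * (\<Sum>q<Q. x q * A q c))"
    by (subst sum.swap) (simp add: sum_distrib_left)
  also have "\<dots> \<le> (\<Sum>c<m. Y k c)"
    using x(2) Y_pos by (intro sum_mono) (simp add: mult_left_le less_imp_le)
  finally show ?thesis
    using b_pos[OF qc_less[of k]] by (simp add: mult_left_mono)
qed

text \<open>At prices of total D, the column bought costs at most D/V per unit of value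
  (\<open>col_len_bound\<close>). So a purchase of value \<open>b\<close> raises D by a factor of at
  most \<open>1 + b / (20 * V)\<close>, which is bounded by an exponential.\<close>

lemma Y_sum_upper:
  assumes x: "\<And>q. q < Q \<Longrightarrow> x q \<ge> 0" "\<And>c. c < m \<Longrightarrow> (\<Sum>q<Q. x q * A q c) \<le> 1"
    and V: "V = (\<Sum>q<Q. b q * x q)" "V > 0"
  shows "(\<Sum>c<m. Y k c) \<le> real m * exp ((\<Sum>q<Q. b q * N k q) / (20 * V))"
proof (induction k)
  case (Suc k)
  let ?D = "\<Sum>c<m. Y k c" and ?v = "\<lambda>k. \<Sum>q<Q. b q * N k q"
  have D0: "?D \<ge> 0" using Y_pos by (intro sum_nonneg) (auto intro: less_imp_le)
  have "(\<Sum>c<m. Y (Suc k) c) = (\<Sum>c<m. Y k c + Y k c * A (qc k) c / 20)"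
    by (intro sum.cong) (simp_all add: Y_Suc algebra_simps)
  also have "\<dots> = ?D + col_len m A (Y k) (qc k) / 20"
    by (simp add: sum.distrib col_len_def sum_divide_distrib)
  also have "\<dots> \<le> ?D + (b (qc k) * ?D / V) / 20"
    using col_len_bound[OF x, of k] V by (simp add: field_simps)
  also have "\<dots> = ?D * (1 + b (qc k) / (20 * V))"
    by (simp add: algebra_simps)
  also have "\<dots> \<le> ?D * exp (b (qc k) / (20 * V))"
    using D0 by (intro mult_left_mono) auto
  also have "\<dots> \<le> real m * exp (?v k / (20 * V)) * exp (b (qc k) / (20 * V))"
    using Suc.IH by (intro mult_right_mono) auto
  also have "\<dots> = real m * exp ((?v k + b (qc k)) / (20 * V))"
    by (simp add: exp_add[symmetric] add_divide_distrib)
  also have "?v k + b (qc k) = ?v (Suc k)"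
  proof -
    have "?v (Suc k) = (\<Sum>q<Q. b q * N k q + (if q = qc k then b q else 0))"
      by (intro sum.cong) (auto simp: N_Suc algebra_simps)
    then show ?thesis using qc_less by (simp add: sum.distrib)
  qed
  finally show ?case .
qed simp

text \<open>The rate 19/400 is 1/20 - 1/400: it comes from \<open>ln (1 + z) >= z - z^2\<close> at
  \<open>z = A / 20\<close>, where \<open>A <= 1\<close> allows replacing the square of
  \<open>A\<close> by \<open>A\<close>.\<close>

lemma Y_lower: "c < m \<Longrightarrow> exp (19 / 400 * L k c) \<le> Y k c"
proof (induction k)
  case (Suc k)
  let ?r = "A (qc k) c"
  have r: "0 \<le> ?r" "?r \<le> 1" using A_range[OF qc_less Suc.prems] by auto
  have "?r / 20 - (?r / 20)\<^sup>2 \<le> ln (1 + ?r / 20)"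
    using r by (intro ln_one_plus_pos_lower_bound) auto
  moreover have "19 / 400 * ?r \<le> ?r / 20 - (?r / 20)\<^sup>2"
    using mult_left_le[OF r(2) r(1)] by (simp add: power2_eq_square field_simps)
  ultimately have "exp (19 / 400 * ?r) \<le> 1 + ?r / 20"
    using r by (subst ln_ge_iff[symmetric]) (auto simp: add_pos_nonneg)
  then have "exp (19 / 400 * L k c) * exp (19 / 400 * ?r) \<le> Y k c * (1 + ?r / 20)"
    using Suc Y_pos[OF Suc.prems, of k] by (intro mult_mono) auto
  then show ?case using Suc.prems
    by (simp only: Y_Suc L_Suc exp_add[symmetric] distrib_left)
qed simp

text \<open>The price bounds become useful only once some load is large. As each purchase loads some
  row by 1, k rounds force a maximal load of at least k/m.\<close>

lemma load_total: "real k \<le> (\<Sum>c<m. L k c)"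
proof (induction k)
  case (Suc k)
  obtain c where c: "c < m" "A (qc k) c = 1" using A_tight[OF qc_less] by auto
  have "1 \<le> (\<Sum>c<m. A (qc k) c)"
    using c A_range[OF qc_less] by (subst c(2)[symmetric], intro member_le_sum) auto
  moreover have "(\<Sum>c<m. L (Suc k) c) = (\<Sum>c<m. L k c) + (\<Sum>c<m. A (qc k) c)"
    by (simp add: L_Suc flip: sum.distrib)
  ultimately show ?case using Suc by simp
qed simp

text \<open>Dividing the purchases by the maximal load makes them feasible.\<close>

definition Lmax :: "nat \<Rightarrow> real" where "Lmax k = fst (best (L k) m)"

lemma Lmax_upper: "c < m \<Longrightarrow> (\<Sum>q<Q. N k q * A q c) \<le> Lmax k"
  unfolding Lmax_def by (subst L_eq[symmetric]) (auto intro: best_upper)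

lemma Lmax_lower: "real k \<le> real m * Lmax k"
proof -
  have "real k \<le> (\<Sum>c<m. L k c)" by (rule load_total)
  also have "\<dots> \<le> (\<Sum>c<m. Lmax k)"
    unfolding Lmax_def by (intro sum_mono best_upper) auto
  finally show ?thesis by simp
qed

text \<open>The largest price is at least \<open>exp (19/400 * Lmax k)\<close>, the sum of all
  prices at most \<open>m * exp (v / (20 * V))\<close>. Taking logarithms, with m in place of ln m,
  gives \<open>v / V >= 0.95 * Lmax k - 20 * m\<close>. The number of rounds is chosen such that
  \<open>Lmax k >= 1000 * m\<close>, so the last term costs at most a fraction 0.02.\<close>

theorem packing_approximation:
  assumes k: "k = 1000 * (m * m)"
    and x: "\<And>q. q < Q \<Longrightarrow> x q \<ge> 0" "\<And>c. c < m \<Longrightarrow> (\<Sum>q<Q. x q * A q c) \<le> 1"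
  shows "93 / 100 * (\<Sum>q<Q. b q * x q) \<le> (\<Sum>q<Q. b q * (N k q / Lmax k))"
    and "Lmax k > 0"
proof -
  have big: "1000 * real m \<le> Lmax k"
    using Lmax_lower[of k] m_pos by (simp add: k)
  show Lpos: "Lmax k > 0" using big m_pos by linarith
  define V where "V = (\<Sum>q<Q. b q * x q)"
  let ?v = "\<Sum>q<Q. b q * N k q"
  have vq: "(\<Sum>q<Q. b q * (N k q / Lmax k)) = ?v / Lmax k"
    by (simp add: sum_divide_distrib)
  show "93 / 100 * (\<Sum>q<Q. b q * x q) \<le> (\<Sum>q<Q. b q * (N k q / Lmax k))"
  proof (cases "V > 0")
    case True
    obtain c where c: "c < m" "L k c = Lmax k"
      using best_attained[of "L k" m] Lpos unfolding Lmax_def by auto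
    have "exp (19 / 400 * Lmax k) \<le> Y k c" using Y_lower[OF c(1), of k] c by simp
    also have "\<dots> \<le> (\<Sum>c<m. Y k c)"
      using c Y_pos by (intro member_le_sum) (auto intro: less_imp_le)
    also have "\<dots> \<le> real m * exp (?v / (20 * V))"
      using x V_def True by (rule Y_sum_upper)
    also have "\<dots> \<le> exp (real m) * exp (?v / (20 * V))"
      using exp_ge_add_one_self[of "real m"] by (intro mult_right_mono) (linarith, simp)
    finally have "19 / 400 * Lmax k \<le> real m + ?v / (20 * V)"
      by (simp add: exp_add[symmetric])
    moreover have "?v / (20 * V) = ?v / V / 20" by simp
    ultimately have "93 / 100 * Lmax k \<le> ?v / V"
      using big by linarith
    then show ?thesis
      using True Lpos unfolding vq V_def[symmetric] by (simp add: field_simps)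
  next
    case False
    have "0 \<le> ?v" using b_pos N_nonneg by (intro sum_nonneg mult_nonneg_nonneg) (auto simp: less_imp_le)
    then show ?thesis using False Lpos unfolding vq V_def[symmetric]
      by (smt (verit) divide_nonneg_pos mult_nonneg_nonpos)
  qed
qed

end

section \<open>The linear programming bound\<close>

text \<open>Time counts the busy time units only, so that \<open>n T\<close> of them suffice for any policy.\<close>

abbreviation horizon :: "sse_instance \<Rightarrow> nat" where
  "horizon I \<equiv> num_opts I * max_eval I"

text \<open>The second constraint bounds the sum of \<open>y\<close> itself, not of \<open>y\<close>
  times the survival probability. This is stronger than selecting each option at most once in
  expectation, and it lets \<open>y\<close> serve as a law of intended times independent of the
  expiration times.\<close>

definition lp_feasible :: "sse_instance \<Rightarrow> (nat \<Rightarrow> nat \<Rightarrow> real) \<Rightarrow> bool" where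
  "lp_feasible I y \<longleftrightarrow>
     (\<forall>j\<in>opts I. \<forall>t\<in>{1..horizon I}. y j t \<ge> 0) \<and>
     (\<forall>j\<in>opts I. (\<Sum>t=1..horizon I. y j t) \<le> 1) \<and>
     (\<forall>u\<in>{1..horizon I}. (\<Sum>j\<in>opts I. \<Sum>t=1..u.
        y j t * tail (exp_dist I j) t * tail (eval_dist I j) (u - t)) \<le> 1) \<and>
     (\<Sum>j\<in>opts I. \<Sum>t=1..horizon I. wgt I j * (y j t * tail (exp_dist I j) t)) \<le> capacity I"

definition lp_value :: "sse_instance \<Rightarrow> (nat \<Rightarrow> nat \<Rightarrow> real) \<Rightarrow> real" where
  "lp_value I y = (\<Sum>j\<in>opts I. \<Sum>t=1..horizon I. val I j * (y j t * tail (exp_dist I j) t))"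

lemma tail_nonneg [simp]: "0 \<le> tail D t"
  by (simp add: tail_def)

lemma tail_le_1 [simp]: "tail D t \<le> 1"
  by (simp add: tail_def)

lemma tail_antimono: "s \<le> t \<Longrightarrow> tail D t \<le> tail D s"
  unfolding tail_def by (intro measure_pmf.finite_measure_mono) auto

text \<open>Restricting both sets to the supports makes them countable, as
  \<open>measure_pmf_prob_product\<close> requires.\<close>

lemma measure_pair_pmf_Times:
  "measure_pmf.prob (pair_pmf P Q) (B \<times> C) = measure_pmf.prob P B * measure_pmf.prob Q C"
proof -
  have "measure_pmf.prob (pair_pmf P Q) (B \<times> C) =
        measure_pmf.prob (pair_pmf P Q) ((B \<inter> set_pmf P) \<times> (C \<inter> set_pmf Q))"
    by (subst measure_Int_set_pmf[symmetric]) (auto intro: arg_cong[where f = "measure_pmf.prob _"])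
  also have "\<dots> = measure_pmf.prob P (B \<inter> set_pmf P) * measure_pmf.prob Q (C \<inter> set_pmf Q)"
    by (intro measure_pmf_prob_product countable_Int2) auto
  finally show ?thesis by (simp add: measure_Int_set_pmf)
qed

section \<open>Scenarios and their independent coordinates\<close>

context
  fixes I :: sse_instance
  assumes valid: "valid_instance I"
begin

private abbreviation (input) "sc \<equiv> scenarios I"

lemma set_scenarios:
  "set_pmf sc = PiE_dflt (opts I) 0 (set_pmf \<circ> eval_dist I) \<times> PiE_dflt (opts I) 0 (set_pmf \<circ> exp_dist I)"
  by (simp add: scenarios_def set_Pi_pmf)

lemma scenario_upd_eval: "(s, e) \<in> set_pmf sc \<Longrightarrow> j \<in> opts I \<Longrightarrow> a \<in> set_pmf (eval_dist I j) \<Longrightarrow>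
    (s(j := a), e) \<in> set_pmf sc"
  by (auto simp: set_scenarios PiE_dflt_def)

lemma scenario_upd_exp: "(s, e) \<in> set_pmf sc \<Longrightarrow> j \<in> opts I \<Longrightarrow> a \<in> set_pmf (exp_dist I j) \<Longrightarrow>
    (s, e(j := a)) \<in> set_pmf sc"
  by (auto simp: set_scenarios PiE_dflt_def)

lemma eval_range: "j \<in> opts I \<Longrightarrow> a \<in> set_pmf (eval_dist I j) \<Longrightarrow> 1 \<le> a \<and> a \<le> max_eval I"
proof -
  assume j: "j \<in> opts I" and a: "a \<in> set_pmf (eval_dist I j)"
  have "a \<noteq> 0" using valid j a by (auto simp: valid_instance_def intro: ccontr)
  moreover have "a \<le> max_eval I"
  proof (rule ccontr)
    assume "\<not> ?thesis"
    then have "measure_pmf.prob (eval_dist I j) {x. x > max_eval I} \<noteq> 0"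
      using a by (auto simp: measure_pmf_zero_iff)
    then show False using valid j by (auto simp: valid_instance_def tail_def)
  qed
  ultimately show ?thesis by simp
qed

lemma eval_range_scenario: "(s, e) \<in> set_pmf sc \<Longrightarrow> j \<in> opts I \<Longrightarrow> 1 \<le> s j \<and> s j \<le> max_eval I"
  by (rule eval_range) (auto simp: set_scenarios PiE_dflt_def)

lemma max_eval_pos: "max_eval I \<ge> 1"
proof -
  have "1 \<in> opts I" using valid by (auto simp: valid_instance_def)
  moreover obtain a where "a \<in> set_pmf (eval_dist I 1)"
    using set_pmf_not_empty[of "eval_dist I 1"] by blast
  ultimately have "1 \<le> a \<and> a \<le> max_eval I" by (rule eval_range)
  then show ?thesis by simp
qed

lemma exp_tail_pos: "j \<in> opts I \<Longrightarrow> tail (exp_dist I j) t > 0"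
proof -
  assume "j \<in> opts I"
  then have "tail (exp_dist I j) (max 1 t) > 0"
    using valid by (auto simp: valid_instance_def)
  moreover have "tail (exp_dist I j) (max 1 t) \<le> tail (exp_dist I j) t"
    by (rule tail_antimono) simp
  ultimately show ?thesis by linarith
qed

text \<open>Supplies a possible expiration time of \<open>j\<close> that outlives any given number
  of decisions.\<close>

lemma exp_unbounded: "j \<in> opts I \<Longrightarrow> \<exists>M\<in>set_pmf (exp_dist I j). M > N"
proof -
  assume "j \<in> opts I"
  then have "measure_pmf.prob (exp_dist I j) {x. x > N} \<noteq> 0"
    using exp_tail_pos[of j N] by (simp add: tail_def)
  then show ?thesis by (auto simp: measure_pmf_zero_iff)
qed

text \<open>Overwriting coordinate \<open>j\<close> by a constant expresses that the second event
  does not look at the evaluation time of \<open>j\<close>. Splitting this coordinate off the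
  product law then separates the two events.\<close>

lemma prob_eval_indep:
  assumes "j \<in> opts I"
  shows "measure_pmf.prob sc {(s, e). s j \<in> B \<and> (s(j := a), e) \<in> C} =
         measure_pmf.prob (eval_dist I j) B * measure_pmf.prob sc {(s, e). (s(j := a), e) \<in> C}"
proof -
  let ?R = "pair_pmf (Pi_pmf (opts I - {j}) 0 (eval_dist I)) (Pi_pmf (opts I) 0 (exp_dist I))"
  have *: "Pi_pmf (opts I) 0 (eval_dist I) = map_pmf (\<lambda>(y, f). f(j := y))
      (pair_pmf (eval_dist I j) (Pi_pmf (opts I - {j}) 0 (eval_dist I)))"
    using assms by (subst Pi_pmf_insert[symmetric]) (auto simp: insert_absorb)
  have sc: "sc = map_pmf (\<lambda>(y, s, e). (s(j := y), e)) (pair_pmf (eval_dist I j) ?R)"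
    unfolding scenarios_def *
    by (simp add: pair_pmf_def map_pmf_def bind_assoc_pmf bind_return_pmf case_prod_beta)
  have 1: "measure_pmf.prob sc {(s, e). s j \<in> B' \<and> (s(j := a), e) \<in> C} =
        measure_pmf.prob (eval_dist I j) B' * measure_pmf.prob ?R {(s, e). (s(j := a), e) \<in> C}" for B'
    unfolding sc by (subst measure_pair_pmf_Times[symmetric])
      (auto intro!: arg_cong[where f = "measure_pmf.prob _"])
  show ?thesis using 1[of B] 1[of UNIV] by simp
qed

lemma prob_exp_indep:
  assumes "j \<in> opts I"
  shows "measure_pmf.prob sc {(s, e). e j \<in> B \<and> (s, e(j := a)) \<in> C} =
         measure_pmf.prob (exp_dist I j) B * measure_pmf.prob sc {(s, e). (s, e(j := a)) \<in> C}"
proof -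
  let ?R = "pair_pmf (Pi_pmf (opts I) 0 (eval_dist I)) (Pi_pmf (opts I - {j}) 0 (exp_dist I))"
  have *: "Pi_pmf (opts I) 0 (exp_dist I) = map_pmf (\<lambda>(y, f). f(j := y))
      (pair_pmf (exp_dist I j) (Pi_pmf (opts I - {j}) 0 (exp_dist I)))"
    using assms by (subst Pi_pmf_insert[symmetric]) (auto simp: insert_absorb)
  have sc: "sc = map_pmf (\<lambda>(y, s, e). (s, e(j := y))) (pair_pmf (exp_dist I j) ?R)"
    unfolding scenarios_def *
    by (simp add: pair_pmf_def map_pmf_def bind_assoc_pmf bind_return_pmf case_prod_beta)
       (rule bind_commute_pmf)
  have 1: "measure_pmf.prob sc {(s, e). e j \<in> B' \<and> (s, e(j := a)) \<in> C} =
        measure_pmf.prob (exp_dist I j) B' * measure_pmf.prob ?R {(s, e). (s, e(j := a)) \<in> C}" for B'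
    unfolding sc by (subst measure_pair_pmf_Times[symmetric])
      (auto intro!: arg_cong[where f = "measure_pmf.prob _"])
  show ?thesis using 1[of B] 1[of UNIV] by simp
qed

section \<open>Runs of a fixed decision rule and their busy-time clock\<close>

context
  fixes d :: "history \<Rightarrow> nat option"
  assumes legal: "\<And>s e t j. (s, e) \<in> set_pmf sc \<Longrightarrow> free s (selections I d s e t) (Suc t) \<Longrightarrow>
    d (observe I s e (selections I d s e t) (Suc t)) = Some j \<Longrightarrow>
    selectable I e (selections I d s e t) (Suc t) j"
begin

private abbreviation (input) "L \<equiv> selections I d"

text \<open>The index \<open>t\<close> refers to the decision at time \<open>Suc t\<close>, matching
  the recursion of \<open>selections\<close>.\<close>

definition picks :: "(nat \<Rightarrow> nat) \<Rightarrow> (nat \<Rightarrow> nat) \<Rightarrow> nat \<Rightarrow> nat \<Rightarrow> bool" where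
  "picks s e t j \<longleftrightarrow> free s (L s e t) (Suc t) \<and> d (observe I s e (L s e t) (Suc t)) = Some j"

text \<open>\<open>Suc (work s e t)\<close> is the clock of the linear program: the time of a
  selection at \<open>Suc t\<close> with all idle time removed.\<close>

definition work :: "(nat \<Rightarrow> nat) \<Rightarrow> (nat \<Rightarrow> nat) \<Rightarrow> nat \<Rightarrow> nat" where
  "work s e t = (\<Sum>(i, r)\<leftarrow>L s e t. s i)"

lemma picks_unique: "picks s e t j \<Longrightarrow> picks s e t k \<Longrightarrow> k = j"
  by (simp add: picks_def)

lemma L_picks: "picks s e t j \<Longrightarrow> L s e (Suc t) = L s e t @ [(j, Suc t)]"
  by (simp add: picks_def Let_def)

lemma L_idle: "(\<And>j. \<not> picks s e t j) \<Longrightarrow> L s e (Suc t) = L s e t"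
  by (auto simp: picks_def Let_def split: option.splits)

declare selections.simps(2) [simp del]

lemma L_induct [case_names zero idle pick]:
  assumes "P 0 []"
    and "\<And>t. P t (L s e t) \<Longrightarrow> (\<And>j. \<not> picks s e t j) \<Longrightarrow> L s e (Suc t) = L s e t \<Longrightarrow> P (Suc t) (L s e t)"
    and "\<And>t j. P t (L s e t) \<Longrightarrow> picks s e t j \<Longrightarrow> L s e (Suc t) = L s e t @ [(j, Suc t)] \<Longrightarrow>
      P (Suc t) (L s e t @ [(j, Suc t)])"
  shows "P t (L s e t)"
proof (induction t)
  case 0 then show ?case using assms(1) by simp
next
  case (Suc t)
  show ?case
  proof (cases "\<exists>j. picks s e t j")
    case True
    then obtain j where "picks s e t j" by blast
    then show ?thesis using assms(3)[OF Suc, of j] L_picks[of s e t j] by simp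
  next
    case False
    then show ?thesis using assms(2)[OF Suc] L_idle[of s e t] by simp
  qed
qed

lemma picks_selectable: "(s, e) \<in> set_pmf sc \<Longrightarrow> picks s e t j \<Longrightarrow> selectable I e (L s e t) (Suc t) j"
  using legal by (auto simp: picks_def)

lemma L_legal:
  assumes sup: "(s, e) \<in> set_pmf sc"
  shows "fst ` set (L s e t) \<subseteq> opts I \<and> distinct (map fst (L s e t)) \<and>
         (\<Sum>(i, r)\<leftarrow>L s e t. wgt I i) \<le> capacity I"
proof (induction rule: L_induct)
  case zero then show ?case using valid by (simp add: valid_instance_def)
next
  case (pick t j)
  then show ?case using picks_selectable[OF sup pick(2)] by (auto simp: selectable_def)
qed

text \<open>Evaluations run one after another from time 1 on, so their total length fits before any
  time at which all are over. The induction needs the claim for all later \<open>u\<close>, since a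
  new evaluation may end long after its start.\<close>

lemma work_before_free: "t < u \<Longrightarrow> free s (L s e t) u \<Longrightarrow> Suc (work s e t) \<le> u"
proof -
  have "\<forall>u>t. free s (L s e t) u \<longrightarrow> Suc (\<Sum>(i, r)\<leftarrow>L s e t. s i) \<le> u"
  proof (induction rule: L_induct[where P = "\<lambda>t l. \<forall>u>t. free s l u \<longrightarrow> Suc (\<Sum>(i, r)\<leftarrow>l. s i) \<le> u" and s = s and e = e and t = t])
    case (idle t) then show ?case by simp
  next
    case (pick t j)
    from pick(2) have "free s (L s e t) (Suc t)" by (simp add: picks_def)
    with pick(1)[rule_format, of "Suc t"] have 1: "Suc (\<Sum>(i, r)\<leftarrow>L s e t. s i) \<le> Suc t" by simp
    show ?case
    proof safe
      fix u assume "Suc t < u" "free s (L s e t @ [(j, Suc t)]) u"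
      then have "Suc t + s j \<le> u" by (simp add: free_def)
      with 1 show "Suc (\<Sum>(i, r)\<leftarrow>L s e t @ [(j, Suc t)]. s i) \<le> u" by simp
    qed
  qed simp
  then show "t < u \<Longrightarrow> free s (L s e t) u \<Longrightarrow> Suc (work s e t) \<le> u" by (auto simp: work_def)
qed

text \<open>At most n - 1 other options precede \<open>j\<close>, each taking at most T, so its
  clock is at most (n - 1) T + 1. The first bound says that removing idle time moves selections only
  to earlier times.\<close>

lemma work_bounds:
  assumes sup: "(s, e) \<in> set_pmf sc" and p: "picks s e t j"
  shows "Suc (work s e t) \<le> Suc t" "Suc (work s e t) \<le> horizon I"
proof -
  show "Suc (work s e t) \<le> Suc t"
    using p by (intro work_before_free) (auto simp: picks_def)
  let ?A = "fst ` set (L s e t)"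
  have j: "j \<in> opts I" "j \<notin> ?A"
    using picks_selectable[OF sup p] by (auto simp: selectable_def)
  have sub: "?A \<subseteq> opts I - {j}" using L_legal[OF sup, of t] j by auto
  have "work s e t = sum_list (map s (map fst (L s e t)))"
    unfolding work_def by (simp add: case_prod_unfold comp_def)
  also have "\<dots> = (\<Sum>i\<in>?A. s i)"
    using L_legal[OF sup, of t] by (subst sum_list_distinct_conv_sum_set) auto
  also have "\<dots> \<le> (\<Sum>i\<in>?A. max_eval I)"
    using eval_range_scenario[OF sup] sub by (intro sum_mono) auto
  also have "\<dots> \<le> card (opts I - {j}) * max_eval I"
    using card_mono[OF _ sub] by simp
  also have "card (opts I - {j}) = num_opts I - 1" using j by simp
  finally have "work s e t \<le> (num_opts I - 1) * max_eval I" .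
  moreover have "(num_opts I - 1) * max_eval I + max_eval I = horizon I"
    using j by (cases "num_opts I") auto
  ultimately show "Suc (work s e t) \<le> horizon I" using max_eval_pos by linarith
qed

text \<open>An additive statistic of the selections. Summing over all triples, most of which
  contribute 0, turns its expectation into a finite sum of probabilities.\<close>

definition path_sum :: "(nat \<Rightarrow> nat) \<Rightarrow> (nat \<Rightarrow> nat) \<Rightarrow> nat \<Rightarrow> (nat \<Rightarrow> nat \<Rightarrow> real) \<Rightarrow> real" where
  "path_sum s e N f = (\<Sum>t<N. \<Sum>j\<in>opts I. \<Sum>c=1..horizon I.
     if picks s e t j \<and> Suc (work s e t) = c then f j c else 0)"

lemma path_sum_Suc:
  assumes sup: "(s, e) \<in> set_pmf sc"
  shows "picks s e N j \<Longrightarrow> path_sum s e (Suc N) f = path_sum s e N f + f j (Suc (work s e N))"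
    and "(\<And>j. \<not> picks s e N j) \<Longrightarrow> path_sum s e (Suc N) f = path_sum s e N f"
proof -
  assume p: "picks s e N j"
  have j: "j \<in> opts I" using picks_selectable[OF sup p] by (simp add: selectable_def)
  have "(\<Sum>k\<in>opts I. \<Sum>c=1..horizon I. if picks s e N k \<and> Suc (work s e N) = c then f k c else 0)
     = (\<Sum>k\<in>opts I. if k = j then \<Sum>c=1..horizon I. if Suc (work s e N) = c then f k c else 0 else 0)"
  proof (intro sum.cong refl)
    fix k show "(\<Sum>c=1..horizon I. if picks s e N k \<and> Suc (work s e N) = c then f k c else 0) =
       (if k = j then \<Sum>c=1..horizon I. if Suc (work s e N) = c then f k c else 0 else 0)"
      using p picks_unique[OF p, of k] by (cases "k = j") (auto intro!: sum.neutral)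
  qed
  also have "\<dots> = f j (Suc (work s e N))"
    using j work_bounds[OF sup p] by simp
  finally show "path_sum s e (Suc N) f = path_sum s e N f + f j (Suc (work s e N))"
    by (simp add: path_sum_def)
qed (simp add: path_sum_def)

lemma path_sum_list:
  assumes sup: "(s, e) \<in> set_pmf sc"
  shows "path_sum s e N (\<lambda>j c. f j) = (\<Sum>(i, r)\<leftarrow>L s e N. f i)"
proof (induction rule: L_induct)
  case zero then show ?case by (simp add: path_sum_def)
next
  case (idle t) then show ?case using path_sum_Suc(2)[OF sup] by simp
next
  case (pick t j) then show ?case using path_sum_Suc(1)[OF sup] by simp
qed

text \<open>On the clock the evaluations tile an initial segment of the positive integers without
  gap or overlap: a selection at clock \<open>c\<close> occupies \<open>c, ..., c + s j - 1\<close>.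
  So the sum is 1 or 0 according to whether the total work reaches \<open>u\<close>.\<close>

lemma path_sum_busy:
  assumes sup: "(s, e) \<in> set_pmf sc" and u: "u \<ge> 1"
  shows "path_sum s e N (\<lambda>j c. if c \<le> u \<and> u - c < s j then 1 else 0) \<le> 1"
proof -
  have "path_sum s e N (\<lambda>j c. if c \<le> u \<and> u - c < s j then 1 else 0) =
      (if u \<le> (\<Sum>(i, r)\<leftarrow>L s e N. s i) then 1 else 0)"
  proof (induction rule: L_induct[where P = "\<lambda>N l. path_sum s e N (\<lambda>j c. if c \<le> u \<and> u - c < s j then 1 else 0) = (if u \<le> (\<Sum>(i, r)\<leftarrow>l. s i) then 1 else 0)" and s = s and e = e and t = N])
    case zero then show ?case using u by (simp add: path_sum_def cong: if_cong)
  next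
    case (idle t) then show ?case using path_sum_Suc(2)[OF sup] by simp
  next
    case (pick t j) then show ?case
      by (subst path_sum_Suc(1)[OF sup pick(2)]) (auto simp: work_def)
  qed
  then show ?thesis by simp
qed

lemma upd_eval_unselected:
  assumes "j \<notin> fst ` set l"
  shows "free (s(j := a)) l t = free s l t"
    and "observe I (s(j := a)) e l t = observe I s e l t"
    and "map (\<lambda>(i, r). (s(j := a)) i) l = map (\<lambda>(i, r). s i) l"
proof -
  have *: "i \<noteq> j" if "(i, r) \<in> set l" for i r
    using assms that by (metis fst_conv image_eqI)
  show "free (s(j := a)) l t = free s l t"
    using * unfolding free_def by fastforce
  show "observe I (s(j := a)) e l t = observe I s e l t"
    unfolding observe_def using * by fastforce
  show "map (\<lambda>(i, r). (s(j := a)) i) l = map (\<lambda>(i, r). s i) l"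
    using * by fastforce
qed

text \<open>The rule learns the evaluation time of \<open>j\<close> only after having selected
  \<open>j\<close>. Hence changing it affects neither whether and when \<open>j\<close> is picked
  nor the work done before.\<close>

lemma picks_upd_eval:
  assumes sup: "(s, e) \<in> set_pmf sc" and j: "j \<in> opts I" and a: "a \<in> set_pmf (eval_dist I j)"
  shows "picks (s(j := a)) e t j \<longleftrightarrow> picks s e t j"
    and "picks s e t j \<Longrightarrow> work (s(j := a)) e t = work s e t"
proof -
  have eq: "L (s(j := a)) e t = L s e t" if "j \<notin> fst ` set (L s e t)" for s a t
    using that
  proof (induction t)
    case (Suc t)
    have mono: "set (L s e t) \<subseteq> set (L s e (Suc t))"
      by (auto simp: selections.simps Let_def split: option.splits)
    then have notin: "j \<notin> fst ` set (L s e t)" using Suc.prems by blast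
    then have IH: "L (s(j := a)) e t = L s e t" by (rule Suc.IH)
    have "free (s(j := a)) (L s e t) (Suc t) = free s (L s e t) (Suc t)"
      using notin by (rule upd_eval_unselected)
    moreover have "observe I (s(j := a)) e (L s e t) (Suc t) = observe I s e (L s e t) (Suc t)"
      using notin by (rule upd_eval_unselected)
    ultimately show ?case unfolding selections.simps IH Let_def by simp
  qed simp
  have *: "picks (s(j := a)) e t j \<and> work (s(j := a)) e t = work s e t"
    if sup: "(s, e) \<in> set_pmf sc" and p: "picks s e t j" for s a
  proof -
    have notin: "j \<notin> fst ` set (L s e t)"
      using picks_selectable[OF sup p] by (simp add: selectable_def)
    have "free (s(j := a)) (L s e t) (Suc t) = free s (L s e t) (Suc t)"
      using notin by (rule upd_eval_unselected)
    moreover have "observe I (s(j := a)) e (L s e t) (Suc t) = observe I s e (L s e t) (Suc t)"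
      using notin by (rule upd_eval_unselected)
    moreover have "map (\<lambda>(i, r). (s(j := a)) i) (L s e t) = map (\<lambda>(i, r). s i) (L s e t)"
      using notin by (rule upd_eval_unselected)
    ultimately show ?thesis using p eq[OF notin, of a]
      unfolding picks_def work_def by (simp only:)
  qed
  show "picks s e t j \<Longrightarrow> work (s(j := a)) e t = work s e t" using *[OF sup] by simp
  show "picks (s(j := a)) e t j \<longleftrightarrow> picks s e t j"
  proof
    assume "picks (s(j := a)) e t j"
    from *[OF scenario_upd_eval[OF sup j a] this, of "s j"] show "picks s e t j" by simp
  qed (use *[OF sup] in blast)
qed

text \<open>As long as neither the old nor the new expiration time has come, both look the same to
  the rule.\<close>

lemma L_upd_exp: "t < e j \<Longrightarrow> t < M \<Longrightarrow> L s (e(j := M)) t = L s e t"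
proof (induction t)
  case (Suc t)
  have "observe I s (e(j := M)) (L s e t) (Suc t) = observe I s e (L s e t) (Suc t)"
    using Suc.prems by (auto simp: observe_def)
  then show ?case using Suc by (simp only: selections.simps Let_def)
qed simp

lemma picks_upd_exp: "Suc t < e j \<Longrightarrow> Suc t < M \<Longrightarrow> picks s (e(j := M)) t j \<longleftrightarrow> picks s e t j"
proof -
  assume *: "Suc t < e j" "Suc t < M"
  then have "observe I s (e(j := M)) (L s e t) (Suc t) = observe I s e (L s e t) (Suc t)"
    by (auto simp: observe_def)
  then show ?thesis using * by (simp add: picks_def L_upd_exp)
qed

section \<open>Selection probabilities form a feasible solution\<close>

definition pick_prob :: "nat \<Rightarrow> nat \<Rightarrow> nat \<Rightarrow> real" where
  "pick_prob t j c = measure_pmf.prob sc {(s, e). picks s e t j \<and> Suc (work s e t) = c}"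

text \<open>The survival probability is taken at the clock value, not at the actual time, so that
  the objective recovers the selection probabilities exactly. \<open>N\<close> truncates the
  run.\<close>

definition lp_of :: "nat \<Rightarrow> nat \<Rightarrow> nat \<Rightarrow> real" where
  "lp_of N j c = (\<Sum>t<N. pick_prob t j c) / tail (exp_dist I j) c"

lemma lp_of_mult: "j \<in> opts I \<Longrightarrow> lp_of N j c * tail (exp_dist I j) c = (\<Sum>t<N. pick_prob t j c)"
  using exp_tail_pos[of j c] by (simp add: lp_of_def)

lemma path_sum_bound: "\<bar>path_sum s e N f\<bar> \<le>
  (\<Sum>t<N. \<Sum>j\<in>opts I. \<Sum>c=1..horizon I. \<bar>f j c\<bar>)"
  unfolding path_sum_def
  by (intro order_trans[OF sum_abs] sum_mono order_trans[OF sum_abs]) auto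

lemma expectation_path_sum:
  "measure_pmf.expectation sc (\<lambda>(s, e). path_sum s e N (\<lambda>j c. g j c * of_bool (R j c (s j)))) =
   (\<Sum>j\<in>opts I. \<Sum>c=1..horizon I. g j c * (\<Sum>t<N.
     measure_pmf.prob sc {(s, e). picks s e t j \<and> Suc (work s e t) = c \<and> R j c (s j)}))"
proof -
  let ?E = "\<lambda>t j c. {(s, e). picks s e t j \<and> Suc (work s e t) = c \<and> R j c (s j)}"
  have eq: "path_sum s e N (\<lambda>j c. g j c * of_bool (R j c (s j))) =
      (\<Sum>t<N. \<Sum>j\<in>opts I. \<Sum>c=1..horizon I. g j c * indicator (?E t j c) (s, e))" for s e
    unfolding path_sum_def by (intro sum.cong refl) (auto simp: indicator_def)
  have int: "integrable (measure_pmf sc) (\<lambda>x. g j c * indicator (?E t j c) x)" for t j c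
    by (intro integrable_mult_right integrable_real_indicator) (auto simp: less_top[symmetric])
  have "measure_pmf.expectation sc (\<lambda>(s, e). path_sum s e N (\<lambda>j c. g j c * of_bool (R j c (s j)))) =
     measure_pmf.expectation sc (\<lambda>x. \<Sum>t<N. \<Sum>j\<in>opts I. \<Sum>c=1..horizon I. g j c * indicator (?E t j c) x)"
    by (intro Bochner_Integration.integral_cong refl) (auto simp: eq)
  also have "\<dots> = (\<Sum>t<N. \<Sum>j\<in>opts I. \<Sum>c=1..horizon I.
      measure_pmf.expectation sc (\<lambda>x. g j c * indicator (?E t j c) x))"
    by (simp only: Bochner_Integration.integral_sum Bochner_Integration.integrable_sum int)
  also have "\<dots> = (\<Sum>t<N. \<Sum>j\<in>opts I. \<Sum>c=1..horizon I. g j c * measure_pmf.prob sc (?E t j c))"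
    by simp
  also have "\<dots> = (\<Sum>j\<in>opts I. \<Sum>t<N. \<Sum>c=1..horizon I. g j c * measure_pmf.prob sc (?E t j c))"
    by (rule sum.swap)
  also have "\<dots> = (\<Sum>j\<in>opts I. \<Sum>c=1..horizon I. \<Sum>t<N. g j c * measure_pmf.prob sc (?E t j c))"
    by (intro sum.cong refl sum.swap)
  finally show ?thesis by (simp add: sum_distrib_left)
qed

lemma integrable_path_sum: "integrable (measure_pmf sc) (\<lambda>(s, e). path_sum s e N (f s))"
  if "\<And>s j c. \<bar>f s j c\<bar> \<le> B j c"
proof (rule measure_pmf.integrable_const_bound)
  show "AE x in measure_pmf sc. norm (case x of (s, e) \<Rightarrow> path_sum s e N (f s)) \<le>
     (\<Sum>t<N. \<Sum>j\<in>opts I. \<Sum>c=1..horizon I. B j c)"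
  proof (rule AE_I2, safe)
    fix s e
    show "norm (path_sum s e N (f s)) \<le> (\<Sum>t<N. \<Sum>j\<in>opts I. \<Sum>c=1..horizon I. B j c)"
      unfolding real_norm_def by (rule order_trans[OF path_sum_bound]) (intro sum_mono that)
  qed
qed simp

lemma expectation_path_sum_lp:
  "measure_pmf.expectation sc (\<lambda>(s, e). path_sum s e N (\<lambda>j c. f j)) =
   (\<Sum>j\<in>opts I. \<Sum>c=1..horizon I. f j * (lp_of N j c * tail (exp_dist I j) c))"
  using expectation_path_sum[of N "\<lambda>j c. f j" "\<lambda>_ _ _. True"]
  by (simp del: atLeastAtMost_iff) (intro sum.cong refl, simp add: lp_of_mult pick_prob_def)

lemma pmf_expectation_le:
  fixes f :: "_ \<Rightarrow> real"
  assumes "integrable (measure_pmf M) f" "\<And>x. x \<in> set_pmf M \<Longrightarrow> f x \<le> B"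
  shows "measure_pmf.expectation M f \<le> B"
  using assms by (intro measure_pmf.integral_le_const) (auto simp: AE_measure_pmf_iff)

lemma lp_of_nonneg: "0 \<le> lp_of N j c"
  by (simp add: lp_of_def pick_prob_def sum_nonneg)

lemma lp_of_capacity:
  "(\<Sum>j\<in>opts I. \<Sum>c=1..horizon I. wgt I j * (lp_of N j c * tail (exp_dist I j) c)) \<le> capacity I"
  unfolding expectation_path_sum_lp[symmetric]
proof (rule pmf_expectation_le)
  fix x assume "x \<in> set_pmf sc"
  then show "(case x of (s, e) \<Rightarrow> path_sum s e N (\<lambda>j c. wgt I j)) \<le> capacity I"
    using L_legal by (cases x) (simp add: path_sum_list)
qed (rule integrable_path_sum, rule order_refl)

text \<open>Being picked at clock \<open>c\<close> is independent of the evaluation time of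
  \<open>j\<close>, so the probability of being picked at \<open>c\<close> and still under
  evaluation at \<open>u\<close> has the product form of the constraint. The total is the
  expectation of a path sum that is at most 1.\<close>

lemma lp_of_busy:
  assumes u: "u \<in> {1..horizon I}"
  shows "(\<Sum>j\<in>opts I. \<Sum>c=1..u. lp_of N j c * tail (exp_dist I j) c * tail (eval_dist I j) (u - c)) \<le> 1"
proof -
  let ?P = "\<lambda>t j c. measure_pmf.prob sc {(s, e). picks s e t j \<and> Suc (work s e t) = c \<and> u - c < s j}"
  have split: "?P t j c = pick_prob t j c * tail (eval_dist I j) (u - c)" if j: "j \<in> opts I" for t j c
  proof -
    \<comment> \<open>Any possible evaluation time serves as the constant that overwrites the actual
      one.\<close>
    obtain a where a: "a \<in> set_pmf (eval_dist I j)" using set_pmf_not_empty by fast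
    let ?C = "{(s, e). picks s e t j \<and> Suc (work s e t) = c}"
    have *: "(s(j := a), e) \<in> ?C \<longleftrightarrow> (s, e) \<in> ?C" if "(s, e) \<in> set_pmf sc" for s e
      using picks_upd_eval[OF that j a, of t] by auto
    have "?P t j c = measure_pmf.prob sc {(s, e). s j \<in> {x. x > u - c} \<and> (s(j := a), e) \<in> ?C}"
      using * by (intro measure_pmf.finite_measure_eq_AE) (auto simp: AE_measure_pmf_iff)
    also have "\<dots> = tail (eval_dist I j) (u - c) * measure_pmf.prob sc {(s, e). (s(j := a), e) \<in> ?C}"
      unfolding tail_def by (rule prob_eval_indep[OF j])
    also have "measure_pmf.prob sc {(s, e). (s(j := a), e) \<in> ?C} = pick_prob t j c"
      unfolding pick_prob_def
      using * by (intro measure_pmf.finite_measure_eq_AE) (auto simp: AE_measure_pmf_iff)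
    finally show ?thesis by simp
  qed
  have "(\<Sum>j\<in>opts I. \<Sum>c=1..u. lp_of N j c * tail (exp_dist I j) c * tail (eval_dist I j) (u - c)) =
     (\<Sum>j\<in>opts I. \<Sum>c=1..u. \<Sum>t<N. ?P t j c)"
    by (intro sum.cong refl) (simp add: lp_of_mult split sum_distrib_right)
  also have "\<dots> = (\<Sum>j\<in>opts I. \<Sum>c=1..horizon I. of_bool (c \<le> u) * (\<Sum>t<N. ?P t j c))"
    using u by (intro sum.cong refl sum.mono_neutral_cong_left) auto
  also have "\<dots> = measure_pmf.expectation sc (\<lambda>(s, e). path_sum s e N
      (\<lambda>j c. of_bool (c \<le> u) * of_bool (u - c < s j)))"
    by (rule expectation_path_sum[symmetric])
  also have "\<dots> \<le> 1"
  proof (rule pmf_expectation_le)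
    fix x assume x: "x \<in> set_pmf sc"
    obtain s e where [simp]: "x = (s, e)" by (cases x)
    have "(\<lambda>j c. of_bool (c \<le> u) * of_bool (u - c < s j)) = (\<lambda>j c. if c \<le> u \<and> u - c < s j then 1 else (0::real))"
      by (auto simp: fun_eq_iff)
    then show "(case x of (s, e) \<Rightarrow> path_sum s e N (\<lambda>j c. of_bool (c \<le> u) * of_bool (u - c < s j))) \<le> 1"
      using path_sum_busy[of s e u N] x u by simp
  next
    show "integrable (measure_pmf sc) (\<lambda>(s, e). path_sum s e N (\<lambda>j c. of_bool (c \<le> u) * of_bool (u - c < s j)))"
      by (rule integrable_path_sum[where B = "\<lambda>_ _. 1"]) simp
  qed
  finally show ?thesis .
qed

text \<open>Whether \<open>j\<close> is selected at \<open>t\<close> depends on \<open>E\<^sub>j\<close> only through \<open>E\<^sub>j > t\<close>. So fixing \<open>E\<^sub>j\<close> at a value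
  \<open>M\<close> beyond all times \<open>t\<close> divides the selection probabilities by \<open>Pr(E\<^sub>j > t)\<close>, and they still add
  up to at most 1.\<close>

lemma lp_of_once:
  assumes j: "j \<in> opts I"
  shows "(\<Sum>c=1..horizon I. lp_of N j c) \<le> 1"
proof -
  let ?p = "tail (exp_dist I j)"
  obtain M where M: "M \<in> set_pmf (exp_dist I j)" "M > N" using exp_unbounded[OF j] by blast
  define \<phi> where "\<phi> t = measure_pmf.prob sc {(s, e). picks s (e(j := M)) t j}" for t
  have pick_j: "measure_pmf.prob sc {(s, e). picks s e t j} = ?p (Suc t) * \<phi> t" if "t < N" for t
  proof -
    have "(s, e) \<in> set_pmf sc \<Longrightarrow> picks s e t j \<longleftrightarrow> e j > Suc t \<and> picks s (e(j := M)) t j" for s e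
      using picks_selectable[of s e t j] picks_upd_exp[of t e j M s] M that
      by (auto simp: selectable_def)
    then have "measure_pmf.prob sc {(s, e). picks s e t j} =
      measure_pmf.prob sc {(s, e). e j \<in> {x. x > Suc t} \<and> (s, e(j := M)) \<in> {(s, e). picks s e t j}}"
      by (intro measure_pmf.finite_measure_eq_AE) (auto simp: AE_measure_pmf_iff)
    also have "\<dots> = ?p (Suc t) * \<phi> t"
      unfolding tail_def \<phi>_def by (subst prob_exp_indep[OF j]) simp
    finally show ?thesis .
  qed
  have "(\<Sum>c=1..horizon I. lp_of N j c) = (\<Sum>t<N. \<Sum>c=1..horizon I. pick_prob t j c / ?p c)"
    unfolding lp_of_def sum_divide_distrib by (rule sum.swap)
  also have "\<dots> \<le> (\<Sum>t<N. \<phi> t)"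
  proof (rule sum_mono)
    fix t assume "t \<in> {..<N}"
    then have t: "t < N" by simp
    \<comment> \<open>A selection at the actual time \<open>Suc t\<close> has a clock
      \<open>c <= Suc t\<close>, where survival is at least as likely.\<close>
    have "(\<Sum>c=1..horizon I. pick_prob t j c / ?p c) \<le> (\<Sum>c=1..horizon I. pick_prob t j c / ?p (Suc t))"
    proof (rule sum_mono)
      fix c
      show "pick_prob t j c / ?p c \<le> pick_prob t j c / ?p (Suc t)"
      proof (cases "c \<le> Suc t")
        case True
        then show ?thesis using tail_antimono[OF True, of "exp_dist I j"] exp_tail_pos[OF j]
          by (intro divide_left_mono mult_pos_pos) (auto simp: pick_prob_def)
      next
        case False
        have "AE x in measure_pmf sc. x \<notin> {(s, e). picks s e t j \<and> Suc (work s e t) = c}"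
          using work_bounds(1) False by (auto simp: AE_measure_pmf_iff)
        then have "pick_prob t j c = 0"
          unfolding pick_prob_def by (subst measure_pmf.prob_eq_0) auto
        then show ?thesis by simp
      qed
    qed
    also have "\<dots> = (\<Sum>c=1..horizon I. pick_prob t j c) / ?p (Suc t)"
      by (simp add: sum_divide_distrib)
    also have "(\<Sum>c=1..horizon I. pick_prob t j c) =
       measure_pmf.prob sc (\<Union>c\<in>{1..horizon I}. {(s, e). picks s e t j \<and> Suc (work s e t) = c})"
      unfolding pick_prob_def
      by (subst measure_pmf.finite_measure_finite_Union) (auto simp: disjoint_family_on_def)
    also have "\<dots> \<le> measure_pmf.prob sc {(s, e). picks s e t j}"
      by (intro measure_pmf.finite_measure_mono) auto
    finally show "(\<Sum>c=1..horizon I. pick_prob t j c / ?p c) \<le> \<phi> t"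
      using exp_tail_pos[OF j, of "Suc t"] by (simp add: pick_j[OF t] divide_right_mono)
  qed
  \<comment> \<open>As \<open>M\<close> is a possible value of \<open>e j\<close>, the modified
    scenario is again legal. So \<open>j\<close> is picked at most once in it, and the events are
    disjoint for different \<open>t\<close>.\<close>
  also have "\<dots> = measure_pmf.prob sc (\<Union>t\<in>{..<N}. {(s, e). (s, e) \<in> set_pmf sc \<and> picks s (e(j := M)) t j})"
  proof -
    have twice: False if sup: "(s, e) \<in> set_pmf sc" and "t < t'" "picks s e t j" "picks s e t' j" for s e t t'
    proof -
      have "t < t'' \<Longrightarrow> j \<in> fst ` set (L s e t'')" for t''
      proof (induction t'')
        case (Suc t'')
        then show ?case using L_picks[OF that(3)]
          by (cases "t = t''") (auto simp: selections.simps Let_def split: option.splits)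
      qed simp
      then show False using picks_selectable[OF sup that(4)] that(2) by (auto simp: selectable_def)
    qed
    have disj: "disjoint_family_on (\<lambda>t. {(s, e). (s, e) \<in> set_pmf sc \<and> picks s (e(j := M)) t j}) {..<N}"
      unfolding disjoint_family_on_def
      using twice[OF scenario_upd_exp[OF _ j M(1)]] by (auto, metis linorder_neqE_nat)
    have "\<phi> t = measure_pmf.prob sc {(s, e). (s, e) \<in> set_pmf sc \<and> picks s (e(j := M)) t j}" for t
      unfolding \<phi>_def by (intro measure_pmf.finite_measure_eq_AE) (auto simp: AE_measure_pmf_iff)
    then show ?thesis
      using disj by (subst measure_pmf.finite_measure_finite_Union) auto
  qed
  also have "\<dots> \<le> 1" by simp
  finally show ?thesis .
qed

lemma lp_of_feasible: "lp_feasible I (lp_of N)"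
  unfolding lp_feasible_def
  using lp_of_nonneg lp_of_once lp_of_busy lp_of_capacity by blast

text \<open>Since a policy may idle arbitrarily long, \<open>selected\<close> refers to no finite
  time. The bound for \<open>lp_of N\<close> passes to the limit in \<open>N\<close> by dominated
  convergence.\<close>

lemma expectation_selected_le:
  assumes B: "\<And>y. lp_feasible I y \<Longrightarrow> lp_value I y \<le> B"
  shows "measure_pmf.expectation sc (\<lambda>(s, e). \<Sum>j\<in>selected I d s e. val I j) \<le> B"
proof -
  let ?f = "\<lambda>N (s, e). path_sum s e N (\<lambda>j c. val I j)"
  have sum_L: "path_sum s e N (\<lambda>j c. val I j) = (\<Sum>j\<in>fst ` set (L s e N). val I j)"
    if "(s, e) \<in> set_pmf sc" for s e N
  proof -
    have "(\<Sum>(i, r)\<leftarrow>L s e N. val I i) = sum_list (map (val I) (map fst (L s e N)))"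
      by (simp add: case_prod_unfold comp_def)
    then show ?thesis
      using L_legal[OF that, of N] unfolding path_sum_list[OF that]
      by (simp only: sum_list_distinct_conv_sum_set set_map)
  qed
  have mono: "N \<le> N' \<Longrightarrow> set (L s e N) \<subseteq> set (L s e N')" for N N' s e
  proof (induction N')
    case (Suc N') then show ?case
      by (cases "N = Suc N'") (auto simp: selections.simps Let_def split: option.splits)
  qed simp
  have "(\<lambda>N. measure_pmf.expectation sc (?f N)) \<longlonglongrightarrow>
      measure_pmf.expectation sc (\<lambda>(s, e). \<Sum>j\<in>selected I d s e. val I j)"
  proof (rule integral_dominated_convergence[where w = "\<lambda>_. \<Sum>j\<in>opts I. \<bar>val I j\<bar>"])
    show "AE x in measure_pmf sc. (\<lambda>N. ?f N x) \<longlonglongrightarrow> (case x of (s, e) \<Rightarrow> \<Sum>j\<in>selected I d s e. val I j)"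
      unfolding AE_measure_pmf_iff
    proof safe
      fix s e assume x: "(s, e) \<in> set_pmf sc"
      have "\<forall>j\<in>selected I d s e. \<exists>t. j \<in> fst ` set (L s e t)" by (auto simp: selected_def)
      then obtain t where t: "\<And>j. j \<in> selected I d s e \<Longrightarrow> j \<in> fst ` set (L s e (t j))" by metis
      have fin: "finite (selected I d s e)" by (simp add: selected_def)
      have "fst ` set (L s e N) = selected I d s e" if N: "N \<ge> (\<Sum>j\<in>selected I d s e. t j)" for N
      proof
        show "fst ` set (L s e N) \<subseteq> selected I d s e"
          using L_legal[OF x, of N] by (auto simp: selected_def)
        show "selected I d s e \<subseteq> fst ` set (L s e N)"
        proof
          fix j assume j: "j \<in> selected I d s e"
          have "t j \<le> N" using N member_le_sum[OF j, of t] fin by simp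
          then show "j \<in> fst ` set (L s e N)" using t[OF j] mono by blast
        qed
      qed
      then have "\<forall>\<^sub>F N in sequentially. path_sum s e N (\<lambda>j c. val I j) = (\<Sum>j\<in>selected I d s e. val I j)"
        unfolding sum_L[OF x] eventually_sequentially by metis
      then show "(\<lambda>N. path_sum s e N (\<lambda>j c. val I j)) \<longlonglongrightarrow> (\<Sum>j\<in>selected I d s e. val I j)"
        by (rule tendsto_eventually)
    qed
    fix N
    show "AE x in measure_pmf sc. norm (?f N x) \<le> (\<Sum>j\<in>opts I. \<bar>val I j\<bar>)"
      unfolding AE_measure_pmf_iff
    proof safe
      fix s e assume x: "(s, e) \<in> set_pmf sc"
      show "norm (path_sum s e N (\<lambda>j c. val I j)) \<le> (\<Sum>j\<in>opts I. \<bar>val I j\<bar>)"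
        using L_legal[OF x, of N] unfolding sum_L[OF x] real_norm_def
        by (intro order_trans[OF sum_abs] sum_mono2) auto
    qed
  qed auto
  then show ?thesis
  proof (rule LIMSEQ_le_const2)
    show "\<exists>N. \<forall>n\<ge>N. measure_pmf.expectation sc (?f n) \<le> B"
      using B[OF lp_of_feasible] unfolding expectation_path_sum_lp lp_value_def by auto
  qed
qed

end
end

section \<open>Averaging over the seed\<close>

lemma prob_space_seed: "prob_space seed"
proof -
  interpret prob_space "restrict_space lborel {0..1::real}"
    by (rule prob_spaceI) (simp add: emeasure_restrict_space space_restrict_space)
  interpret product_prob_space "\<lambda>_. restrict_space lborel {0..1::real}" UNIV ..
  show ?thesis unfolding seed_def by (rule prob_space_axioms)
qed

text \<open>Fubini reduces the claim to a fixed seed. Joint measurability of the integrand is not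
  established; if it is not integrable, the integral is 0 by convention, which explains the
  assumption \<open>0 \<le> B\<close>.\<close>

lemma expected_value_le_pointwise:
  assumes B: "0 \<le> B" "\<And>u. u \<in> space seed \<Longrightarrow>
      (\<integral>x. (case x of (s, e) \<Rightarrow> \<Sum>j\<in>selected I (\<pi> u) s e. val I j) \<partial>measure_pmf (scenarios I)) \<le> B"
  shows "expected_value I \<pi> \<le> B"
proof (cases "integrable (measure_pmf (scenarios I) \<Otimes>\<^sub>M seed)
    (\<lambda>(x, u). case x of (s, e) \<Rightarrow> \<Sum>j\<in>selected I (\<pi> u) s e. val I j)")
  case True
  interpret S: prob_space seed by (rule prob_space_seed)
  interpret P: pair_prob_space "measure_pmf (scenarios I)" seed ..
  let ?g = "\<lambda>x u. case x of (s, e) \<Rightarrow> \<Sum>j\<in>selected I (\<pi> u) s e. val I j"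
  have "expected_value I \<pi> = integral\<^sup>L (measure_pmf (scenarios I) \<Otimes>\<^sub>M seed) (case_prod ?g)"
    unfolding expected_value_def by (intro Bochner_Integration.integral_cong) auto
  also have "\<dots> = (\<integral>u. (\<integral>x. ?g x u \<partial>measure_pmf (scenarios I)) \<partial>seed)"
    using True by (rule P.integral_snd[symmetric])
  also have "\<dots> \<le> B"
    using True B by (intro S.integral_le_const P.integrable_snd AE_I2) auto
  finally show ?thesis .
next
  case False
  have "expected_value I \<pi> = 0"
    unfolding expected_value_def using False
    by (intro not_integrable_integral_eq) (auto simp: case_prod_unfold)
  then show ?thesis using B by simp
qed

lemma online_policy_legal:
  assumes "online_policy I \<pi>" "u \<in> space seed" "(s, e) \<in> set_pmf (scenarios I)"
    "free s (selections I (\<pi> u) s e t) (Suc t)" "\<pi> u (observe I s e (selections I (\<pi> u) s e t) (Suc t)) = Some j"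
  shows "selectable I e (selections I (\<pi> u) s e t) (Suc t) j"
  using assms unfolding online_policy_def Let_def by fastforce

theorem expected_value_le_lp:
  assumes valid: "valid_instance I" and pol: "online_policy I \<pi>"
    and B: "\<And>y. lp_feasible I y \<Longrightarrow> lp_value I y \<le> B"
  shows "expected_value I \<pi> \<le> B"
proof (rule expected_value_le_pointwise)
  have "lp_feasible I (\<lambda>_ _. 0)" using valid by (simp add: lp_feasible_def valid_instance_def)
  from B[OF this] show "0 \<le> B" by (simp add: lp_value_def)
  fix u assume u: "u \<in> space seed"
  show "(\<integral>x. (case x of (s, e) \<Rightarrow> \<Sum>j\<in>selected I (\<pi> u) s e. val I j) \<partial>measure_pmf (scenarios I)) \<le> B"
    using valid online_policy_legal[OF pol u] B by (rule expectation_selected_le)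
qed

section \<open>Selection probabilities of independent plans\<close>

text \<open>The Taylor polynomial of \<open>exp (- m)\<close> of degree 3, in place of \<open>exp (- m)\<close> because programs
  have only the field operations.\<close>

definition thin :: "real \<Rightarrow> real" where
  "thin m = 1 - m * (1 - m / 2 * (1 - m / 3))"

text \<open>In the sum of \<open>thin\<close> and its derivative everything cancels except
  \<open>- x^3 / 6\<close>, so the product with \<open>exp\<close> has a nonpositive derivative. At
  \<open>a = 0\<close> this bounds \<open>thin\<close> from above by \<open>exp (- m)\<close>; at
  \<open>b = 4 / 5\<close> it gives a lower bound of exponential shape.\<close>

lemma thin_exp_antimono:
  assumes "0 \<le> a" "a \<le> b"
  shows "thin b * exp b \<le> thin a * exp a"
proof (rule DERIV_nonpos_imp_nonincreasing[OF assms(2)])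
  fix x assume "a \<le> x" "x \<le> b"
  have "((\<lambda>x. thin x * exp x) has_real_derivative - (x ^ 3 / 6) * exp x) (at x)"
    unfolding thin_def
    by (auto intro!: derivative_eq_intros simp: field_simps power3_eq_cube power2_eq_square)
  moreover have "- (x ^ 3 / 6) * exp x \<le> 0"
    using assms(1) \<open>a \<le> x\<close> by (intro mult_nonpos_nonneg) auto
  ultimately show "\<exists>y. ((\<lambda>x. thin x * exp x) has_real_derivative y) (at x) \<and> y \<le> 0" by blast
qed

lemma thin_le_exp: "0 \<le> m \<Longrightarrow> thin m \<le> exp (- m)"
  using thin_exp_antimono[of 0 m] by (simp add: thin_def exp_minus field_simps)

lemma thin_lower: "0 \<le> m \<Longrightarrow> m \<le> 4 / 5 \<Longrightarrow> thin (4 / 5) * exp (4 / 5 - m) \<le> thin m"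
  using thin_exp_antimono[of m "4 / 5"] unfolding exp_diff by (simp add: pos_divide_le_eq)

lemma thin_pos: "0 \<le> m \<Longrightarrow> m \<le> 4 / 5 \<Longrightarrow> 0 \<le> thin m"
proof -
  assume m: "0 \<le> m" "m \<le> 4 / 5"
  have "0 \<le> thin (4 / 5) * exp (4 / 5 - m)" by (simp add: thin_def)
  with thin_lower[OF m] show ?thesis by linarith
qed

lemma thin_le_1: "0 \<le> m \<Longrightarrow> thin m \<le> 1"
  using thin_le_exp[of m] by (smt (verit) exp_le_one_iff)

text \<open>A Riemann sum of the decreasing function \<open>exp (-m)\<close>.\<close>

lemma thin_sum_le:
  fixes d m :: "nat \<Rightarrow> real"
  assumes "\<And>s. s \<in> {1..t} \<Longrightarrow> 0 \<le> d s" "\<And>s. s \<in> {1..t} \<Longrightarrow> (\<Sum>r=1..s. d r) \<le> m s"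
  shows "(\<Sum>s=1..t. d s * thin (m s)) \<le> 1 - exp (- (\<Sum>s=1..t. d s))"
  using assms
proof (induction t)
  case (Suc t)
  let ?S = "\<Sum>r=1..t. d r"
  have m: "?S + d (Suc t) \<le> m (Suc t)" and d: "0 \<le> d (Suc t)" using Suc.prems[of "Suc t"] by auto
  have S: "0 \<le> ?S" using Suc.prems by (intro sum_nonneg) auto
  have "d (Suc t) * thin (m (Suc t)) \<le> d (Suc t) * exp (- (?S + d (Suc t)))"
    using m S d thin_le_exp[of "m (Suc t)"] by (intro mult_left_mono) (auto intro: order_trans)
  \<comment> \<open>A rectangle under the decreasing curve; its area is bounded through
    \<open>1 + d <= exp d\<close>.\<close>
  also have "\<dots> \<le> exp (- ?S) - exp (- (?S + d (Suc t)))"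
  proof -
    have "d (Suc t) * exp (- (?S + d (Suc t))) \<le> (exp (d (Suc t)) - 1) * exp (- (?S + d (Suc t)))"
      using exp_ge_add_one_self[of "d (Suc t)"] by (intro mult_right_mono) (linarith, simp)
    then show ?thesis by (simp add: algebra_simps flip: exp_add)
  qed
  finally show ?case using Suc.IH Suc.prems by simp
qed simp

text \<open>Computed from \<open>y\<close> and not from the thinned rates, which avoids a recursion
  over time; it is an upper bound for the blocking probability.\<close>

definition capped :: "sse_instance \<Rightarrow> (nat \<Rightarrow> nat \<Rightarrow> real) \<Rightarrow> nat \<Rightarrow> nat \<Rightarrow> real" where
  "capped I y j t = (\<Sum>s=1..t. 4 / 5 * y j s * tail (exp_dist I j) s * tail (eval_dist I j) (t - s))"

definition rate :: "sse_instance \<Rightarrow> (nat \<Rightarrow> nat \<Rightarrow> real) \<Rightarrow> nat \<Rightarrow> nat \<Rightarrow> real" where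
  "rate I y j t = 4 / 5 * y j t * thin (capped I y j t)"

text \<open>The value \<open>Suc (horizon I)\<close> takes the remaining mass and means that the
  option is never intended.\<close>

definition plan_pmf :: "sse_instance \<Rightarrow> (nat \<Rightarrow> nat \<Rightarrow> real) \<Rightarrow> nat \<Rightarrow> nat pmf" where
  "plan_pmf I y j = embed_pmf (\<lambda>t. if t \<in> {1..horizon I} then rate I y j t
     else if t = Suc (horizon I) then 1 - (\<Sum>s=1..horizon I. rate I y j s) else 0)"

text \<open>One option: intended selection time, expiration time, evaluation time.\<close>

definition fate :: "sse_instance \<Rightarrow> (nat \<Rightarrow> nat \<Rightarrow> real) \<Rightarrow> nat \<Rightarrow> (nat \<times> nat \<times> nat) pmf" where
  "fate I y j = pair_pmf (plan_pmf I y j) (pair_pmf (exp_dist I j) (eval_dist I j))"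

definition fates :: "sse_instance \<Rightarrow> (nat \<Rightarrow> nat \<Rightarrow> real) \<Rightarrow> (nat \<Rightarrow> nat \<times> nat \<times> nat) pmf" where
  "fates I y = Pi_pmf (opts I) (0, 0, 0) (fate I y)"

definition Start :: "nat \<Rightarrow> (nat \<times> nat \<times> nat) set" where
  "Start t = {(a, b, c). a = t \<and> b > t}"

definition Cand :: "nat \<Rightarrow> (nat \<times> nat \<times> nat) set" where
  "Cand t = {(a, b, c). 1 \<le> a \<and> a \<le> t \<and> b > a}"

definition Block :: "nat \<Rightarrow> (nat \<times> nat \<times> nat) set" where
  "Block t = {(a, b, c). 1 \<le> a \<and> a \<le> t \<and> b > a \<and> t < a + c}"

text \<open>The weight counts all candidates, selected or not, so the event refers to the fates of
  the options only and not to earlier selections of the policy.\<close>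

definition Chosen :: "sse_instance \<Rightarrow> nat \<Rightarrow> nat \<Rightarrow> (nat \<Rightarrow> nat \<times> nat \<times> nat) set" where
  "Chosen I j t = {\<omega>. \<omega> j \<in> Start t \<and> (\<forall>i\<in>opts I - {j}. \<omega> i \<notin> Block t) \<and>
     (\<Sum>i\<in>opts I. wgt I i * indicator (Cand t) (\<omega> i)) \<le> capacity I}"

section \<open>Probabilities of blocking and selection\<close>

context
  fixes I :: sse_instance and y :: "nat \<Rightarrow> nat \<Rightarrow> real"
  assumes valid: "valid_instance I" and feas: "lp_feasible I y"
begin

private abbreviation (input) "p j \<equiv> tail (exp_dist I j)"
private abbreviation (input) "F j \<equiv> tail (eval_dist I j)"

lemma y_nonneg: "j \<in> opts I \<Longrightarrow> t \<in> {1..horizon I} \<Longrightarrow> 0 \<le> y j t"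
  using feas by (auto simp: lp_feasible_def)

lemma capped_nonneg: "j \<in> opts I \<Longrightarrow> t \<in> {1..horizon I} \<Longrightarrow> 0 \<le> capped I y j t"
  unfolding capped_def using y_nonneg[of j] by (intro sum_nonneg) auto

lemma capped_total: "t \<in> {1..horizon I} \<Longrightarrow> (\<Sum>j\<in>opts I. capped I y j t) \<le> 4 / 5"
proof -
  assume t: "t \<in> {1..horizon I}"
  have "(\<Sum>j\<in>opts I. capped I y j t) = 4 / 5 * (\<Sum>j\<in>opts I. \<Sum>s=1..t. y j s * p j s * F j (t - s))"
    by (simp add: capped_def sum_distrib_left mult_ac)
  moreover have "(\<Sum>j\<in>opts I. \<Sum>s=1..t. y j s * p j s * F j (t - s)) \<le> 1"
    using feas t by (auto simp: lp_feasible_def)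
  ultimately show ?thesis by simp
qed

lemma capped_le: "j \<in> opts I \<Longrightarrow> t \<in> {1..horizon I} \<Longrightarrow> capped I y j t \<le> 4 / 5"
  using capped_total[of t] capped_nonneg
  by (intro order_trans[OF member_le_sum[of j "opts I" "\<lambda>j. capped I y j t"]]) auto

lemma rate_nonneg: "j \<in> opts I \<Longrightarrow> t \<in> {1..horizon I} \<Longrightarrow> 0 \<le> rate I y j t"
  unfolding rate_def using y_nonneg capped_nonneg capped_le thin_pos by simp

lemma rate_le: "j \<in> opts I \<Longrightarrow> t \<in> {1..horizon I} \<Longrightarrow> rate I y j t \<le> 4 / 5 * y j t"
  unfolding rate_def using y_nonneg[of j t] capped_nonneg[of j t] thin_le_1
  by (intro mult_left_le) auto

lemma rate_sum: "j \<in> opts I \<Longrightarrow> (\<Sum>t=1..horizon I. rate I y j t) \<le> 1"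
proof -
  assume j: "j \<in> opts I"
  have "(\<Sum>t=1..horizon I. rate I y j t) \<le> (\<Sum>t=1..horizon I. 4 / 5 * y j t)"
    using rate_le[OF j] by (intro sum_mono)
  also have "\<dots> = 4 / 5 * (\<Sum>t=1..horizon I. y j t)" by (simp add: sum_distrib_left)
  also have "\<dots> \<le> 4 / 5 * 1" using feas j by (intro mult_left_mono) (auto simp: lp_feasible_def)
  finally show ?thesis by simp
qed

lemma pmf_plan:
  assumes j: "j \<in> opts I"
  shows "pmf (plan_pmf I y j) t = (if t \<in> {1..horizon I} then rate I y j t
     else if t = Suc (horizon I) then 1 - (\<Sum>s=1..horizon I. rate I y j s) else 0)"
proof -
  let ?f = "\<lambda>t. if t \<in> {1..horizon I} then rate I y j t
     else if t = Suc (horizon I) then 1 - (\<Sum>s=1..horizon I. rate I y j s) else 0"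
  have nn: "0 \<le> ?f t" for t
    using rate_nonneg[OF j] rate_sum[OF j] by (cases "t \<in> {1..horizon I}") (simp, simp)
  have "(\<integral>\<^sup>+ t. ennreal (?f t) \<partial>count_space UNIV) = (\<Sum>t\<in>{1..Suc (horizon I)}. ennreal (?f t))"
    by (rule nn_integral_count_space') (auto split: if_splits)
  also have "\<dots> = ennreal (\<Sum>t\<in>{1..Suc (horizon I)}. ?f t)"
    using nn by (intro sum_ennreal)
  also have "(\<Sum>t\<in>{1..Suc (horizon I)}. ?f t) = (\<Sum>t=1..horizon I. rate I y j t) + (1 - (\<Sum>s=1..horizon I. rate I y j s))"
    by simp
  finally have "(\<integral>\<^sup>+ t. ennreal (?f t) \<partial>count_space UNIV) = 1" by simp
  then show ?thesis unfolding plan_pmf_def using nn by (subst pmf_embed_pmf) auto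
qed

private abbreviation (input) "PF j \<equiv> measure_pmf.prob (fate I y j)"

lemma prob_point: "j \<in> opts I \<Longrightarrow> s \<in> {1..horizon I} \<Longrightarrow>
    PF j ({s} \<times> {x. x > s} \<times> C) = rate I y j s * p j s * measure_pmf.prob (eval_dist I j) C"
  by (simp add: fate_def measure_pair_pmf_Times measure_pmf_single pmf_plan tail_def del: Times_subset_cancel2)

lemma prob_Start: "j \<in> opts I \<Longrightarrow> t \<in> {1..horizon I} \<Longrightarrow> PF j (Start t) = rate I y j t * p j t"
proof -
  have "Start t = {t} \<times> {x. x > t} \<times> UNIV" by (auto simp: Start_def)
  then show "j \<in> opts I \<Longrightarrow> t \<in> {1..horizon I} \<Longrightarrow> ?thesis" by (simp only: prob_point) simp
qed

lemma prob_Cand: "j \<in> opts I \<Longrightarrow> t \<in> {1..horizon I} \<Longrightarrow> PF j (Cand t) = (\<Sum>s=1..t. rate I y j s * p j s)"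
proof -
  assume *: "j \<in> opts I" "t \<in> {1..horizon I}"
  have "Cand t = (\<Union>s\<in>{1..t}. {s} \<times> {x. x > s} \<times> UNIV)" by (auto simp: Cand_def)
  also have "PF j \<dots> = (\<Sum>s=1..t. PF j ({s} \<times> {x. x > s} \<times> UNIV))"
    by (intro measure_pmf.finite_measure_finite_Union) (auto simp: disjoint_family_on_def)
  also have "\<dots> = (\<Sum>s=1..t. rate I y j s * p j s)"
    using * by (intro sum.cong refl, subst prob_point) auto
  finally show ?thesis .
qed

lemma prob_Block: "j \<in> opts I \<Longrightarrow> t \<in> {1..horizon I} \<Longrightarrow> PF j (Block t) = (\<Sum>s=1..t. rate I y j s * p j s * F j (t - s))"
proof -
  assume *: "j \<in> opts I" "t \<in> {1..horizon I}"
  have "Block t = (\<Union>s\<in>{1..t}. {s} \<times> {x. x > s} \<times> {x. x > t - s})" by (auto simp: Block_def)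
  also have "PF j \<dots> = (\<Sum>s=1..t. PF j ({s} \<times> {x. x > s} \<times> {x. x > t - s}))"
    by (intro measure_pmf.finite_measure_finite_Union) (auto simp: disjoint_family_on_def)
  also have "\<dots> = (\<Sum>s=1..t. rate I y j s * p j s * F j (t - s))"
    using * by (intro sum.cong refl, subst prob_point) (auto simp: tail_def)
  finally show ?thesis .
qed

text \<open>An option intended at \<open>r\<close> blocks time \<open>t\<close> with weight
  \<open>F (t - r)\<close>, which is at most its weight \<open>F (s - r)\<close> at an earlier time
  \<open>s\<close>. Hence the partial sums up to \<open>s\<close> stay below
  \<open>capped I y j s\<close>, as \<open>thin_sum_le\<close> requires.\<close>

lemma prob_unblocked:
  assumes j: "j \<in> opts I" and t: "t \<in> {1..horizon I}"
  shows "exp (- capped I y j t) \<le> 1 - PF j (Block t)"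
proof -
  let ?d = "\<lambda>s. 4 / 5 * y j s * p j s * F j (t - s)"
  have nn: "0 \<le> ?d s" if "s \<in> {1..t}" for s using y_nonneg[OF j, of s] t that by simp
  have "(\<Sum>s=1..t. ?d s * thin (capped I y j s)) \<le> 1 - exp (- (\<Sum>s=1..t. ?d s))"
  proof (rule thin_sum_le)
    fix s assume s: "s \<in> {1..t}"
    show "(\<Sum>r=1..s. ?d r) \<le> capped I y j s"
      unfolding capped_def
    proof (rule sum_mono)
      fix r assume r: "r \<in> {1..s}"
      show "?d r \<le> 4 / 5 * y j r * p j r * F j (s - r)"
        using y_nonneg[OF j, of r] r s t by (intro mult_left_mono tail_antimono) auto
    qed
  qed (rule nn)
  then have "PF j (Block t) \<le> 1 - exp (- capped I y j t)"
    using j t by (simp add: prob_Block rate_def capped_def mult_ac)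
  then show ?thesis by simp
qed

lemma w_max_ge: "j \<in> opts I \<Longrightarrow> wgt I j \<le> w_max I"
  unfolding w_max_def by (intro Max_ge) auto

lemma wgt_nonneg: "j \<in> opts I \<Longrightarrow> 0 \<le> wgt I j"
  using valid by (auto simp: valid_instance_def)

lemma cand_weight: 
  assumes t: "t \<in> {1..horizon I}"
  shows "(\<Sum>j\<in>opts I. wgt I j * PF j (Cand t)) \<le> 4 / 5 * capacity I"
proof -
  have "(\<Sum>j\<in>opts I. wgt I j * PF j (Cand t)) \<le> (\<Sum>j\<in>opts I. \<Sum>s=1..horizon I. 4 / 5 * (wgt I j * (y j s * p j s)))"
  proof (rule sum_mono)
    fix j assume j: "j \<in> opts I"
    have "wgt I j * PF j (Cand t) = (\<Sum>s=1..t. wgt I j * (rate I y j s * p j s))"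
      using j t by (simp add: prob_Cand sum_distrib_left)
    also have "\<dots> \<le> (\<Sum>s=1..t. wgt I j * ((4 / 5 * y j s) * p j s))"
      using j t rate_le[OF j] wgt_nonneg[OF j] by (intro sum_mono mult_left_mono mult_right_mono) auto
    also have "\<dots> \<le> (\<Sum>s=1..horizon I. wgt I j * ((4 / 5 * y j s) * p j s))"
      using t wgt_nonneg[OF j] y_nonneg[OF j] by (intro sum_mono2) auto
    finally show "wgt I j * PF j (Cand t) \<le> (\<Sum>s=1..horizon I. 4 / 5 * (wgt I j * (y j s * p j s)))"
      by (simp add: mult_ac)
  qed
  also have "\<dots> = 4 / 5 * (\<Sum>j\<in>opts I. \<Sum>s=1..horizon I. wgt I j * (y j s * p j s))"
    by (simp add: sum_distrib_left)
  also have "\<dots> \<le> 4 / 5 * capacity I"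
    using feas by (intro mult_left_mono) (auto simp: lp_feasible_def)
  finally show ?thesis .
qed

text \<open>Conditioning on not being blocked by \<open>i\<close> only makes it less likely that \<open>i\<close> is a candidate,
  so the exponential moment of its weight stays bounded as in Hoeffding's inequality.\<close>

lemma unblocked_moment:
  assumes i: "i \<in> opts I" and t: "t \<in> {1..horizon I}" and h: "0 \<le> h"
  shows "measure_pmf.expectation (fate I y i) (\<lambda>x. indicator (- Block t) x * exp (h * (wgt I i * indicator (Cand t) x)))
     \<le> (1 - PF i (Block t)) * exp (h * (wgt I i * PF i (Cand t)) + h\<^sup>2 * (w_max I)\<^sup>2 / 8)"
proof -
  let ?w = "wgt I i" and ?q = "PF i (Cand t)" and ?m = "PF i (Block t)"
  have sub: "Block t \<subseteq> Cand t" by (auto simp: Block_def Cand_def)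
  have eq: "(\<lambda>x. indicator (- Block t) x * exp (h * (?w * indicator (Cand t) x))) =
    (\<lambda>x. (1 - indicator (Cand t) x) + exp (h * ?w) * (indicator (Cand t) x - indicator (Block t) x) :: real)"
    using sub by (auto simp: fun_eq_iff indicator_def)
  have int: "integrable (measure_pmf (fate I y i)) (indicator A :: _ \<Rightarrow> real)" for A
    by (intro integrable_real_indicator) (auto simp: less_top[symmetric])
  have "measure_pmf.expectation (fate I y i) (\<lambda>x. indicator (- Block t) x * exp (h * (?w * indicator (Cand t) x)))
      = (1 - ?q) + exp (h * ?w) * (?q - ?m)"
    unfolding eq using int by simp
  also have "\<dots> = (1 - ?m) + (?q - ?m) * (exp (h * ?w) - 1)"
    by (simp add: algebra_simps)
  also have "\<dots> \<le> (1 - ?m) + ?q * (1 - ?m) * (exp (h * ?w) - 1)"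
  proof -
    have "?m * ?q \<le> ?m" by (intro mult_left_le) auto
    then have "?q - ?m \<le> ?q * (1 - ?m)" by (simp add: algebra_simps)
    then show ?thesis using h wgt_nonneg[OF i] by (intro add_left_mono mult_right_mono) auto
  qed
  also have "\<dots> = (1 - ?m) * (1 + ?q * (exp (h * ?w) - 1))"
    by (simp add: algebra_simps)
  also have "1 + ?q * (exp (h * ?w) - 1) \<le> exp (h * (?w * ?q) + h\<^sup>2 * (w_max I)\<^sup>2 / 8)"
  proof -
    have pos: "0 < 1 + ?q * (exp (h * ?w) - 1)"
      using h wgt_nonneg[OF i] by (intro add_pos_nonneg mult_nonneg_nonneg) auto
    \<comment> \<open>Hoeffding's bound for the cumulant generating function of a Bernoulli variable
      with mean \<open>?q\<close>.\<close>
    have "ln (1 + ?q * (exp (h * ?w) - 1)) \<le> h * ?w * ?q + (h * ?w)\<^sup>2 / 8"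
      using Hoeffdings_lemma_aux[of "h * ?w" ?q] h wgt_nonneg[OF i] by simp
    also have "(h * ?w)\<^sup>2 \<le> h\<^sup>2 * (w_max I)\<^sup>2"
      using wgt_nonneg[OF i] w_max_ge[OF i] unfolding power_mult_distrib
      by (intro mult_left_mono power_mono) auto
    finally have "ln (1 + ?q * (exp (h * ?w) - 1)) \<le> h * (?w * ?q) + h\<^sup>2 * (w_max I)\<^sup>2 / 8"
      by (simp add: mult_ac)
    then show ?thesis using pos by (metis exp_le_cancel_iff exp_ln)
  qed
  finally show ?thesis by (simp add: mult_left_mono)
qed

text \<open>A Chernoff bound within the event that \<open>j\<close> starts and nobody else blocks,
  but without conditioning: the indicator of \<open>Chosen\<close> is bounded below by a difference
  of two products over the options, whose expectations factor by independence.\<close>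

lemma prob_Chosen:
  assumes j: "j \<in> opts I" and t: "t \<in> {1..horizon I}"
    and small: "\<And>i. i \<in> opts I \<Longrightarrow> 10 * wgt I i \<le> capacity I"
  shows "PF j (Start t) * (\<Prod>i\<in>opts I - {j}. 1 - PF i (Block t)) * knapsack_factor (1 / 50) I
     \<le> measure_pmf.prob (fates I y) (Chosen I j t)"
proof -
  define R where "R = opts I - {j}"
  have R: "finite R" "j \<notin> R" "opts I = insert j R" "\<And>i. i \<in> R \<Longrightarrow> i \<in> opts I"
    using j by (auto simp: R_def)
  let ?a = "PF j (Start t)" and ?U = "\<Prod>i\<in>R. 1 - PF i (Block t)"
  \<comment> \<open>At \<open>h = 0\<close> the product over the options is the indicator that
    \<open>j\<close> starts and no other option blocks. In general it is weighted by the exponential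
    of the weight of the other candidates.\<close>
  define \<phi> where "\<phi> h i x = (if i = j then indicator (Start t) x else
     indicator (- Block t) x * exp (h * (wgt I i * indicator (Cand t) x)))" for h :: real and i and x :: "nat \<times> nat \<times> nat"
  have int_prod: "integrable (measure_pmf (fates I y)) (\<lambda>\<omega>. \<Prod>i\<in>opts I. \<phi> h i (\<omega> i))" for h
  proof -
    have "integrable (measure_pmf (fate I y i)) (\<phi> h i)" if "i \<in> opts I" for i
    proof (rule measure_pmf.integrable_const_bound)
      show "AE x in measure_pmf (fate I y i). norm (\<phi> h i x) \<le> max 1 (exp (h * wgt I i))"
        by (auto simp: \<phi>_def indicator_def le_max_iff_disj)
    qed simp
    then show ?thesis unfolding fates_def by (intro integrable_prod_Pi_pmf) auto
  qed
  have E\<phi>: "measure_pmf.expectation (fates I y) (\<lambda>\<omega>. \<Prod>i\<in>opts I. \<phi> h i (\<omega> i)) =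
     ?a * (\<Prod>i\<in>R. measure_pmf.expectation (fate I y i) (\<lambda>x. indicator (- Block t) x * exp (h * (wgt I i * indicator (Cand t) x))))" for h
  proof -
    have "measure_pmf.expectation (fates I y) (\<lambda>\<omega>. \<Prod>i\<in>opts I. \<phi> h i (\<omega> i)) =
      (\<Prod>i\<in>opts I. measure_pmf.expectation (fate I y i) (\<phi> h i))"
      unfolding fates_def
    proof (rule expectation_prod_Pi_pmf)
      fix i assume "i \<in> opts I"
      show "integrable (measure_pmf (fate I y i)) (\<phi> h i)"
      proof (rule measure_pmf.integrable_const_bound)
        show "AE x in measure_pmf (fate I y i). norm (\<phi> h i x) \<le> max 1 (exp (h * wgt I i))"
          by (auto simp: \<phi>_def indicator_def le_max_iff_disj)
      qed simp
    qed (auto simp: \<phi>_def)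
    also have "\<dots> = measure_pmf.expectation (fate I y j) (\<phi> h j) * (\<Prod>i\<in>R. measure_pmf.expectation (fate I y i) (\<phi> h i))"
      using R by simp
    also have "(\<Prod>i\<in>R. measure_pmf.expectation (fate I y i) (\<phi> h i)) =
      (\<Prod>i\<in>R. measure_pmf.expectation (fate I y i) (\<lambda>x. indicator (- Block t) x * exp (h * (wgt I i * indicator (Cand t) x))))"
      using R by (intro prod.cong refl Bochner_Integration.integral_cong) (auto simp: \<phi>_def)
    finally show ?thesis by (simp add: \<phi>_def[abs_def])
  qed
  have E0: "measure_pmf.expectation (fates I y) (\<lambda>\<omega>. \<Prod>i\<in>opts I. \<phi> 0 i (\<omega> i)) = ?a * ?U"
  proof -
    have "measure_pmf.expectation (fate I y i) (indicator (- Block t) :: _ \<Rightarrow> real) = 1 - PF i (Block t)" for i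
      by (simp add: measure_pmf.prob_compl[symmetric] Compl_eq_Diff_UNIV)
    then show ?thesis unfolding E\<phi> by simp
  qed
  have \<phi>_prod: "(\<Prod>i\<in>opts I. \<phi> h i (\<omega> i)) = indicator (Start t) (\<omega> j) * (\<Prod>i\<in>R. indicator (- Block t) (\<omega> i)) *
      exp (h * (\<Sum>i\<in>R. wgt I i * indicator (Cand t) (\<omega> i)))" for h \<omega>
  proof -
    have "(\<Prod>i\<in>opts I. \<phi> h i (\<omega> i)) = indicator (Start t) (\<omega> j) * (\<Prod>i\<in>R. \<phi> h i (\<omega> i))"
      using R by (simp add: \<phi>_def)
    also have "(\<Prod>i\<in>R. \<phi> h i (\<omega> i)) = (\<Prod>i\<in>R. indicator (- Block t) (\<omega> i) * exp (h * (wgt I i * indicator (Cand t) (\<omega> i))))"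
      using R by (intro prod.cong refl) (auto simp: \<phi>_def)
    finally show ?thesis using R(1) by (simp only: prod.distrib exp_sum sum_distrib_left mult.assoc)
  qed
  have U0: "0 \<le> ?U" by (intro prod_nonneg) auto
  have chosen: "\<omega> \<in> Chosen I j t" if "\<omega> j \<in> Start t" "\<And>i. i \<in> R \<Longrightarrow> \<omega> i \<notin> Block t"
      "(\<Sum>i\<in>R. wgt I i * indicator (Cand t) (\<omega> i)) + wgt I j \<le> capacity I" for \<omega>
  proof -
    have "wgt I j * indicator (Cand t) (\<omega> j) \<le> wgt I j"
      using wgt_nonneg[OF j] by (simp add: indicator_def)
    moreover have "(\<Sum>i\<in>opts I. wgt I i * indicator (Cand t) (\<omega> i)) =
        wgt I j * indicator (Cand t) (\<omega> j) + (\<Sum>i\<in>R. wgt I i * indicator (Cand t) (\<omega> i))"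
      unfolding R(3) using R(1,2) by (rule sum.insert)
    ultimately have "(\<Sum>i\<in>opts I. wgt I i * indicator (Cand t) (\<omega> i)) \<le> capacity I"
      using that(3) by linarith
    then show ?thesis using that by (simp add: Chosen_def R_def)
  qed
  have ind01: "(\<Prod>i\<in>R. indicator (- Block t) (\<omega> i)) = (if \<forall>i\<in>R. \<omega> i \<notin> Block t then 1 else (0::real))" for \<omega>
    using R(1) by (auto simp: indicator_def)
  show ?thesis
  proof (cases "w_max I = 0")
    case True
    have w0: "wgt I i = 0" if "i \<in> opts I" for i
      using wgt_nonneg[OF that] w_max_ge[OF that] True by simp
    have W: "0 \<le> capacity I" using valid by (simp add: valid_instance_def)
    have "?a * ?U \<le> measure_pmf.expectation (fates I y) (indicator (Chosen I j t))"
      unfolding E0[symmetric]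
    proof (rule integral_mono[OF int_prod])
      fix \<omega>
      show "(\<Prod>i\<in>opts I. \<phi> 0 i (\<omega> i)) \<le> indicator (Chosen I j t) \<omega>"
        unfolding \<phi>_prod ind01 using chosen[of \<omega>] w0 R(4) j W by (auto simp: indicator_def)
    qed (auto intro!: integrable_real_indicator simp: less_top[symmetric])
    then show ?thesis using True by (simp add: knapsack_factor_def R_def)
  next
    case False
    define n w W where "n = real (num_opts I)" and "w = w_max I" and "W = capacity I"
    have "1 \<in> opts I" using valid by (auto simp: valid_instance_def)
    then have wpos: "w > 0" using wgt_nonneg[of 1] w_max_ge[of 1] False by (simp add: w_def)
    have npos: "n > 0" using valid by (auto simp: valid_instance_def n_def)
    have Wpos: "0 \<le> W" using valid by (simp add: valid_instance_def W_def)
    \<comment> \<open>Minimiser of \<open>- h * W / 10 + n * h^2 * w^2 / 8\<close>, where W/10 is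
      what remains of W after W/10 for \<open>j\<close> and 4W/5 for the expected candidates. The
      minimum is \<open>- (1/50) * W^2 / (n * w^2)\<close>.\<close>
    define h where "h = 2 / 5 * W / (n * w\<^sup>2)"
    have h0: "0 \<le> h" using wpos npos Wpos by (simp add: h_def)
    define c where "c = exp (h * (wgt I j - W))"
    let ?E2 = "\<Prod>i\<in>R. measure_pmf.expectation (fate I y i) (\<lambda>x. indicator (- Block t) x * exp (h * (wgt I i * indicator (Cand t) x)))"
    have "?a * ?U - c * (?a * ?E2) = measure_pmf.expectation (fates I y)
       (\<lambda>\<omega>. (\<Prod>i\<in>opts I. \<phi> 0 i (\<omega> i)) - c * (\<Prod>i\<in>opts I. \<phi> h i (\<omega> i)))"
      using int_prod by (simp add: E0[symmetric] E\<phi>[symmetric])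
    \<comment> \<open>If the weights fit, the first product is at most the indicator of
      \<open>Chosen\<close>. If they do not, the second product, scaled by \<open>c\<close>, is at
      least the first.\<close>
    also have "\<dots> \<le> measure_pmf.expectation (fates I y) (indicator (Chosen I j t))"
    proof (rule integral_mono)
      fix \<omega>
      let ?S = "\<Sum>i\<in>R. wgt I i * indicator (Cand t) (\<omega> i)"
      have "c * exp (h * ?S) = exp (h * (?S + wgt I j - W))"
        by (simp add: c_def algebra_simps flip: exp_add)
      moreover have "1 \<le> exp (h * (?S + wgt I j - W))" if "\<not> ?S + wgt I j \<le> W"
        using that h0 by simp
      ultimately show "(\<Prod>i\<in>opts I. \<phi> 0 i (\<omega> i)) - c * (\<Prod>i\<in>opts I. \<phi> h i (\<omega> i)) \<le> indicator (Chosen I j t) \<omega>"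
        unfolding \<phi>_prod ind01 using chosen[of \<omega>] by (auto simp: indicator_def W_def)
    next
      show "integrable (measure_pmf (fates I y)) (\<lambda>\<omega>. (\<Prod>i\<in>opts I. \<phi> 0 i (\<omega> i)) - c * (\<Prod>i\<in>opts I. \<phi> h i (\<omega> i)))"
        by (intro Bochner_Integration.integrable_diff integrable_mult_right int_prod)
    qed (auto intro!: integrable_real_indicator simp: less_top[symmetric])
    finally have 1: "?a * (?U - c * ?E2) \<le> measure_pmf.prob (fates I y) (Chosen I j t)"
      by (simp add: algebra_simps)
    have "?E2 \<le> (\<Prod>i\<in>R. (1 - PF i (Block t)) * exp (h * (wgt I i * PF i (Cand t)) + h\<^sup>2 * w\<^sup>2 / 8))"
      unfolding w_def using R t h0
      by (intro prod_mono conjI unblocked_moment Bochner_Integration.integral_nonneg) auto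
    also have "\<dots> = ?U * exp ((\<Sum>i\<in>R. h * (wgt I i * PF i (Cand t))) + real (card R) * (h\<^sup>2 * w\<^sup>2 / 8))"
      using R by (simp add: prod.distrib exp_sum sum.distrib flip: exp_sum)
    finally have "c * ?E2 \<le> ?U * exp (h * (wgt I j - W) + ((\<Sum>i\<in>R. h * (wgt I i * PF i (Cand t))) + real (card R) * (h\<^sup>2 * w\<^sup>2 / 8)))"
      unfolding exp_add[of "h * (wgt I j - W)"] c_def by (simp add: mult.left_commute)
    also have "\<dots> \<le> ?U * exp (- (1 / 50) * W\<^sup>2 / (n * w\<^sup>2))"
    proof (intro mult_left_mono U0, subst exp_le_cancel_iff)
      have "(\<Sum>i\<in>R. wgt I i * PF i (Cand t)) \<le> (\<Sum>i\<in>opts I. wgt I i * PF i (Cand t))"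
        using R wgt_nonneg by (intro sum_mono2) auto
      also have "\<dots> \<le> 4 / 5 * W" unfolding W_def by (rule cand_weight[OF t])
      finally have A: "h * (\<Sum>i\<in>R. wgt I i * PF i (Cand t)) \<le> h * (4 / 5 * W)"
        using h0 by (intro mult_left_mono)
      have B: "h * (wgt I j - W) \<le> h * (W / 10 - W)"
        using small[OF j] h0 by (intro mult_left_mono) (auto simp: W_def)
      have "card R \<le> num_opts I" unfolding R_def using card_Diff1_le[of "opts I" j] by simp
      then have C: "real (card R) * (h\<^sup>2 * w\<^sup>2 / 8) \<le> n * (h\<^sup>2 * w\<^sup>2 / 8)"
        unfolding n_def by (intro mult_right_mono) auto
      have D: "h * (W / 10 - W) + h * (4 / 5 * W) + n * (h\<^sup>2 * w\<^sup>2 / 8) = - (1 / 50) * W\<^sup>2 / (n * w\<^sup>2)"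
        using npos wpos unfolding h_def by (simp add: field_simps power2_eq_square)
      show "h * (wgt I j - W) + ((\<Sum>i\<in>R. h * (wgt I i * PF i (Cand t))) + real (card R) * (h\<^sup>2 * w\<^sup>2 / 8))
         \<le> - (1 / 50) * W\<^sup>2 / (n * w\<^sup>2)"
        using A B C D unfolding sum_distrib_left by linarith
    qed
    finally have "?a * (?U * (1 - exp (- (1 / 50) * W\<^sup>2 / (n * w\<^sup>2)))) \<le> ?a * (?U - c * ?E2)"
      by (intro mult_left_mono) (auto simp: algebra_simps)
    with 1 have "?a * ?U * (1 - exp (- (1 / 50) * W\<^sup>2 / (n * w\<^sup>2))) \<le> measure_pmf.prob (fates I y) (Chosen I j t)"
      by (simp only: mult.assoc)
    moreover have "knapsack_factor (1 / 50) I = 1 - exp (- (1 / 50) * W\<^sup>2 / (n * w\<^sup>2))"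
      using False unfolding knapsack_factor_def W_def n_def w_def by simp
    ultimately show ?thesis by (simp only: R_def)
  qed
qed

lemma knapsack_factor_nonneg: "0 \<le> c \<Longrightarrow> 0 \<le> knapsack_factor c I"
  by (auto simp: knapsack_factor_def)

theorem expected_chosen:
  assumes small: "\<And>i. i \<in> opts I \<Longrightarrow> 10 * wgt I i \<le> capacity I"
  shows "0.3477 * knapsack_factor (1 / 50) I * lp_value I y
     \<le> (\<Sum>j\<in>opts I. \<Sum>t=1..horizon I. val I j * measure_pmf.prob (fates I y) (Chosen I j t))"
  unfolding lp_value_def sum_distrib_left
proof (intro sum_mono)
  fix j t assume j: "j \<in> opts I" and t: "t \<in> {1..horizon I}"
  let ?k = "knapsack_factor (1 / 50) I"
  have k0: "0 \<le> ?k" by (rule knapsack_factor_nonneg) simp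
  let ?m = "\<lambda>i. capped I y i t"
  have "(\<Sum>i\<in>opts I - {j}. ?m i) + ?m j \<le> 4 / 5"
    using capped_total[OF t] sum.remove[OF _ j, of ?m] by simp
  then have "thin (4 / 5) \<le> thin (?m j) * exp (- (\<Sum>i\<in>opts I - {j}. ?m i))"
  proof -
    assume *: "(\<Sum>i\<in>opts I - {j}. ?m i) + ?m j \<le> 4 / 5"
    have "thin (4 / 5) = thin (4 / 5) * exp (4 / 5 - ?m j) * exp (- (4 / 5 - ?m j))"
      by (simp flip: exp_add)
    also have "\<dots> \<le> thin (?m j) * exp (- (4 / 5 - ?m j))"
      using thin_lower capped_nonneg[OF j t] capped_le[OF j t] by (intro mult_right_mono) auto
    also have "\<dots> \<le> thin (?m j) * exp (- (\<Sum>i\<in>opts I - {j}. ?m i))"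
      using * thin_pos capped_nonneg[OF j t] capped_le[OF j t] by (intro mult_left_mono) auto
    finally show ?thesis .
  qed
  also have "exp (- (\<Sum>i\<in>opts I - {j}. ?m i)) = (\<Prod>i\<in>opts I - {j}. exp (- ?m i))"
    by (simp add: exp_sum flip: sum_negf)
  also have "\<dots> \<le> (\<Prod>i\<in>opts I - {j}. 1 - PF i (Block t))"
    using prob_unblocked t by (intro prod_mono) auto
  finally have "thin (4 / 5) \<le> thin (?m j) * (\<Prod>i\<in>opts I - {j}. 1 - PF i (Block t))"
    using thin_pos capped_nonneg[OF j t] capped_le[OF j t] by (auto simp: mult_left_mono)
  then have "(4 / 5 * y j t * p j t * ?k) * thin (4 / 5)
     \<le> (4 / 5 * y j t * p j t * ?k) * (thin (?m j) * (\<Prod>i\<in>opts I - {j}. 1 - PF i (Block t)))"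
    using y_nonneg[OF j t] k0 by (intro mult_left_mono) auto
  also have "\<dots> = PF j (Start t) * (\<Prod>i\<in>opts I - {j}. 1 - PF i (Block t)) * ?k"
    using j t by (simp add: prob_Start rate_def mult_ac)
  also have "\<dots> \<le> measure_pmf.prob (fates I y) (Chosen I j t)"
    using j t small by (rule prob_Chosen)
  finally have *: "(4 / 5 * y j t * p j t * ?k) * thin (4 / 5) \<le> measure_pmf.prob (fates I y) (Chosen I j t)" .
  \<comment> \<open>\<open>4 / 5 * thin (4 / 5)\<close> equals 0.34773..., rounded down
    here.\<close>
  have "0.3477 * ?k * (y j t * p j t) \<le> (4 / 5 * thin (4 / 5)) * ?k * (y j t * p j t)"
    using y_nonneg[OF j t] k0 by (intro mult_right_mono) (auto simp: thin_def)
  also have "\<dots> \<le> measure_pmf.prob (fates I y) (Chosen I j t)" using * by (simp add: mult_ac)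
  finally have "val I j * (0.3477 * ?k * (y j t * p j t)) \<le> val I j * measure_pmf.prob (fates I y) (Chosen I j t)"
    using valid j by (intro mult_left_mono) (auto simp: valid_instance_def intro: less_imp_le)
  then show "0.3477 * ?k * (val I j * (y j t * p j t)) \<le> val I j * measure_pmf.prob (fates I y) (Chosen I j t)"
    by (simp add: mult_ac)
qed

end

section \<open>The online policy\<close>

text \<open>Inverse-transform sampling. The value \<open>Suc N\<close> absorbs the mass missing from
  \<open>r\<close>; the disjunct \<open>N < t\<close> guarantees that the least element
  exists.\<close>

definition quantile :: "(nat \<Rightarrow> real) \<Rightarrow> nat \<Rightarrow> real \<Rightarrow> nat" where
  "quantile r N u = (LEAST t. 1 \<le> t \<and> (N < t \<or> u < (\<Sum>s=1..t. r s)))"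

lemma quantile_prop:
  "1 \<le> quantile r N u" "N < quantile r N u \<or> u < (\<Sum>s=1..quantile r N u. r s)" "quantile r N u \<le> Suc N"
proof -
  have *: "1 \<le> Suc N \<and> (N < Suc N \<or> u < (\<Sum>s=1..Suc N. r s))" by simp
  show "1 \<le> quantile r N u" "N < quantile r N u \<or> u < (\<Sum>s=1..quantile r N u. r s)"
    using LeastI[of "\<lambda>t. 1 \<le> t \<and> (N < t \<or> u < (\<Sum>s=1..t. r s))", OF *] by (auto simp: quantile_def)
  show "quantile r N u \<le> Suc N" 
    unfolding quantile_def by (rule Least_le[of "\<lambda>t. 1 \<le> t \<and> (N < t \<or> u < (\<Sum>s=1..t. r s))", OF *])
qed

lemma quantile_before: "1 \<le> t \<Longrightarrow> t < quantile r N u \<Longrightarrow> (\<Sum>s=1..t. r s) \<le> u"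
  using not_less_Least[of t "\<lambda>t. 1 \<le> t \<and> (N < t \<or> u < (\<Sum>s=1..t. r s))"] by (auto simp: quantile_def)

lemma quantile_eq_iff:
  assumes r: "\<And>s. s \<in> {1..N} \<Longrightarrow> 0 \<le> r s" and t: "t \<in> {1..N}" and u: "0 \<le> u"
  shows "quantile r N u = t \<longleftrightarrow> (\<Sum>s=1..t - 1. r s) \<le> u \<and> u < (\<Sum>s=1..t. r s)"
proof
  assume q: "quantile r N u = t"
  show "(\<Sum>s=1..t - 1. r s) \<le> u \<and> u < (\<Sum>s=1..t. r s)"
    using quantile_before[of "t - 1" r N u] quantile_prop(2)[of N r u] q t u by (cases "t = 1") auto
next
  assume *: "(\<Sum>s=1..t - 1. r s) \<le> u \<and> u < (\<Sum>s=1..t. r s)"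
  show "quantile r N u = t" unfolding quantile_def
  proof (rule Least_equality)
    fix t' assume t': "1 \<le> t' \<and> (N < t' \<or> u < (\<Sum>s=1..t'. r s))"
    show "t \<le> t'"
    proof (rule ccontr)
      assume "\<not> t \<le> t'"
      then have "(\<Sum>s=1..t'. r s) \<le> (\<Sum>s=1..t - 1. r s)"
        using t r by (intro sum_mono2) auto
      then show False using t' * \<open>\<not> t \<le> t'\<close> t by auto
    qed
  qed (use * t in auto)
qed

lemma quantile_beyond_iff:
  assumes r: "\<And>s. s \<in> {1..N} \<Longrightarrow> 0 \<le> r s" and u: "0 \<le> u"
  shows "quantile r N u = Suc N \<longleftrightarrow> (\<Sum>s=1..N. r s) \<le> u"
proof
  assume q: "quantile r N u = Suc N"
  show "(\<Sum>s=1..N. r s) \<le> u"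
    using quantile_before[of N r N u] q u by (cases "N = 0") auto
next
  assume *: "(\<Sum>s=1..N. r s) \<le> u"
  show "quantile r N u = Suc N"
  proof (rule ccontr)
    assume "quantile r N u \<noteq> Suc N"
    then have q: "quantile r N u \<le> N" using quantile_prop(3)[of r N u] by simp
    then have "u < (\<Sum>s=1..quantile r N u. r s)" using quantile_prop(2)[of N r u] by auto
    also have "\<dots> \<le> (\<Sum>s=1..N. r s)" using q r by (intro sum_mono2) auto
    finally show False using * by simp
  qed
qed

abbreviation unit_uniform :: "real measure" where
  "unit_uniform \<equiv> restrict_space lborel {0..1}"

text \<open>The preimages are the half-open intervals between consecutive partial sums, and the
  closed interval from the total mass to 1 for the value \<open>Suc N\<close>.\<close>

lemma quantile_law:
  assumes r: "\<And>s. s \<in> {1..N} \<Longrightarrow> 0 \<le> r s" and r1: "(\<Sum>s=1..N. r s) \<le> 1"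
    and t: "t \<in> {1..Suc N}"
  shows "{u \<in> {0..1}. quantile r N u = t} \<in> sets unit_uniform"
    and "emeasure unit_uniform {u \<in> {0..1}. quantile r N u = t} =
      ennreal (if t \<le> N then r t else 1 - (\<Sum>s=1..N. r s))"
proof -
  define C where "C t = (\<Sum>s=1..t. r s)" for t
  have C0: "0 \<le> C k" if "k \<le> N" for k unfolding C_def using r that by (intro sum_nonneg) simp
  have C1: "C k \<le> 1" if "k \<le> N" for k
  proof -
    have "C k \<le> C N" unfolding C_def using r that by (intro sum_mono2) simp_all
    then show ?thesis using r1 by (simp add: C_def)
  qed
  define A where "A = {u \<in> {0..1}. quantile r N u = t}"
  have "A \<in> sets unit_uniform \<and> emeasure unit_uniform A = ennreal (if t \<le> N then r t else 1 - C N)"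
  proof (cases "t \<le> N")
    case True
    have "A = {C (t - 1)..<C t}"
    proof (intro set_eqI)
      fix u
      have *: "0 \<le> C (t - 1)" using True by (intro C0) simp
      have "quantile r N u = t \<longleftrightarrow> C (t - 1) \<le> u \<and> u < C t" if "0 \<le> u"
        unfolding C_def by (rule quantile_eq_iff) (use r t True that in simp_all)
      then show "u \<in> A \<longleftrightarrow> u \<in> {C (t - 1)..<C t}"
        using * C1[OF True] unfolding A_def mem_Collect_eq atLeastAtMost_iff atLeastLessThan_iff by linarith
    qed
    moreover have "C t = C (t - 1) + r t" using t unfolding C_def by (cases t) simp_all
    moreover have "0 \<le> r t" using r t True by simp
    moreover have "{C (t - 1)..<C t} \<subseteq> {0..1}" 
    proof (rule subsetI, simp only: atLeastLessThan_iff atLeastAtMost_iff)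
      fix x assume "C (t - 1) \<le> x \<and> x < C t"
      moreover have "0 \<le> C (t - 1)" using True by (intro C0) simp
      ultimately show "0 \<le> x \<and> x \<le> 1" using C1[OF True] by linarith
    qed
    ultimately show ?thesis using True by (simp add: sets_restrict_space_iff emeasure_restrict_space)
  next
    case False
    then have tN: "t = Suc N" using t by simp
    have "A = {C N..1}"
    proof (intro set_eqI)
      fix u
      have "quantile r N u = t \<longleftrightarrow> C N \<le> u" if "0 \<le> u"
        unfolding C_def tN by (rule quantile_beyond_iff) (use r that in simp_all)
      then show "u \<in> A \<longleftrightarrow> u \<in> {C N..1}"
        using C0[of N] unfolding A_def mem_Collect_eq atLeastAtMost_iff by linarith
    qed
    moreover have "{C N..1} \<subseteq> {0..1}" using C0[of N] by (intro subsetI) simp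
    ultimately show ?thesis using False C1[of N] by (simp add: sets_restrict_space_iff emeasure_restrict_space)
  qed
  then show "{u \<in> {0..1}. quantile r N u = t} \<in> sets unit_uniform"
    "emeasure unit_uniform {u \<in> {0..1}. quantile r N u = t} =
      ennreal (if t \<le> N then r t else 1 - (\<Sum>s=1..N. r s))"
    unfolding A_def C_def by simp_all
qed

text \<open>Surjectivity comes for free: as both total masses are 1, a different image law would
  exceed \<open>M\<close> at some point \<open>f x\<close>, but by injectivity its mass there is
  that of \<open>x\<close>.\<close>

lemma map_pmf_preserving:
  assumes inj: "inj_on f (set_pmf M)" and pres: "\<And>x. x \<in> set_pmf M \<Longrightarrow> pmf M (f x) = pmf M x"
  shows "map_pmf f M = M"
proof (rule ccontr)
  assume "map_pmf f M \<noteq> M"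
  then obtain z where z: "pmf M z < pmf (map_pmf f M) z"
    using pmf_neq_exists_less[of M "map_pmf f M"] by metis
  then have "z \<in> set_pmf (map_pmf f M)" by (metis not_less pmf_nonneg set_pmf_iff)
  then obtain x where x: "x \<in> set_pmf M" "z = f x" by auto
  have "pmf (map_pmf f M) (f x) = pmf M x"
    using inj x(1) by (rule pmf_map_inj)
  then show False using z pres[OF x(1)] x(2) by simp
qed

text \<open>\<open>None\<close> means unexpired or selected; in both cases an option whose intended
  time has come was unexpired at that time. For an expired option the observed expiration time
  decides.\<close>

definition candidate :: "(nat \<Rightarrow> nat) \<Rightarrow> history \<Rightarrow> nat \<Rightarrow> bool" where
  "candidate \<tau> h i \<longleftrightarrow> \<tau> i \<le> now h \<and>
     (case expired h ! (i - 1) of None \<Rightarrow> True | Some x \<Rightarrow> \<tau> i < x)"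

text \<open>Selected options are left out: whenever the decision-maker is free, their evaluations
  are over. All others use the simulated time \<open>g i\<close>.\<close>

definition blocker :: "(nat \<Rightarrow> nat) \<Rightarrow> (nat \<Rightarrow> nat) \<Rightarrow> history \<Rightarrow> nat \<Rightarrow> bool" where
  "blocker \<tau> g h i \<longleftrightarrow> candidate \<tau> h i \<and> i \<notin> fst ` set (past h) \<and> now h < \<tau> i + g i"

text \<open>The bound 2 accounts for \<open>j\<close>, which counts as a blocker at its own intended
  time.\<close>

definition eligible :: "sse_instance \<Rightarrow> (nat \<Rightarrow> nat) \<Rightarrow> (nat \<Rightarrow> nat) \<Rightarrow> history \<Rightarrow> nat \<Rightarrow> bool" where
  "eligible I \<tau> g h j \<longleftrightarrow> \<tau> j = now h \<and> now h \<le> horizon I \<and> j \<notin> fst ` set (past h) \<and>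
     expired h ! (j - 1) = None \<and> card {i \<in> opts I. blocker \<tau> g h i} < 2 \<and>
     (\<Sum>i\<in>opts I. if candidate \<tau> h i then wgt I i else 0) \<le> capacity I"

text \<open>The result of a loop that overwrites its answer; 0 is the output code for selecting
  nothing.\<close>

primrec last_such :: "(nat \<Rightarrow> bool) \<Rightarrow> nat \<Rightarrow> nat" where
  "last_such P 0 = 0"
| "last_such P (Suc k) = (if P (Suc k) then Suc k else last_such P k)"

lemma last_such: "last_such P n = 0 \<and> (\<forall>j\<in>{1..n}. \<not> P j) \<or> last_such P n \<in> {1..n} \<and> P (last_such P n)"
  by (induction n) (auto simp: le_Suc_eq)

definition as_option :: "nat \<Rightarrow> nat option" where
  "as_option k = (if k = 0 then None else Some k)"

definition plan_rule :: "sse_instance \<Rightarrow> (nat \<Rightarrow> nat) \<Rightarrow> (nat \<Rightarrow> nat) \<Rightarrow> history \<Rightarrow> nat option" where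
  "plan_rule I \<tau> g h = as_option (last_such (eligible I \<tau> g h) (num_opts I))"

lemma plan_rule_Some: "plan_rule I \<tau> g h = Some j \<Longrightarrow> j \<in> opts I \<and> eligible I \<tau> g h j"
  using last_such[of "eligible I \<tau> g h" "num_opts I"] by (auto simp: plan_rule_def as_option_def split: if_splits)

lemma plan_rule_None: "plan_rule I \<tau> g h = None \<Longrightarrow> j \<in> opts I \<Longrightarrow> \<not> eligible I \<tau> g h j"
  using last_such[of "eligible I \<tau> g h" "num_opts I"] by (auto simp: plan_rule_def as_option_def split: if_splits)

lemma observe_simps:
  "now (observe I s e L t) = t"
  "fst ` set (past (observe I s e L t)) = fst ` set L"
  "j \<in> opts I \<Longrightarrow> expired (observe I s e L t) ! (j - 1) =
     (if j \<in> fst ` set L \<or> e j > t then None else Some (e j))"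
proof -
  assume j: "j \<in> opts I"
  then have "[1..<Suc (num_opts I)] ! (j - 1) = j" "j - 1 < length [1..<Suc (num_opts I)]"
    by (auto simp del: upt_Suc)
  then show "expired (observe I s e L t) ! (j - 1) =
     (if j \<in> fst ` set L \<or> e j > t then None else Some (e j))"
    unfolding observe_def history.sel by (simp only: nth_map)
qed (simp_all add: observe_def image_image case_prod_unfold del: upt_Suc)

lemma plan_rule_L:
  fixes I \<tau> g s e
  defines "L \<equiv> selections I (plan_rule I \<tau> g) s e"
  shows "(i, r) \<in> set (L t) \<Longrightarrow> i \<in> opts I \<and> \<tau> i = r \<and> r \<le> t"
    and "distinct (map fst (L t))"
proof -
  have "(\<forall>(i, r)\<in>set (L t). i \<in> opts I \<and> \<tau> i = r \<and> r \<le> t) \<and> distinct (map fst (L t))"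
  proof (induction t)
    case (Suc t)
    have "L (Suc t) = L t \<or> (\<exists>j. plan_rule I \<tau> g (observe I s e (L t) (Suc t)) = Some j \<and> L (Suc t) = L t @ [(j, Suc t)])"
      by (auto simp: L_def Let_def split: option.splits)
    then show ?case
    proof
      assume "\<exists>j. plan_rule I \<tau> g (observe I s e (L t) (Suc t)) = Some j \<and> L (Suc t) = L t @ [(j, Suc t)]"
      then obtain j where j: "plan_rule I \<tau> g (observe I s e (L t) (Suc t)) = Some j" "L (Suc t) = L t @ [(j, Suc t)]"
        by blast
      show ?thesis using plan_rule_Some[OF j(1)] j(2) Suc by (force simp: eligible_def observe_simps)
    qed (use Suc in force)
  qed (simp add: L_def)
  then show "(i, r) \<in> set (L t) \<Longrightarrow> i \<in> opts I \<and> \<tau> i = r \<and> r \<le> t" "distinct (map fst (L t))" by auto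
qed

text \<open>All selected options are candidates, so the capacity test on the candidates covers
  them.\<close>

lemma plan_rule_selectable:
  fixes I \<tau> g s e t
  defines "L \<equiv> selections I (plan_rule I \<tau> g) s e t"
  assumes valid: "valid_instance I" and j: "plan_rule I \<tau> g (observe I s e L (Suc t)) = Some j"
  shows "selectable I e L (Suc t) j"
proof -
  let ?h = "observe I s e L (Suc t)"
  have el: "j \<in> opts I" "eligible I \<tau> g ?h j" using plan_rule_Some[OF j] by auto
  have notin: "j \<notin> fst ` set L" and ej: "e j > Suc t" and \<tau>: "\<tau> j = Suc t"
    using el(2) unfolding eligible_def observe_simps(1,2) observe_simps(3)[OF el(1)] by (auto split: if_splits)
  have cand: "candidate \<tau> ?h i" if "i \<in> insert j (fst ` set L)" for i
  proof (cases "i = j")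
    case True then show ?thesis using el by (auto simp: eligible_def candidate_def)
  next
    case False
    then have i: "i \<in> fst ` set L" using that by simp
    then have "i \<in> opts I" "\<tau> i \<le> t" using plan_rule_L(1)[of _ _ I \<tau> g s e t] by (auto simp: L_def)
    then show ?thesis using i unfolding candidate_def observe_simps(3)[OF \<open>i \<in> opts I\<close>] by (simp add: observe_simps)
  qed
  have sub: "insert j (fst ` set L) \<subseteq> opts I"
    using el(1) plan_rule_L(1)[of _ _ I \<tau> g s e t] by (auto simp: L_def)
  have "(\<Sum>(i, r)\<leftarrow>L. wgt I i) = sum_list (map (wgt I) (map fst L))"
    by (simp add: case_prod_unfold comp_def)
  also have "\<dots> = (\<Sum>i\<in>fst ` set L. wgt I i)"
    using plan_rule_L(2)[of I \<tau> g s e t]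
    by (simp only: sum_list_distinct_conv_sum_set set_map L_def)
  finally have "(\<Sum>(i, r)\<leftarrow>L. wgt I i) + wgt I j = (\<Sum>i\<in>insert j (fst ` set L). wgt I i)"
    using notin by simp
  also have "\<dots> = (\<Sum>i\<in>insert j (fst ` set L). if candidate \<tau> ?h i then wgt I i else 0)"
    using cand by (intro sum.cong) auto
  also have "\<dots> \<le> (\<Sum>i\<in>opts I. if candidate \<tau> ?h i then wgt I i else 0)"
    using sub valid by (intro sum_mono2) (auto simp: valid_instance_def)
  also have "\<dots> \<le> capacity I" using el by (simp add: eligible_def)
  finally show ?thesis using el notin ej by (simp add: selectable_def)
qed

section \<open>Coupling of real and simulated evaluation times\<close>

definition zip3 :: "(nat \<Rightarrow> nat) \<Rightarrow> (nat \<Rightarrow> nat) \<Rightarrow> (nat \<Rightarrow> nat) \<Rightarrow> nat \<Rightarrow> nat \<times> nat \<times> nat" where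
  "zip3 \<tau> e D = (\<lambda>i. (\<tau> i, e i, D i))"

text \<open>Selection in the idealised process in which every candidate \<open>i\<close> blocks for
  the time \<open>D i\<close>.\<close>

definition goes :: "sse_instance \<Rightarrow> (nat \<Rightarrow> nat) \<Rightarrow> (nat \<Rightarrow> nat) \<Rightarrow> (nat \<Rightarrow> nat) \<Rightarrow> nat \<Rightarrow> bool" where
  "goes I \<tau> e D i \<longleftrightarrow> i \<in> opts I \<and> \<tau> i \<le> horizon I \<and> zip3 \<tau> e D \<in> Chosen I i (\<tau> i)"

text \<open>The policy sees the evaluation time \<open>s i\<close> of a selected option, and otherwise lets the option
  block for a simulated time \<open>g i\<close>. Independently of which of the two is used, the blocking times
  \<open>D\<close> are distributed like the evaluation times: \<open>swap\<close> recovers \<open>(s, g)\<close> from \<open>(D, D')\<close>,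
  where \<open>D'\<close> are the times not used, and it preserves the product law.\<close>

definition swap :: "sse_instance \<Rightarrow> (nat \<Rightarrow> nat) \<Rightarrow> (nat \<Rightarrow> nat) \<Rightarrow> (nat \<Rightarrow> nat) \<times> (nat \<Rightarrow> nat)
    \<Rightarrow> (nat \<Rightarrow> nat) \<times> (nat \<Rightarrow> nat)" where
  "swap I \<tau> e = (\<lambda>(D, D'). (\<lambda>i. if goes I \<tau> e D i then D i else D' i,
                              \<lambda>i. if goes I \<tau> e D i then D' i else D i))"

lemma Chosen_iff: "zip3 \<tau> e D \<in> Chosen I j t \<longleftrightarrow> \<tau> j = t \<and> e j > t \<and>
   (\<forall>i\<in>opts I - {j}. \<not> (1 \<le> \<tau> i \<and> \<tau> i \<le> t \<and> e i > \<tau> i \<and> t < \<tau> i + D i)) \<and>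
   (\<Sum>i\<in>opts I. if 1 \<le> \<tau> i \<and> \<tau> i \<le> t \<and> e i > \<tau> i then wgt I i else 0) \<le> capacity I"
proof -
  have *: "(\<Sum>i\<in>opts I. wgt I i * indicator (Cand t) (zip3 \<tau> e D i)) =
        (\<Sum>i\<in>opts I. if 1 \<le> \<tau> i \<and> \<tau> i \<le> t \<and> e i > \<tau> i then wgt I i else 0)"
    by (intro sum.cong refl) (auto simp: Cand_def zip3_def indicator_def)
  have "zip3 \<tau> e D j \<in> Start t \<longleftrightarrow> \<tau> j = t \<and> e j > t"
    "\<And>i. zip3 \<tau> e D i \<in> Block t \<longleftrightarrow> 1 \<le> \<tau> i \<and> \<tau> i \<le> t \<and> e i > \<tau> i \<and> t < \<tau> i + D i"
    by (auto simp: zip3_def Start_def Block_def)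
  then show ?thesis unfolding Chosen_def mem_Collect_eq * by (simp only: conj_assoc)
qed

text \<open>Induction over time: the selections up to \<open>t\<close> are exactly the options that
  go and are intended by \<open>t\<close>. If the decision-maker is busy, the option under
  evaluation has \<open>s i = D i\<close>, so it blocks everything in the idealised process too. If
  it is free, selected options no longer block under \<open>D\<close> either, and unselected
  candidates of the past use \<open>g i = D i\<close>, so the blockers that the rule computes are
  the idealised ones.\<close>

lemma plan_rule_simulation:
  fixes I \<tau> e D D' s g
  assumes sg: "(s, g) = swap I \<tau> e (D, D')"
    and pos: "\<And>i. i \<in> opts I \<Longrightarrow> 1 \<le> \<tau> i \<and> 1 \<le> D i \<and> 1 \<le> D' i"
  shows "selected I (plan_rule I \<tau> g) s e = {j. goes I \<tau> e D j}"
proof -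
  let ?L = "selections I (plan_rule I \<tau> g) s e" and ?go = "goes I \<tau> e D"
  have s: "s i = (if ?go i then D i else D' i)" and g: "g i = (if ?go i then D' i else D i)" for i
    using sg by (auto simp: swap_def)
  let ?cand = "\<lambda>t i. 1 \<le> \<tau> i \<and> \<tau> i \<le> t \<and> e i > \<tau> i"
  let ?block = "\<lambda>t i. 1 \<le> \<tau> i \<and> \<tau> i \<le> t \<and> e i > \<tau> i \<and> t < \<tau> i + D i"
  have go_opts: "?go i \<Longrightarrow> i \<in> opts I" for i by (simp add: goes_def)
  have main: "set (?L t) = (\<lambda>i. (i, \<tau> i)) ` {i. ?go i \<and> \<tau> i \<le> t}" for t
  proof (induction t)
    case 0
    have "{i. ?go i \<and> \<tau> i \<le> 0} = {}" using pos go_opts by force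
    then show ?case by simp
  next
    case (Suc t)
    let ?t = "Suc t" let ?h = "observe I s e (?L t) ?t"
    have fstL: "fst ` set (?L t) = {i. ?go i \<and> \<tau> i \<le> t}" unfolding Suc by (force simp: image_image)
    have new: "{i. ?go i \<and> \<tau> i \<le> ?t} = {i. ?go i \<and> \<tau> i \<le> t} \<union> {i. ?go i \<and> \<tau> i = ?t}" by auto
    have uniq: "i = k" if "?go i" "?go k" "\<tau> i = \<tau> k" for i k
    proof (rule ccontr)
      assume "i \<noteq> k"
      then have "k \<in> opts I - {i}" using that go_opts by auto
      moreover have "1 \<le> \<tau> k" "1 \<le> D k" "e k > \<tau> k"
        using that(2) pos[OF go_opts[OF that(2)]] unfolding goes_def Chosen_iff by blast+
      moreover have "\<forall>l\<in>opts I - {i}. \<not> ?block (\<tau> i) l"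
        using that(1) unfolding goes_def Chosen_iff by blast
      ultimately show False using that(3) by fastforce
    qed
    show ?case
    proof (cases "free s (?L t) ?t")
      case False
      then obtain i where i: "?go i" "\<tau> i \<le> t" "?t < \<tau> i + s i"
        unfolding free_def Suc by force
      have bi: "?block ?t i" using i pos[OF go_opts[OF i(1)]] unfolding s goes_def Chosen_iff by simp
      have "\<not> ?go j" if "\<tau> j = ?t" for j
      proof
        assume "?go j"
        then have "zip3 \<tau> e D \<in> Chosen I j ?t" using that by (simp add: goes_def)
        then have "\<forall>i\<in>opts I - {j}. \<not> ?block ?t i" unfolding Chosen_iff by blast
        moreover have "i \<in> opts I - {j}" using i that go_opts by auto
        ultimately show False using bi by blast
      qed
      then have e0: "{i. ?go i \<and> \<tau> i = ?t} = {}" by blast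
      show ?thesis using False Suc unfolding new e0 by simp
    next
      case True
      have cand: "candidate \<tau> ?h i \<longleftrightarrow> ?cand ?t i" if i: "i \<in> opts I" for i
      proof -
        have "?go i \<Longrightarrow> e i > \<tau> i" by (simp add: goes_def Chosen_iff)
        then show ?thesis
          unfolding candidate_def observe_simps(3)[OF i] fstL using pos[OF i] by (auto simp: observe_simps)
      qed
      have block: "blocker \<tau> g ?h i \<longleftrightarrow> ?block ?t i" if i: "i \<in> opts I" for i
      proof (cases "i \<in> fst ` set (?L t)")
        case inL: True
        then have "?go i" "\<tau> i + s i \<le> ?t" using True unfolding free_def Suc by (auto simp: image_image)
        then have "\<not> ?block ?t i" by (simp add: s)
        then show ?thesis using inL by (simp add: blocker_def observe_simps)
      next
        case notL: False
        \<comment> \<open>An option that goes right now has \<open>g i = D' i\<close> instead of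
          \<open>D i\<close>, but at its intended time it blocks for any positive duration.\<close>
        then have "\<not> ?go i \<or> ?t \<le> \<tau> i" unfolding fstL by auto
        then show ?thesis using notL pos[OF i] cand[OF i]
          by (auto simp: blocker_def observe_simps g)
      qed
      have el: "eligible I \<tau> g ?h j \<longleftrightarrow> ?go j \<and> \<tau> j = ?t" if j: "j \<in> opts I" for j
      proof (cases "\<tau> j = ?t \<and> e j > ?t \<and> ?t \<le> horizon I")
        case tj: True
        have B: "{i \<in> opts I. blocker \<tau> g ?h i} = insert j {i \<in> opts I - {j}. ?block ?t i}"
          using block tj j pos[OF j] by auto
        have "card {i \<in> opts I. blocker \<tau> g ?h i} < 2 \<longleftrightarrow> (\<forall>i\<in>opts I - {j}. \<not> ?block ?t i)"
          unfolding B by (subst card_insert_disjoint) (auto simp: card_eq_0_iff)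
        moreover have "(\<Sum>i\<in>opts I. if candidate \<tau> ?h i then wgt I i else 0) =
           (\<Sum>i\<in>opts I. if ?cand ?t i then wgt I i else 0)"
          using cand by (intro sum.cong) auto
        moreover have "j \<notin> fst ` set (?L t)" unfolding fstL using tj by simp
        ultimately show ?thesis
          using tj j unfolding eligible_def goes_def Chosen_iff observe_simps(1,2) observe_simps(3)[OF j] by auto
      next
        case False
        have "\<not> ?go j \<or> \<tau> j \<noteq> ?t" using False by (auto simp: goes_def Chosen_iff)
        moreover have "j \<notin> fst ` set (?L t)" if "\<tau> j = ?t" unfolding fstL using that by simp
        ultimately show ?thesis using False
          unfolding eligible_def observe_simps(1,2) observe_simps(3)[OF j] by auto
      qed
      show ?thesis
      proof (cases "plan_rule I \<tau> g ?h")
        case None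
        then have e0: "{i. ?go i \<and> \<tau> i = ?t} = {}"
          using plan_rule_None[OF None] el go_opts by blast
        show ?thesis using None True Suc unfolding new e0 by simp
      next
        case (Some k)
        then have "?go k" "\<tau> k = ?t" using plan_rule_Some[OF Some] el by auto
        then have e1: "{i. ?go i \<and> \<tau> i = ?t} = {k}" using uniq by force
        show ?thesis using Some True Suc \<open>\<tau> k = ?t\<close> unfolding new e1 by simp
      qed
    qed
  qed
  show ?thesis
  proof (intro set_eqI iffI)
    fix j assume "j \<in> selected I (plan_rule I \<tau> g) s e"
    then show "j \<in> {j. ?go j}" unfolding selected_def main by auto
  next
    fix j assume "j \<in> {j. ?go j}"
    then show "j \<in> selected I (plan_rule I \<tau> g) s e"
      using go_opts unfolding selected_def main by (auto simp: image_image intro!: exI[of _ "\<tau> j"])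
  qed
qed

section \<open>Law of the random plan drawn from the seed\<close>

definition lp_noise :: "sse_instance \<Rightarrow> (nat \<Rightarrow> nat \<Rightarrow> real) \<Rightarrow> (nat \<Rightarrow> real) \<Rightarrow> (nat \<Rightarrow> nat) \<times> (nat \<Rightarrow> nat)" where
  "lp_noise I y u =
     (\<lambda>j. if j \<in> opts I then quantile (rate I y j) (horizon I) (u j) else 0,
      \<lambda>j. if j \<in> opts I then quantile (pmf (eval_dist I j)) (max_eval I) (u (num_opts I + j)) else 0)"

definition lp_policy :: "sse_instance \<Rightarrow> (nat \<Rightarrow> nat \<Rightarrow> real) \<Rightarrow> policy" where
  "lp_policy I y u = (case lp_noise I y u of (\<tau>, g) \<Rightarrow> plan_rule I \<tau> g)"

definition noise_pmf :: "sse_instance \<Rightarrow> (nat \<Rightarrow> nat \<Rightarrow> real) \<Rightarrow> ((nat \<Rightarrow> nat) \<times> (nat \<Rightarrow> nat)) pmf" where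
  "noise_pmf I y = pair_pmf (Pi_pmf (opts I) 0 (plan_pmf I y)) (Pi_pmf (opts I) 0 (eval_dist I))"

text \<open>Simulated times range up to \<open>Suc (max_eval I)\<close>, which is attained for
  instance at a seed coordinate equal to 1: it has probability 0 but cannot be excluded
  pointwise.\<close>

definition noise_range :: "sse_instance \<Rightarrow> ((nat \<Rightarrow> nat) \<times> (nat \<Rightarrow> nat)) set" where
  "noise_range I = PiE_dflt (opts I) 0 (\<lambda>_. {1..Suc (horizon I)}) \<times> PiE_dflt (opts I) 0 (\<lambda>_. {1..Suc (max_eval I)})"

lemma finite_noise_range: "finite (noise_range I)"
  unfolding noise_range_def by (intro finite_cartesian_product finite_PiE_dflt) auto

lemma lp_noise_range: "lp_noise I y u \<in> noise_range I"
  unfolding noise_range_def lp_noise_def PiE_dflt_def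
  by (auto simp: quantile_prop(3) intro: quantile_prop(1)[unfolded One_nat_def])

context
  fixes I :: sse_instance and y :: "nat \<Rightarrow> nat \<Rightarrow> real"
  assumes valid: "valid_instance I" and feas: "lp_feasible I y"
begin

private abbreviation (input) "T \<equiv> max_eval I"
private abbreviation (input) "SP \<equiv> Pi_pmf (opts I) 0 (eval_dist I)"
private abbreviation (input) "EP \<equiv> Pi_pmf (opts I) 0 (exp_dist I)"
private abbreviation (input) "TP \<equiv> Pi_pmf (opts I) 0 (plan_pmf I y)"

lemma eval_pmf_sum: "j \<in> opts I \<Longrightarrow> (\<Sum>s=1..T. pmf (eval_dist I j) s) = 1"
  using eval_range[OF valid, of j] by (intro sum_pmf_eq_1) auto

lemma plan_range: "j \<in> opts I \<Longrightarrow> a \<in> set_pmf (plan_pmf I y j) \<Longrightarrow> a \<in> {1..Suc (horizon I)}"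
  using pmf_plan[OF valid feas, of j a] by (auto simp: set_pmf_iff split: if_splits)

text \<open>Intended times read the seed coordinates 1 to n, simulated times the coordinates n + 1
  to 2n. So the event is a cylinder over 2n independent coordinates.\<close>

lemma noise_point:
  assumes ab: "(a, b) \<in> noise_range I"
  shows "{u \<in> space seed. lp_noise I y u = (a, b)} \<in> sets seed"
    and "emeasure seed {u \<in> space seed. lp_noise I y u = (a, b)} = ennreal (pmf (noise_pmf I y) (a, b))"
proof -
  interpret prob_space unit_uniform
    by (rule prob_spaceI) (simp add: emeasure_restrict_space space_restrict_space)
  interpret product_prob_space "\<lambda>_. unit_uniform" "UNIV :: nat set" ..
  define r where "r k = (if k \<le> num_opts I then rate I y k else pmf (eval_dist I (k - num_opts I)))" for k
  define N where "N k = (if k \<le> num_opts I then horizon I else T)" for k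
  define c where "c k = (if k \<le> num_opts I then a k else b (k - num_opts I))" for k
  define X where "X k = {v \<in> {0..1}. quantile (r k) (N k) v = c k}" for k
  have a: "a j \<in> {1..Suc (horizon I)}" "b j \<in> {1..Suc T}" if "j \<in> opts I" for j
    using ab that by (auto simp: noise_range_def PiE_dflt_def)
  have out: "a j = 0" "b j = 0" if "j \<notin> opts I" for j
    using ab that by (auto simp: noise_range_def PiE_dflt_def)
  have X: "X k \<in> sets unit_uniform \<and> emeasure unit_uniform (X k) =
      ennreal (if k \<le> num_opts I then pmf (plan_pmf I y k) (a k) else pmf (eval_dist I (k - num_opts I)) (b (k - num_opts I)))"
    if k: "k \<in> {1..num_opts I + num_opts I}" for k
  proof (cases "k \<le> num_opts I")
    case True
    then have j: "k \<in> opts I" using k by simp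
    have "r k = rate I y k" "N k = horizon I" "c k = a k" using True by (simp_all add: r_def N_def c_def)
    then show ?thesis
      using quantile_law[of "horizon I" "rate I y k" "a k", OF rate_nonneg[OF valid feas j] rate_sum[OF valid feas j] a(1)[OF j]]
        pmf_plan[OF valid feas j, of "a k"] a(1)[OF j] True
      unfolding X_def by (auto simp: le_Suc_eq)
  next
    case False
    define j where "j = k - num_opts I"
    have j: "j \<in> opts I" using False k by (auto simp: j_def)
    have *: "r k = pmf (eval_dist I j)" "N k = T" "c k = b j" using False by (simp_all add: r_def N_def c_def j_def)
    have "pmf (eval_dist I j) (Suc T) = 0"
      using eval_range[OF valid j, of "Suc T"] by (auto simp: set_pmf_iff)
    then show ?thesis
      using quantile_law[of T "pmf (eval_dist I j)" "b j", OF _ _ a(2)[OF j]] eval_pmf_sum[OF j] a(2)[OF j] False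
      unfolding X_def * by (auto simp: le_Suc_eq j_def)
  qed
  have eq: "{u \<in> space seed. lp_noise I y u = (a, b)} = {u \<in> space seed. \<forall>k\<in>{1..num_opts I + num_opts I}. u k \<in> X k}"
  proof (intro Collect_cong conj_cong refl)
    fix u assume "u \<in> space seed"
    then have u: "u k \<in> {0..1}" for k
      by (auto simp: seed_def space_PiM space_restrict_space)
    have "lp_noise I y u = (a, b) \<longleftrightarrow> (\<forall>j\<in>opts I. quantile (rate I y j) (horizon I) (u j) = a j \<and>
       quantile (pmf (eval_dist I j)) T (u (num_opts I + j)) = b j)"
      using out unfolding lp_noise_def by (auto simp: fun_eq_iff)
    also have "\<dots> \<longleftrightarrow> (\<forall>k\<in>{1..num_opts I + num_opts I}. u k \<in> X k)"
    proof (intro iffI ballI conjI)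
      fix k assume *: "\<forall>j\<in>opts I. quantile (rate I y j) (horizon I) (u j) = a j \<and> quantile (pmf (eval_dist I j)) T (u (num_opts I + j)) = b j"
        and k: "k \<in> {1..num_opts I + num_opts I}"
      show "u k \<in> X k"
      proof (cases "k \<le> num_opts I")
        case True then show ?thesis using * k u by (simp add: X_def r_def N_def c_def)
      next
        case False
        then have "k - num_opts I \<in> opts I" "num_opts I + (k - num_opts I) = k" using k by auto
        then have "quantile (pmf (eval_dist I (k - num_opts I))) T (u k) = b (k - num_opts I)" using * by metis
        then show ?thesis using False u by (simp add: X_def r_def N_def c_def)
      qed
    next
      fix j assume *: "\<forall>k\<in>{1..num_opts I + num_opts I}. u k \<in> X k" and j: "j \<in> opts I"
      have "u j \<in> X j" using * j by auto
      then show "quantile (rate I y j) (horizon I) (u j) = a j" using j by (auto simp: X_def r_def N_def c_def)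
      have "u (num_opts I + j) \<in> X (num_opts I + j)" using * j by auto
      then show "quantile (pmf (eval_dist I j)) T (u (num_opts I + j)) = b j" using j by (auto simp: X_def r_def N_def c_def)
    qed
    finally show "lp_noise I y u = (a, b) \<longleftrightarrow> (\<forall>k\<in>{1..num_opts I + num_opts I}. u k \<in> X k)" .
  qed
  show "{u \<in> space seed. lp_noise I y u = (a, b)} \<in> sets seed"
    unfolding eq unfolding seed_def
  proof (rule sets.sets_Collect_finite_All)
    fix k assume "k \<in> {1..num_opts I + num_opts I}"
    then have "X k \<in> sets unit_uniform" using X by blast
    from measurable_sets[OF measurable_component_singleton[of k UNIV "\<lambda>_. unit_uniform"] this]
    have "(\<lambda>u. u k) -` X k \<inter> space (\<Pi>\<^sub>M i\<in>UNIV. unit_uniform) \<in> sets (\<Pi>\<^sub>M i\<in>UNIV. unit_uniform)" by simp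
    then show "{u \<in> space (\<Pi>\<^sub>M i\<in>UNIV. unit_uniform). u k \<in> X k} \<in> sets (\<Pi>\<^sub>M i\<in>UNIV. unit_uniform)"
      by (simp only: vimage_def Int_def mem_Collect_eq conj_commute)
  qed simp
  have "emeasure seed {u \<in> space seed. \<forall>k\<in>{1..num_opts I + num_opts I}. u k \<in> X k} = (\<Prod>k\<in>{1..num_opts I + num_opts I}. emeasure unit_uniform (X k))"
    unfolding seed_def using X by (intro emeasure_PiM_Collect) auto
  also have "\<dots> = (\<Prod>k\<in>{1..num_opts I + num_opts I}. ennreal (if k \<le> num_opts I then pmf (plan_pmf I y k) (a k) else pmf (eval_dist I (k - num_opts I)) (b (k - num_opts I))))"
    using X by (intro prod.cong) auto
  also have "\<dots> = ennreal (\<Prod>k\<in>{1..num_opts I + num_opts I}. if k \<le> num_opts I then pmf (plan_pmf I y k) (a k) else pmf (eval_dist I (k - num_opts I)) (b (k - num_opts I)))"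
    by (rule prod_ennreal) auto
  also have "(\<Prod>k\<in>{1..num_opts I + num_opts I}. if k \<le> num_opts I then pmf (plan_pmf I y k) (a k) else pmf (eval_dist I (k - num_opts I)) (b (k - num_opts I))) =
     (\<Prod>k\<in>{1..num_opts I}. pmf (plan_pmf I y k) (a k)) * (\<Prod>k\<in>{1..num_opts I}. pmf (eval_dist I k) (b k))"
  proof -
    have "(\<Prod>k\<in>{num_opts I+1..num_opts I + num_opts I}. if k \<le> num_opts I then pmf (plan_pmf I y k) (a k) else pmf (eval_dist I (k - num_opts I)) (b (k - num_opts I))) =
      (\<Prod>k\<in>{1..num_opts I}. pmf (eval_dist I k) (b k))"
      by (rule prod.reindex_bij_witness[where i = "\<lambda>k. num_opts I + k" and j = "\<lambda>k. k - num_opts I"]) auto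
    moreover have "(\<Prod>k\<in>{1..num_opts I}. if k \<le> num_opts I then pmf (plan_pmf I y k) (a k) else pmf (eval_dist I (k - num_opts I)) (b (k - num_opts I))) =
      (\<Prod>k\<in>{1..num_opts I}. pmf (plan_pmf I y k) (a k))" by (intro prod.cong) auto
    ultimately show ?thesis by (subst prod.ub_add_nat) auto
  qed
  also have "\<dots> = pmf (noise_pmf I y) (a, b)"
    using out unfolding noise_pmf_def pmf_pair by (intro arg_cong2[where f = "(*)"] pmf_Pi'[symmetric]) auto
  finally show "emeasure seed {u \<in> space seed. lp_noise I y u = (a, b)} = ennreal (pmf (noise_pmf I y) (a, b))"
    unfolding eq .
qed

lemma measurable_noise: "lp_noise I y \<in> measurable seed (count_space UNIV)"
proof (rule measurableI)
  fix A :: "((nat \<Rightarrow> nat) \<times> (nat \<Rightarrow> nat)) set"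
  have "lp_noise I y -` A \<inter> space seed = (\<Union>r\<in>noise_range I \<inter> A. {u \<in> space seed. lp_noise I y u = r})"
    using lp_noise_range[of I y] by blast
  also have "\<dots> \<in> sets seed"
  proof (rule sets.finite_UN)
    fix r assume "r \<in> noise_range I \<inter> A"
    then show "{u \<in> space seed. lp_noise I y u = r} \<in> sets seed"
      using noise_point(1)[of "fst r" "snd r"] by simp
  qed (use finite_noise_range in simp)
  finally show "lp_noise I y -` A \<inter> space seed \<in> sets seed" .
qed simp

text \<open>Both laws live on a finite set, so comparing point masses suffices.\<close>

lemma noise_law: "distr seed (count_space UNIV) (lp_noise I y) = measure_pmf (noise_pmf I y)"
proof (rule measure_eqI_countable_AE)
  show "AE x in distr seed (count_space UNIV) (lp_noise I y). x \<in> noise_range I"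
    using lp_noise_range[of I y] by (subst AE_distr_iff[OF measurable_noise]) simp_all
  show "AE x in measure_pmf (noise_pmf I y). x \<in> noise_range I"
  proof -
    have "set_pmf (plan_pmf I y j) \<subseteq> {1..Suc (horizon I)}" "set_pmf (eval_dist I j) \<subseteq> {1..Suc T}" if "j \<in> opts I" for j
      using plan_range[OF that] eval_range[OF valid that] by force+
    then have "set_pmf TP \<subseteq> PiE_dflt (opts I) 0 (\<lambda>_. {1..Suc (horizon I)})" "set_pmf SP \<subseteq> PiE_dflt (opts I) 0 (\<lambda>_. {1..Suc T})"
      unfolding set_Pi_pmf[OF finite_atLeastAtMost] PiE_dflt_def comp_def by blast+
    then show ?thesis
      unfolding AE_measure_pmf_iff noise_pmf_def noise_range_def set_pair_pmf by blast
  qed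
  fix x assume x: "x \<in> noise_range I"
  have "lp_noise I y -` {x} \<inter> space seed = {u \<in> space seed. lp_noise I y u = x}" by auto
  then show "emeasure (distr seed (count_space UNIV) (lp_noise I y)) {x} = emeasure (measure_pmf (noise_pmf I y)) {x}"
    using noise_point(2)[of "fst x" "snd x"] x
    by (subst emeasure_distr[OF measurable_noise]) (simp_all add: emeasure_pmf_single)
qed (simp_all add: finite_noise_range countable_finite)

lemma measurable_lp_policy: "(\<lambda>u. lp_policy I y u h) \<in> measurable seed (count_space UNIV)"
  unfolding lp_policy_def
  by (rule measurable_compose[OF measurable_noise, where g = "\<lambda>r. (case r of (\<tau>, g) \<Rightarrow> plan_rule I \<tau> g) h", simplified]) simp

definition gain :: "((nat \<Rightarrow> nat) \<times> (nat \<Rightarrow> nat)) \<Rightarrow> ((nat \<Rightarrow> nat) \<times> (nat \<Rightarrow> nat)) \<Rightarrow> real" where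
  "gain = (\<lambda>(s, e) (\<tau>, g). \<Sum>j\<in>selected I (plan_rule I \<tau> g) s e. val I j)"

lemma gain_bounds: "0 \<le> gain x r" "gain x r \<le> (\<Sum>j\<in>opts I. val I j)"
proof -
  have "selected I d s e \<subseteq> opts I" for d s e by (auto simp: selected_def)
  moreover have v: "j \<in> opts I \<Longrightarrow> 0 \<le> val I j" for j
    using valid by (auto simp: valid_instance_def intro: less_imp_le)
  ultimately show "0 \<le> gain x r" "gain x r \<le> (\<Sum>j\<in>opts I. val I j)"
    by (auto simp: gain_def case_prod_unfold subset_eq intro!: sum_nonneg sum_mono2)
qed

lemma expected_value_lp_policy:
  "expected_value I (lp_policy I y) =
   measure_pmf.expectation (pair_pmf (scenarios I) (noise_pmf I y)) (case_prod gain)"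
proof -
  interpret S: prob_space seed by (rule prob_space_seed)
  interpret P: pair_prob_space "measure_pmf (scenarios I)" seed ..
  let ?M = "measure_pmf (scenarios I) \<Otimes>\<^sub>M seed"
  have meas: "(\<lambda>(x, u). gain x (lp_noise I y u)) \<in> borel_measurable ?M"
  proof -
    \<comment> \<open>Splitting by the finitely many values of the noise separates the two variables
      and yields joint measurability.\<close>
    have "(\<lambda>(x, u). gain x (lp_noise I y u)) =
      (\<lambda>z. \<Sum>r\<in>noise_range I. gain (fst z) r * indicator {r} (lp_noise I y (snd z)))"
      using lp_noise_range finite_noise_range
      by (auto simp: fun_eq_iff indicator_def if_distrib[where f = "\<lambda>x. _ * x"] cong: if_cong)
    also have "\<dots> \<in> borel_measurable ?M"
    proof (intro borel_measurable_sum borel_measurable_times)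
      fix r
      show "(\<lambda>z. gain (fst z) r) \<in> borel_measurable ?M"
        by (rule measurable_compose[OF measurable_fst]) simp
      show "(\<lambda>z. indicator {r} (lp_noise I y (snd z)) :: real) \<in> borel_measurable ?M"
        by (rule measurable_compose[OF measurable_snd], rule measurable_compose[OF measurable_noise]) simp
    qed
    finally show ?thesis .
  qed
  have "expected_value I (lp_policy I y) = integral\<^sup>L ?M (\<lambda>(x, u). gain x (lp_noise I y u))"
    unfolding expected_value_def
    by (intro Bochner_Integration.integral_cong refl) (auto simp: gain_def lp_policy_def case_prod_unfold)
  also have "\<dots> = enn2real (\<integral>\<^sup>+ z. ennreal (case z of (x, u) \<Rightarrow> gain x (lp_noise I y u)) \<partial>?M)"
    using meas by (intro integral_eq_nn_integral) (auto simp: gain_bounds)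
  also have "(\<integral>\<^sup>+ z. ennreal (case z of (x, u) \<Rightarrow> gain x (lp_noise I y u)) \<partial>?M) =
     (\<integral>\<^sup>+ x. \<integral>\<^sup>+ u. ennreal (gain x (lp_noise I y u)) \<partial>seed \<partial>measure_pmf (scenarios I))"
    using meas by (subst S.nn_integral_fst[symmetric]) (auto simp: case_prod_unfold)
  also have "\<dots> = (\<integral>\<^sup>+ x. \<integral>\<^sup>+ r. ennreal (gain x r) \<partial>measure_pmf (noise_pmf I y) \<partial>measure_pmf (scenarios I))"
    unfolding noise_law[symmetric] using measurable_noise
    by (intro nn_integral_cong, subst nn_integral_distr) auto
  also have "\<dots> = (\<integral>\<^sup>+ z. ennreal (case_prod gain z) \<partial>measure_pmf (pair_pmf (scenarios I) (noise_pmf I y)))"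
    by (simp add: nn_integral_pair_pmf')
  also have "enn2real \<dots> = measure_pmf.expectation (pair_pmf (scenarios I) (noise_pmf I y)) (case_prod gain)"
    by (rule integral_eq_nn_integral[symmetric]) (auto simp: gain_bounds case_prod_unfold)
  finally show ?thesis .
qed

section \<open>Reduction of the policy to independent options\<close>

private abbreviation (input) "Big \<equiv> pair_pmf (pair_pmf EP TP) (pair_pmf SP SP)"

text \<open>\<open>swap\<close> is parametrised by \<open>e\<close> and \<open>\<tau>\<close> and
  acts on the two copies of the evaluation times; the variables are grouped accordingly.\<close>

lemma pair_rearrange:
  "pair_pmf (scenarios I) (noise_pmf I y) = map_pmf (\<lambda>((e, \<tau>), (s, g)). ((s, e), (\<tau>, g))) Big"
proof (rule pmf_eqI)
  fix z :: "((nat \<Rightarrow> nat) \<times> (nat \<Rightarrow> nat)) \<times> (nat \<Rightarrow> nat) \<times> (nat \<Rightarrow> nat)"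
  obtain s e \<tau> g where z: "z = ((s, e), (\<tau>, g))" by (metis surj_pair)
  let ?f = "\<lambda>((e, \<tau>), (s, g)). ((s, e), (\<tau>, g)) :: ((nat \<Rightarrow> nat) \<times> (nat \<Rightarrow> nat)) \<times> (nat \<Rightarrow> nat) \<times> (nat \<Rightarrow> nat)"
  have "inj ?f" by (auto simp: inj_def)
  then have "pmf (map_pmf ?f Big) (?f ((e, \<tau>), (s, g))) = pmf Big ((e, \<tau>), (s, g))" by (rule pmf_map_inj')
  then show "pmf (pair_pmf (scenarios I) (noise_pmf I y)) z = pmf (map_pmf ?f Big) z"
    unfolding z by (simp add: pmf_pair scenarios_def noise_pmf_def mult_ac)
qed

lemma support_positive:
  assumes "((e, \<tau>), (D, D')) \<in> set_pmf Big"
  shows "i \<in> opts I \<Longrightarrow> 1 \<le> \<tau> i \<and> 1 \<le> D i \<and> 1 \<le> D' i" and "i \<notin> opts I \<Longrightarrow> D i = 0 \<and> D' i = 0"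
proof -
  have "\<tau> \<in> PiE_dflt (opts I) 0 (set_pmf \<circ> plan_pmf I y)" "D \<in> PiE_dflt (opts I) 0 (set_pmf \<circ> eval_dist I)"
    "D' \<in> PiE_dflt (opts I) 0 (set_pmf \<circ> eval_dist I)"
    using assms by (auto simp: set_Pi_pmf)
  then show "i \<in> opts I \<Longrightarrow> 1 \<le> \<tau> i \<and> 1 \<le> D i \<and> 1 \<le> D' i" "i \<notin> opts I \<Longrightarrow> D i = 0 \<and> D' i = 0"
    using plan_range[of i "\<tau> i"] eval_range[OF valid, of i "D i"] eval_range[OF valid, of i "D' i"]
    by (auto simp: PiE_dflt_def)
qed

text \<open>An option with the same intended time as \<open>i\<close> blocks it for every positive
  duration, and a later one never does. So durations matter only for options intended strictly
  earlier.\<close>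

lemma goes_cong:
  assumes "\<And>l. l \<in> opts I \<Longrightarrow> \<tau> l < \<tau> i \<Longrightarrow> D l = G l" "\<And>l. l \<in> opts I \<Longrightarrow> 1 \<le> D l \<and> 1 \<le> G l"
  shows "goes I \<tau> e D i \<longleftrightarrow> goes I \<tau> e G i"
proof -
  have "(\<tau> l \<le> \<tau> i \<and> \<tau> i < \<tau> l + D l) = (\<tau> l \<le> \<tau> i \<and> \<tau> i < \<tau> l + G l)" if "l \<in> opts I" for l
    using assms(1)[OF that] assms(2)[OF that] by (cases "\<tau> l < \<tau> i") auto
  then have "(\<forall>l\<in>opts I - {i}. \<not> (1 \<le> \<tau> l \<and> \<tau> l \<le> \<tau> i \<and> e l > \<tau> l \<and> \<tau> i < \<tau> l + D l)) =
     (\<forall>l\<in>opts I - {i}. \<not> (1 \<le> \<tau> l \<and> \<tau> l \<le> \<tau> i \<and> e l > \<tau> l \<and> \<tau> i < \<tau> l + G l))"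
    by blast
  then show ?thesis unfolding goes_def Chosen_iff by blast
qed

text \<open>In each coordinate the map exchanges two values of the same law or does nothing, so it
  preserves point masses. It is injective although the exchanges depend on \<open>D\<close>: by
  \<open>goes_cong\<close>, whether \<open>i\<close> is exchanged is known once \<open>D\<close> is
  recovered for all smaller intended times.\<close>

lemma swap_preserves:
  "map_pmf (\<lambda>((e, \<tau>), x). ((e, \<tau>), swap I \<tau> e x)) Big = Big"
proof (rule map_pmf_preserving)
  show "inj_on (\<lambda>((e, \<tau>), x). ((e, \<tau>), swap I \<tau> e x)) (set_pmf Big)"
  proof (rule inj_onI)
    fix x x'
    assume xx: "x \<in> set_pmf Big" "x' \<in> set_pmf Big"
      "(\<lambda>((e, \<tau>), x). ((e, \<tau>), swap I \<tau> e x)) x = (\<lambda>((e, \<tau>), x). ((e, \<tau>), swap I \<tau> e x)) x'"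
    obtain e \<tau> D D' e1 \<tau>1 G G' where x: "x = ((e, \<tau>), (D, D'))" "x' = ((e1, \<tau>1), (G, G'))" by (metis surj_pair)
    have 1: "((e, \<tau>), (D, D')) \<in> set_pmf Big" and 2: "((e1, \<tau>1), (G, G')) \<in> set_pmf Big"
      and eq: "(e, \<tau>) = (e1, \<tau>1) \<and> swap I \<tau> e (D, D') = swap I \<tau>1 e1 (G, G')"
      using xx(1,2) unfolding x by (simp, simp) (use xx(3) in \<open>auto simp: x\<close>)
    then have [simp]: "e1 = e" "\<tau>1 = \<tau>" and sw: "swap I \<tau> e (D, D') = swap I \<tau> e (G, G')" by auto
    have sw1: "(if goes I \<tau> e D i then D i else D' i) = (if goes I \<tau> e G i then G i else G' i)"
      and sw2: "(if goes I \<tau> e D i then D' i else D i) = (if goes I \<tau> e G i then G' i else G i)" for i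
      using sw unfolding swap_def by (simp_all add: fun_eq_iff)
    have "D i = G i \<and> D' i = G' i" for i
    proof (induction "\<tau> i" arbitrary: i rule: less_induct)
      case less
      have "goes I \<tau> e D i \<longleftrightarrow> goes I \<tau> e G i"
        using less support_positive(1)[OF 1] support_positive(1)[OF 2] by (intro goes_cong) auto
      then show ?case using sw1[of i] sw2[of i] by (auto split: if_splits)
    qed
    then show "x = x'" unfolding x by (auto simp: fun_eq_iff)
  qed
next
  fix x assume "x \<in> set_pmf Big"
  moreover obtain e \<tau> D D' where x: "x = ((e, \<tau>), (D, D'))" by (metis surj_pair)
  ultimately have sup: "((e, \<tau>), (D, D')) \<in> set_pmf Big" by simp
  obtain s g where sg: "swap I \<tau> e (D, D') = (s, g)" by (metis surj_pair)
  have s: "s = (\<lambda>i. if goes I \<tau> e D i then D i else D' i)" and g: "g = (\<lambda>i. if goes I \<tau> e D i then D' i else D i)"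
    using sg by (auto simp: swap_def)
  have out: "i \<notin> opts I \<Longrightarrow> D i = 0" "i \<notin> opts I \<Longrightarrow> D' i = 0" "i \<notin> opts I \<Longrightarrow> s i = 0" "i \<notin> opts I \<Longrightarrow> g i = 0" for i
    using support_positive(2)[OF sup, of i] by (auto simp: s g)
  have "pmf SP s * pmf SP g = (\<Prod>i\<in>opts I. pmf (eval_dist I i) (s i) * pmf (eval_dist I i) (g i))"
    using out unfolding prod.distrib by (intro arg_cong2[where f = "(*)"] pmf_Pi') auto
  also have "\<dots> = (\<Prod>i\<in>opts I. pmf (eval_dist I i) (D i) * pmf (eval_dist I i) (D' i))"
    by (intro prod.cong refl) (simp add: s g)
  also have "\<dots> = pmf SP D * pmf SP D'"
    using out unfolding prod.distrib by (intro arg_cong2[where f = "(*)"] pmf_Pi'[symmetric]) auto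
  finally have "pmf Big ((e, \<tau>), swap I \<tau> e (D, D')) = pmf Big ((e, \<tau>), (D, D'))"
    by (simp add: sg pmf_pair)
  then show "pmf Big ((\<lambda>((e, \<tau>), x). ((e, \<tau>), swap I \<tau> e x)) x) = pmf Big x"
    unfolding x by simp
qed

lemma fates_law: "map_pmf (\<lambda>((e, \<tau>), (D, D')). zip3 \<tau> e D) Big = fates I y"
proof -
  let ?f = "\<lambda>((e, \<tau>), D). zip3 \<tau> e D"
  have "map_pmf (\<lambda>((e, \<tau>), (D, D')). zip3 \<tau> e D) Big = map_pmf ?f (pair_pmf (pair_pmf EP TP) (map_pmf fst (pair_pmf SP SP)))"
    unfolding pair_map_pmf2 pmf.map_comp by (intro map_pmf_cong refl) auto
  also have "\<dots> = map_pmf ?f (pair_pmf (pair_pmf EP TP) SP)" by (simp add: map_fst_pair_pmf)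
  also have "\<dots> = fates I y"
  proof (rule pmf_eqI)
    fix \<omega> :: "nat \<Rightarrow> nat \<times> nat \<times> nat"
    define \<tau> e D where "\<tau> = (\<lambda>i. fst (\<omega> i))" and "e = (\<lambda>i. fst (snd (\<omega> i)))" and "D = (\<lambda>i. snd (snd (\<omega> i)))"
    have \<omega>: "\<omega> = ?f ((e, \<tau>), D)" by (simp add: zip3_def \<tau>_def e_def D_def)
    have "inj ?f" by (auto simp: inj_def zip3_def fun_eq_iff)
    then have "pmf (map_pmf ?f (pair_pmf (pair_pmf EP TP) SP)) \<omega> = pmf (pair_pmf (pair_pmf EP TP) SP) ((e, \<tau>), D)"
      unfolding \<omega> by (rule pmf_map_inj')
    also have "\<dots> = pmf (fates I y) \<omega>"
    proof (cases "\<forall>i. i \<notin> opts I \<longrightarrow> \<omega> i = (0, 0, 0)")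
      case True
      then have "i \<notin> opts I \<Longrightarrow> \<tau> i = 0" "i \<notin> opts I \<Longrightarrow> e i = 0" "i \<notin> opts I \<Longrightarrow> D i = 0" for i
        by (auto simp: \<tau>_def e_def D_def)
      then have "pmf TP \<tau> = (\<Prod>i\<in>opts I. pmf (plan_pmf I y i) (\<tau> i))" "pmf EP e = (\<Prod>i\<in>opts I. pmf (exp_dist I i) (e i))"
        "pmf SP D = (\<Prod>i\<in>opts I. pmf (eval_dist I i) (D i))"
        by (intro pmf_Pi' finite_atLeastAtMost; blast)+
      then have "pmf (pair_pmf (pair_pmf EP TP) SP) ((e, \<tau>), D) =
         (\<Prod>i\<in>opts I. pmf (fate I y i) (\<tau> i, e i, D i))"
        by (simp add: pmf_pair fate_def prod.distrib mult_ac)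
      also have "\<dots> = pmf (fates I y) \<omega>"
        using True unfolding fates_def by (subst pmf_Pi') (auto simp: \<tau>_def e_def D_def)
      finally show ?thesis .
    next
      case False
      then obtain i where i: "i \<notin> opts I" "\<omega> i \<noteq> (0, 0, 0)" by blast
      then have "\<tau> i \<noteq> 0 \<or> e i \<noteq> 0 \<or> D i \<noteq> 0" by (auto simp: \<tau>_def e_def D_def prod_eq_iff)
      then have "pmf (pair_pmf (pair_pmf EP TP) SP) ((e, \<tau>), D) = 0"
        using i(1) by (auto simp: pmf_pair pmf_Pi)
      moreover have "pmf (fates I y) \<omega> = 0" using i unfolding fates_def by (subst pmf_Pi) auto
      ultimately show ?thesis by simp
    qed
    finally show "pmf (map_pmf ?f (pair_pmf (pair_pmf EP TP) SP)) \<omega> = pmf (fates I y) \<omega>" .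
  qed
  finally show ?thesis .
qed

text \<open>Replacing the real and simulated times by \<open>swap\<close> of a fresh pair does not
  change the law. Afterwards the selected set depends on \<open>D\<close> alone, so
  \<open>D'\<close> drops out and only independent fates remain.\<close>

theorem expected_value_lp_policy_eq:
  "expected_value I (lp_policy I y) = (\<Sum>j\<in>opts I. \<Sum>t=1..horizon I. val I j * measure_pmf.prob (fates I y) (Chosen I j t))"
proof -
  let ?h = "\<lambda>((e, \<tau>), (s, g)). gain (s, e) (\<tau>, g)"
  have "expected_value I (lp_policy I y) = measure_pmf.expectation Big ?h"
    unfolding expected_value_lp_policy pair_rearrange integral_map_pmf
    by (intro Bochner_Integration.integral_cong) auto
  also have "\<dots> = measure_pmf.expectation Big (\<lambda>((e, \<tau>), x). ?h ((e, \<tau>), swap I \<tau> e x))"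
    by (subst swap_preserves[symmetric], subst integral_map_pmf)
       (intro Bochner_Integration.integral_cong, auto)
  also have "\<dots> = measure_pmf.expectation Big
     (\<lambda>((e, \<tau>), (D, D')). \<Sum>j\<in>opts I. \<Sum>t=1..horizon I. val I j * indicator (Chosen I j t) (zip3 \<tau> e D))"
  proof (rule integral_cong_AE)
    show "AE x in measure_pmf Big. (\<lambda>((e, \<tau>), x). ?h ((e, \<tau>), swap I \<tau> e x)) x =
      (\<lambda>((e, \<tau>), (D, D')). \<Sum>j\<in>opts I. \<Sum>t=1..horizon I. val I j * indicator (Chosen I j t) (zip3 \<tau> e D)) x"
      unfolding AE_measure_pmf_iff
    proof
      fix x assume "x \<in> set_pmf Big"
      moreover obtain e \<tau> D D' where x: "x = ((e, \<tau>), (D, D'))" by (metis surj_pair)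
      ultimately have sup: "((e, \<tau>), (D, D')) \<in> set_pmf Big" by simp
      obtain s g where sg: "swap I \<tau> e (D, D') = (s, g)" by (metis surj_pair)
      have sel: "selected I (plan_rule I \<tau> g) s e = {j. goes I \<tau> e D j}"
        by (rule plan_rule_simulation[OF sg[symmetric]]) (rule support_positive(1)[OF sup])
      have in1: "(\<Sum>t=1..horizon I. val I j * indicator (Chosen I j t) (zip3 \<tau> e D)) = (if goes I \<tau> e D j then val I j else 0)"
        if j: "j \<in> opts I" for j
      proof -
        have "(\<Sum>t=1..horizon I. val I j * indicator (Chosen I j t) (zip3 \<tau> e D)) =
           (\<Sum>t=1..horizon I. if t = \<tau> j then (if zip3 \<tau> e D \<in> Chosen I j t then val I j else 0) else 0)"
          by (intro sum.cong refl) (auto simp: Chosen_iff indicator_def)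
        then show ?thesis using support_positive(1)[OF sup j] j by (auto simp: goes_def)
      qed
      have *: "{j. goes I \<tau> e D j} = {j \<in> opts I. goes I \<tau> e D j}" by (auto simp: goes_def)
      have "(\<Sum>j\<in>{j. goes I \<tau> e D j}. val I j) = (\<Sum>j\<in>opts I. if goes I \<tau> e D j then val I j else 0)"
        by (subst *, subst sum.inter_filter) auto
      also have "\<dots> = (\<Sum>j\<in>opts I. \<Sum>t=1..horizon I. val I j * indicator (Chosen I j t) (zip3 \<tau> e D))"
        by (intro sum.cong refl in1[symmetric])
      finally show "(\<lambda>((e, \<tau>), x). ?h ((e, \<tau>), swap I \<tau> e x)) x =
        (\<lambda>((e, \<tau>), (D, D')). \<Sum>j\<in>opts I. \<Sum>t=1..horizon I. val I j * indicator (Chosen I j t) (zip3 \<tau> e D)) x"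
        unfolding x by (simp only: prod.case sg gain_def sel)
    qed
  qed auto
  also have "\<dots> = measure_pmf.expectation (fates I y) (\<lambda>\<omega>. \<Sum>j\<in>opts I. \<Sum>t=1..horizon I. val I j * indicator (Chosen I j t) \<omega>)"
    unfolding fates_law[symmetric] integral_map_pmf
    by (intro Bochner_Integration.integral_cong) auto
  also have "\<dots> = (\<Sum>j\<in>opts I. \<Sum>t=1..horizon I. measure_pmf.expectation (fates I y) (\<lambda>\<omega>. val I j * indicator (Chosen I j t) \<omega>))"
  proof -
    have int: "integrable (measure_pmf (fates I y)) (\<lambda>\<omega>. val I j * indicator (Chosen I j t) \<omega>)" for j t
      by (intro integrable_mult_right integrable_real_indicator) (auto simp: less_top[symmetric])
    show ?thesis by (simp only: Bochner_Integration.integral_sum Bochner_Integration.integrable_sum int)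
  qed
  finally show ?thesis by simp
qed

end

section \<open>Solving the linear program\<close>

text \<open>The linear program as a packing program: column \<open>q\<close> stands for option \<open>q div H + 1\<close> at time
  \<open>q mod H + 1\<close>, where \<open>H\<close> is the horizon; the rows are those of the options, of the times, and of
  the capacity. The entries of the capacity row are \<open>0 / 0 = 0\<close> if the capacity is 0.\<close>

definition lp_rows :: "sse_instance \<Rightarrow> nat" where
  "lp_rows I = num_opts I + horizon I + 1"

definition lp_cols :: "sse_instance \<Rightarrow> nat" where
  "lp_cols I = num_opts I * horizon I"

definition lp_coeff :: "sse_instance \<Rightarrow> nat \<Rightarrow> nat \<Rightarrow> real" where
  "lp_coeff I q c = (let H = horizon I; j = q div H; t = q mod H; p = tail (exp_dist I (Suc j)) (Suc t) in
     if c < num_opts I then if c = j then 1 else 0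
     else if c < num_opts I + H then
       if t \<le> c - num_opts I then p * tail (eval_dist I (Suc j)) (c - num_opts I - t) else 0
     else p * wgt I (Suc j) / capacity I)"

definition lp_obj :: "sse_instance \<Rightarrow> nat \<Rightarrow> real" where
  "lp_obj I q = val I (Suc (q div horizon I)) *
     tail (exp_dist I (Suc (q div horizon I))) (Suc (q mod horizon I))"

definition lp_result :: "sse_instance \<Rightarrow> pack_state" where
  "lp_result I = pack (lp_rows I) (lp_cols I) (lp_coeff I) (lp_obj I) (1000 * (lp_rows I * lp_rows I))"

definition lp_scale :: "sse_instance \<Rightarrow> real" where
  "lp_scale I = fst (best (snd (snd (lp_result I))) (lp_rows I))"

definition lp_y :: "sse_instance \<Rightarrow> nat \<Rightarrow> nat \<Rightarrow> real" where
  "lp_y I j t = fst (snd (lp_result I)) ((j - 1) * horizon I + (t - 1)) / lp_scale I"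

lemma sum_columns:
  fixes f :: "nat \<Rightarrow> real"
  assumes "0 < (H::nat)"
  shows "(\<Sum>q<n * H. f q) = (\<Sum>j=1..n. \<Sum>t=1..H. f ((j - 1) * H + (t - 1)))"
proof -
  have "(\<Sum>q<n * H. f q) = (\<Sum>(j, t)\<in>{1..n} \<times> {1..H}. f ((j - 1) * H + (t - 1)))"
  proof (rule sum.reindex_bij_witness[where j = "\<lambda>q. (q div H + 1, q mod H + 1)"
        and i = "\<lambda>(j, t). (j - 1) * H + (t - 1)"])
    fix x assume "x \<in> {1..n} \<times> {1..H}"
    then obtain j t where x: "x = (Suc j, Suc t)" "j < n" "t < H"
      by (cases x) (metis Suc_le_D SigmaE atLeastAtMost_iff le_imp_less_Suc less_Suc_eq_le One_nat_def prod.inject Suc_le_lessD)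
    then show "(\<lambda>q. (q div H + 1, q mod H + 1)) ((\<lambda>(j, t). (j - 1) * H + (t - 1)) x) = x" by simp
    have "j * H + t < Suc j * H" using x by simp
    also have "\<dots> \<le> n * H" using x by (intro mult_le_mono1) simp
    finally show "(\<lambda>(j, t). (j - 1) * H + (t - 1)) x \<in> {..<n * H}" using x by simp
  next
    fix q assume "q \<in> {..<n * H}"
    then show "(q div H + 1, q mod H + 1) \<in> {1..n} \<times> {1..H}"
      using assms by (auto simp: Suc_le_eq less_mult_imp_div_less)
  qed auto
  then show ?thesis by (simp only: sum.cartesian_product)
qed

context
  fixes I :: sse_instance
  assumes valid: "valid_instance I"
    and small: "\<And>j. j \<in> opts I \<Longrightarrow> 10 * wgt I j \<le> capacity I"
begin

private abbreviation (input) "n \<equiv> num_opts I"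
private abbreviation (input) "H \<equiv> horizon I"

lemma n_pos: "0 < n" and H_pos: "0 < H"
  using valid max_eval_pos[OF valid] by (auto simp: valid_instance_def)

lemma capacity_nonneg: "0 \<le> capacity I"
  using valid by (simp add: valid_instance_def)

lemma wgt_le: "j \<in> opts I \<Longrightarrow> 0 \<le> wgt I j \<and> wgt I j \<le> capacity I"
proof -
  assume j: "j \<in> opts I"
  then have "0 \<le> wgt I j" using valid by (auto simp: valid_instance_def)
  then show ?thesis using small[OF j] by simp
qed

lemma col_range: "q < lp_cols I \<Longrightarrow> Suc (q div H) \<in> opts I \<and> Suc (q mod H) \<in> {1..H}"
  using H_pos by (auto simp: lp_cols_def Suc_le_eq less_mult_imp_div_less)

lemma coeff_at:
  assumes "j \<in> opts I" "t \<in> {1..H}"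
  shows "lp_coeff I ((j - 1) * H + (t - 1)) c =
     (if c < n then if c = j - 1 then 1 else 0
      else if c < n + H then if t \<le> Suc (c - n) then tail (exp_dist I j) t * tail (eval_dist I j) (Suc (c - n) - t) else 0
      else tail (exp_dist I j) t * wgt I j / capacity I)"
    and "lp_obj I ((j - 1) * H + (t - 1)) = val I j * tail (exp_dist I j) t"
proof -
  obtain j' t' where [simp]: "j = Suc j'" "t = Suc t'" "t' < H" using assms by (cases j; cases t) auto
  have *: "((j - 1) * H + (t - 1)) div H = j'" "((j - 1) * H + (t - 1)) mod H = t'" using H_pos by auto
  show "lp_coeff I ((j - 1) * H + (t - 1)) c =
     (if c < n then if c = j - 1 then 1 else 0
      else if c < n + H then if t \<le> Suc (c - n) then tail (exp_dist I j) t * tail (eval_dist I j) (Suc (c - n) - t) else 0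
      else tail (exp_dist I j) t * wgt I j / capacity I)"
    unfolding lp_coeff_def Let_def * by simp
  show "lp_obj I ((j - 1) * H + (t - 1)) = val I j * tail (exp_dist I j) t"
    unfolding lp_obj_def * by simp
qed

text \<open>The assumption on the weights bounds the entries of the capacity row by 1. The row of
  its option gives each column its entry 1.\<close>

lemma packing_lp: "packing (lp_rows I) (lp_cols I) (lp_coeff I) (lp_obj I)"
proof
  fix q c assume q: "q < lp_cols I"
  note cr = col_range[OF q]
  show "lp_coeff I q c \<in> {0..1}"
  proof -
    let ?j = "Suc (q div H)" and ?t = "Suc (q mod H)"
    have w: "0 \<le> wgt I ?j" "wgt I ?j \<le> capacity I" using wgt_le[OF conjunct1[OF cr]] by auto
    have "0 \<le> wgt I ?j / capacity I" "wgt I ?j / capacity I \<le> 1"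
      using w capacity_nonneg by (auto simp: divide_le_eq_1)
    then have "0 \<le> tail (exp_dist I ?j) ?t * (wgt I ?j / capacity I)"
      "tail (exp_dist I ?j) ?t * (wgt I ?j / capacity I) \<le> 1"
      by (intro mult_nonneg_nonneg mult_le_one; simp)+
    then show ?thesis by (auto simp: lp_coeff_def Let_def intro: mult_le_one)
  qed
  have "q div H < lp_rows I \<and> lp_coeff I q (q div H) = 1"
    using cr by (auto simp: lp_coeff_def Let_def lp_rows_def)
  then show "\<exists>c<lp_rows I. lp_coeff I q c = 1" by blast
  show "0 < lp_obj I q"
    using cr valid exp_tail_pos[OF valid conjunct1[OF cr]] unfolding lp_obj_def
    by (intro mult_pos_pos) (auto simp: valid_instance_def)
next
  show "0 < lp_cols I" using n_pos H_pos by (simp add: lp_cols_def)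
qed

lemma columns_sum: "(\<Sum>q<lp_cols I. f q) = (\<Sum>j\<in>opts I. \<Sum>t=1..H. f ((j - 1) * H + (t - 1)))" for f :: "nat \<Rightarrow> real"
  unfolding lp_cols_def by (rule sum_columns[OF H_pos])

lemma row_sum:
  fixes x :: "nat \<Rightarrow> real"
  defines "y \<equiv> \<lambda>j t. x ((j - 1) * H + (t - 1))"
  shows "c < n \<Longrightarrow> (\<Sum>q<lp_cols I. x q * lp_coeff I q c) = (\<Sum>t=1..H. y (Suc c) t)"
    and "u \<in> {1..H} \<Longrightarrow> (\<Sum>q<lp_cols I. x q * lp_coeff I q (n + (u - 1))) =
       (\<Sum>j\<in>opts I. \<Sum>t=1..u. y j t * tail (exp_dist I j) t * tail (eval_dist I j) (u - t))"
    and "(\<Sum>q<lp_cols I. x q * lp_coeff I q (n + H)) =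
       (\<Sum>j\<in>opts I. \<Sum>t=1..H. wgt I j * (y j t * tail (exp_dist I j) t)) / capacity I"
proof -
  assume c: "c < n"
  have "(\<Sum>q<lp_cols I. x q * lp_coeff I q c) = (\<Sum>j\<in>opts I. if j = Suc c then (\<Sum>t=1..H. y (Suc c) t) else 0)"
    unfolding columns_sum
  proof (intro sum.cong refl)
    fix j assume j: "j \<in> opts I"
    show "(\<Sum>t=1..H. x ((j - 1) * H + (t - 1)) * lp_coeff I ((j - 1) * H + (t - 1)) c) =
       (if j = Suc c then (\<Sum>t=1..H. y (Suc c) t) else 0)"
    proof (cases "j = Suc c")
      case True
      have "(\<Sum>t=1..H. x ((j - 1) * H + (t - 1)) * lp_coeff I ((j - 1) * H + (t - 1)) c) = (\<Sum>t=1..H. y (Suc c) t)"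
      proof (rule sum.cong[OF refl])
        fix t assume t: "t \<in> {1..H}"
        show "x ((j - 1) * H + (t - 1)) * lp_coeff I ((j - 1) * H + (t - 1)) c = y (Suc c) t"
          unfolding coeff_at(1)[OF j t] using c True by (simp add: y_def)
      qed
      then show ?thesis using True by simp
    next
      case False
      have "(\<Sum>t=1..H. x ((j - 1) * H + (t - 1)) * lp_coeff I ((j - 1) * H + (t - 1)) c) = 0"
      proof (rule sum.neutral, rule ballI)
        fix t assume t: "t \<in> {1..H}"
        have "c \<noteq> j - 1" using False j by auto
        then show "x ((j - 1) * H + (t - 1)) * lp_coeff I ((j - 1) * H + (t - 1)) c = 0"
          unfolding coeff_at(1)[OF j t] using c by simp
      qed
      then show ?thesis using False by simp
    qed
  qed
  also have "\<dots> = (\<Sum>t=1..H. y (Suc c) t)" using c by (subst sum.delta) auto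
  finally show "(\<Sum>q<lp_cols I. x q * lp_coeff I q c) = (\<Sum>t=1..H. y (Suc c) t)" .
next
  assume u: "u \<in> {1..H}"
  then have u': "(n + (u - 1) < n) = False" "(n + (u - 1) < n + H) = True" "Suc (n + (u - 1) - n) = u"
    by auto
  have rs: "(\<Sum>t=1..H. x ((j - 1) * H + (t - 1)) * lp_coeff I ((j - 1) * H + (t - 1)) (n + (u - 1))) =
      (\<Sum>t=1..u. y j t * tail (exp_dist I j) t * tail (eval_dist I j) (u - t))" if j: "j \<in> opts I" for j
  proof (rule sum.mono_neutral_cong_right)
    show "\<forall>t\<in>{1..H} - {1..u}. x ((j - 1) * H + (t - 1)) * lp_coeff I ((j - 1) * H + (t - 1)) (n + (u - 1)) = 0"
    proof
      fix t assume t: "t \<in> {1..H} - {1..u}"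
      then have "t \<in> {1..H}" "u < t" by auto
      then show "x ((j - 1) * H + (t - 1)) * lp_coeff I ((j - 1) * H + (t - 1)) (n + (u - 1)) = 0"
        unfolding coeff_at(1)[OF j \<open>t \<in> {1..H}\<close>] u' by simp
    qed
    fix t assume t: "t \<in> {1..u}"
    then have t': "t \<in> {1..H}" using u by simp
    show "x ((j - 1) * H + (t - 1)) * lp_coeff I ((j - 1) * H + (t - 1)) (n + (u - 1)) =
      y j t * tail (exp_dist I j) t * tail (eval_dist I j) (u - t)"
      unfolding coeff_at(1)[OF j t'] u' using t by (simp add: y_def)
  qed (use u in auto)
  show "(\<Sum>q<lp_cols I. x q * lp_coeff I q (n + (u - 1))) =
       (\<Sum>j\<in>opts I. \<Sum>t=1..u. y j t * tail (exp_dist I j) t * tail (eval_dist I j) (u - t))"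
    unfolding columns_sum by (rule sum.cong[OF refl rs])
next
  show "(\<Sum>q<lp_cols I. x q * lp_coeff I q (n + H)) =
       (\<Sum>j\<in>opts I. \<Sum>t=1..H. wgt I j * (y j t * tail (exp_dist I j) t)) / capacity I"
    unfolding columns_sum sum_divide_distrib
  proof (intro sum.cong refl)
    fix j t assume jt: "j \<in> opts I" "t \<in> {1..H}"
    show "x ((j - 1) * H + (t - 1)) * lp_coeff I ((j - 1) * H + (t - 1)) (n + H) =
       wgt I j * (y j t * tail (exp_dist I j) t) / capacity I"
      unfolding coeff_at(1)[OF jt] by (simp add: y_def)
  qed
qed

lemma obj_sum: "(\<Sum>q<lp_cols I. lp_obj I q * x q) = lp_value I (\<lambda>j t. x ((j - 1) * H + (t - 1)))"
  unfolding columns_sum lp_value_def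
proof (intro sum.cong refl)
  fix j t assume jt: "j \<in> opts I" "t \<in> {1..H}"
  show "lp_obj I ((j - 1) * H + (t - 1)) * x ((j - 1) * H + (t - 1)) =
     val I j * (x ((j - 1) * H + (t - 1)) * tail (exp_dist I j) t)"
    unfolding coeff_at(2)[OF jt] by simp
qed

interpretation pk: packing "lp_rows I" "lp_cols I" "lp_coeff I" "lp_obj I" by (rule packing_lp)

lemma lp_y_near_optimal:
  shows "lp_feasible I (lp_y I)"
    and "lp_feasible I y \<Longrightarrow> 93 / 100 * lp_value I y \<le> lp_value I (lp_y I)"
    and "0 < lp_scale I"
proof -
  define k where "k = 1000 * (lp_rows I * lp_rows I)"
  have scale: "lp_scale I = pk.Lmax k" by (simp add: lp_scale_def lp_result_def pk.Lmax_def k_def)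
  define x where "x q = pk.N k q / pk.Lmax k" for q
  have y_x: "lp_y I = (\<lambda>j t. x ((j - 1) * H + (t - 1)))"
    by (simp add: lp_y_def x_def scale lp_result_def k_def fun_eq_iff)
  \<comment> \<open>The zero solution is an instance from which the positivity of the scale can be
    read off.\<close>
  have "(\<Sum>q<lp_cols I. 0 * lp_coeff I q c) \<le> 1" for c by simp
  from pk.packing_approximation(2)[OF k_def, of "\<lambda>_. 0"] this
  have Lpos: "0 < pk.Lmax k" by simp
  then show "0 < lp_scale I" by (simp add: scale)
  have x0: "0 \<le> x q" for q using pk.N_nonneg Lpos by (simp add: x_def)
  have rows: "(\<Sum>q<lp_cols I. x q * lp_coeff I q c) \<le> 1" if "c < lp_rows I" for c
    using pk.Lmax_upper[OF that, of k] Lpos by (simp add: x_def flip: sum_divide_distrib)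
  show "lp_feasible I (lp_y I)"
    unfolding lp_feasible_def y_x
  proof (intro conjI ballI)
    fix j assume "j \<in> opts I"
    then show "(\<Sum>t=1..H. x ((j - 1) * H + (t - 1))) \<le> 1"
      using rows[of "j - 1"] row_sum(1)[of "j - 1" x] by (auto simp: lp_rows_def)
  next
    fix u assume u: "u \<in> {1..H}"
    then show "(\<Sum>j\<in>opts I. \<Sum>t=1..u. x ((j - 1) * H + (t - 1)) * tail (exp_dist I j) t * tail (eval_dist I j) (u - t)) \<le> 1"
      using rows[of "n + (u - 1)"] row_sum(2)[OF u, of x] by (auto simp: lp_rows_def)
  next
    have *: "(\<Sum>j\<in>opts I. \<Sum>t=1..H. wgt I j * (x ((j - 1) * H + (t - 1)) * tail (exp_dist I j) t)) / capacity I \<le> 1"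
      using rows[of "n + H"] row_sum(3)[of x] by (simp add: lp_rows_def)
    show "(\<Sum>j\<in>opts I. \<Sum>t=1..H. wgt I j * (x ((j - 1) * H + (t - 1)) * tail (exp_dist I j) t)) \<le> capacity I"
    \<comment> \<open>At capacity 0 the scaled row is 0 and carries no information, but then all
      weights vanish.\<close>
    proof (cases "capacity I = 0")
      case True
      then have "wgt I j = 0" if "j \<in> opts I" for j using wgt_le[OF that] by simp
      then show ?thesis using True by simp
    next
      case False then show ?thesis using * capacity_nonneg by (simp add: divide_le_eq_1)
    qed
  qed (use x0 in auto)
  assume feas: "lp_feasible I y"
  define x' where "x' q = y (Suc (q div H)) (Suc (q mod H))" for q
  have x'_at: "x' ((j - 1) * H + (t - 1)) = y j t" if "j \<in> opts I" "t \<in> {1..H}" for j t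
  proof -
    have "x' (a * H + b) = y (Suc a) (Suc b)" if "b < H" for a b
    proof -
      have "(a * H + b) div H = a" "(a * H + b) mod H = b"
        unfolding div_mult_self3[OF H_pos[THEN gr_implies_not0]] mod_mult_self3 using that by simp_all
      then show ?thesis by (simp only: x'_def)
    qed
    from this[of "t - 1" "j - 1"] show ?thesis using that by (cases j; cases t) simp_all
  qed
  have "93 / 100 * (\<Sum>q<lp_cols I. lp_obj I q * x' q) \<le> (\<Sum>q<lp_cols I. lp_obj I q * (pk.N k q / pk.Lmax k))"
  proof (rule pk.packing_approximation(1)[OF k_def])
    fix q assume "q < lp_cols I"
    from col_range[OF this] show "0 \<le> x' q" using feas by (simp add: x'_def lp_feasible_def)
  next
    fix c assume c: "c < lp_rows I"
    consider "c < n" | "n \<le> c" "c < n + H" | "c = n + H" using c unfolding lp_rows_def by linarith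
    then show "(\<Sum>q<lp_cols I. x' q * lp_coeff I q c) \<le> 1"
    proof cases
      case 1
      have "(\<Sum>q<lp_cols I. x' q * lp_coeff I q c) = (\<Sum>t=1..H. y (Suc c) t)"
        unfolding row_sum(1)[OF 1] by (rule sum.cong[OF refl x'_at]) (use 1 in auto)
      then show ?thesis using feas 1 by (auto simp: lp_feasible_def)
    next
      case 2
      define u where "u = Suc (c - n)"
      have u: "u \<in> {1..H}" "c = n + (u - 1)" using 2 by (auto simp: u_def)
      have "(\<Sum>q<lp_cols I. x' q * lp_coeff I q c) =
        (\<Sum>j\<in>opts I. \<Sum>t=1..u. y j t * tail (exp_dist I j) t * tail (eval_dist I j) (u - t))"
        unfolding u(2) row_sum(2)[OF u(1)]
      proof (intro sum.cong refl)
        fix j t assume "j \<in> opts I" "t \<in> {1..u}"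
        then have "x' ((j - 1) * H + (t - 1)) = y j t" using u(1) by (intro x'_at) auto
        then show "x' ((j - 1) * H + (t - 1)) * tail (exp_dist I j) t * tail (eval_dist I j) (u - t) =
          y j t * tail (exp_dist I j) t * tail (eval_dist I j) (u - t)" by simp
      qed
      then show ?thesis using feas u by (auto simp: lp_feasible_def)
    next
      case 3
      have "(\<Sum>q<lp_cols I. x' q * lp_coeff I q c) =
        (\<Sum>j\<in>opts I. \<Sum>t=1..H. wgt I j * (y j t * tail (exp_dist I j) t)) / capacity I"
        unfolding 3 row_sum(3)
      proof (intro arg_cong2[where f = "(/)"] sum.cong refl)
        fix j t assume "j \<in> opts I" "t \<in> {1..H}"
        then show "wgt I j * (x' ((j - 1) * H + (t - 1)) * tail (exp_dist I j) t) = wgt I j * (y j t * tail (exp_dist I j) t)"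
          by (simp only: x'_at)
      qed
      also have "\<dots> \<le> 1"
        using feas capacity_nonneg by (cases "capacity I = 0") (auto simp: lp_feasible_def divide_le_eq_1)
      finally show ?thesis .
    qed
  qed
  also have "\<dots> = lp_value I (lp_y I)" unfolding x_def[symmetric] obj_sum y_x ..
  also have "(\<Sum>q<lp_cols I. lp_obj I q * x' q) = lp_value I y"
    unfolding obj_sum lp_value_def
  proof (intro sum.cong refl)
    fix j t assume "j \<in> opts I" "t \<in> {1..H}"
    then show "val I j * (x' ((j - 1) * H + (t - 1)) * tail (exp_dist I j) t) = val I j * (y j t * tail (exp_dist I j) t)"
      by (simp only: x'_at)
  qed
  finally show "93 / 100 * lp_value I y \<le> lp_value I (lp_y I)" .
qed

end

section \<open>A language with arrays\<close>

text \<open>Structured programs over arrays. \<open>NPar\<close> are parameters fixed throughout a run, \<open>NInp\<close> and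
  \<open>RInp\<close> read the input, and \<open>NArr k e\<close>, \<open>RArr k e\<close> are the entries of index \<open>e\<close> of the \<open>k\<close>-th
  array of integers and of reals. Scalars are entries of index 0. A loop runs over
  \<open>0, \<dots>, b - 1\<close>, where \<open>b\<close> is a parameter.\<close>

datatype an = NCon nat | NPar nat | NInp an | NArr nat an | NPlus an an | NMinus an an

datatype ar = RNat an | RInp an | RRnd an | RArr nat an
  | RPlus ar ar | RMinus ar ar | RTimes ar ar | ROver ar ar

datatype ab = BNat an an | BReal ar ar | BNeg ab | BConj ab ab

datatype stmt = SetN nat an an | SetR nat an ar | Then stmt stmt (infixr ";;" 60)
  | IfElse ab stmt stmt | For nat nat stmt

type_synonym arrays = "(nat \<Rightarrow> nat \<Rightarrow> nat) \<times> (nat \<Rightarrow> nat \<Rightarrow> real)"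

text \<open>Contains the products that serve as loop bounds and addresses. \<open>4 * n + 4\<close>
  bounds the length of the integer input, with at most n past selections; the last entry is the
  length of the real input.\<close>

definition par :: "(nat \<Rightarrow> nat) \<Rightarrow> nat \<Rightarrow> nat" where
  "par m i = (let n = m 0; T = m 1 in
     [n, T, m 2, m 3, n * T, n * (n * T), n + n * T + 1, 1000, 4 * n + 4, 1 + 2 * n + n * T + n * (n * T)] ! i)"

abbreviation (input) "par_n \<equiv> 0::nat"
abbreviation (input) "par_T \<equiv> 1::nat"
abbreviation (input) "par_now \<equiv> 2::nat"
abbreviation (input) "par_len \<equiv> 3::nat"
abbreviation (input) "par_H \<equiv> 4::nat"
abbreviation (input) "par_Q \<equiv> 5::nat"
abbreviation (input) "par_m \<equiv> 6::nat"
abbreviation (input) "par_rep \<equiv> 7::nat"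
abbreviation (input) "par_nbase \<equiv> 8::nat"
abbreviation (input) "par_rbase \<equiv> 9::nat"

text \<open>The inputs lie below the addresses \<open>par m par_nbase\<close> and \<open>par m par_rbase\<close>, the arrays above
  them. Input addresses are cut off there, so that the meaning of a program does not depend on
  out-of-range reads.\<close>

context
  fixes u :: "nat \<Rightarrow> real" and m :: "nat \<Rightarrow> nat" and r :: "nat \<Rightarrow> real"
begin

primrec an_val :: "arrays \<Rightarrow> an \<Rightarrow> nat" where
  "an_val s (NCon c) = c"
| "an_val s (NPar i) = par m i"
| "an_val s (NInp e) = m (min (an_val s e) (par m par_nbase - 1))"
| "an_val s (NArr k e) = fst s k (an_val s e)"
| "an_val s (NPlus a b) = an_val s a + an_val s b"
| "an_val s (NMinus a b) = an_val s a - an_val s b"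

primrec ar_val :: "arrays \<Rightarrow> ar \<Rightarrow> real" where
  "ar_val s (RNat a) = real (an_val s a)"
| "ar_val s (RInp e) = r (min (an_val s e) (par m par_rbase - 1))"
| "ar_val s (RRnd e) = u (an_val s e)"
| "ar_val s (RArr k e) = snd s k (an_val s e)"
| "ar_val s (RPlus a b) = ar_val s a + ar_val s b"
| "ar_val s (RMinus a b) = ar_val s a - ar_val s b"
| "ar_val s (RTimes a b) = ar_val s a * ar_val s b"
| "ar_val s (ROver a b) = ar_val s a / ar_val s b"

primrec ab_val :: "arrays \<Rightarrow> ab \<Rightarrow> bool" where
  "ab_val s (BNat a b) = (an_val s a < an_val s b)"
| "ab_val s (BReal a b) = (ar_val s a < ar_val s b)"
| "ab_val s (BNeg a) = (\<not> ab_val s a)"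
| "ab_val s (BConj a b) = (ab_val s a \<and> ab_val s b)"

definition set_n :: "nat \<Rightarrow> nat \<Rightarrow> nat \<Rightarrow> arrays \<Rightarrow> arrays" where
  "set_n k i v s = ((fst s)(k := (fst s k)(i := v)), snd s)"

definition set_r :: "nat \<Rightarrow> nat \<Rightarrow> real \<Rightarrow> arrays \<Rightarrow> arrays" where
  "set_r k i v s = (fst s, (snd s)(k := (snd s k)(i := v)))"

primrec iterate :: "(nat \<Rightarrow> arrays \<Rightarrow> arrays) \<Rightarrow> nat \<Rightarrow> arrays \<Rightarrow> arrays" where
  "iterate f 0 s = s"
| "iterate f (Suc i) s = f i (iterate f i s)"

primrec run :: "stmt \<Rightarrow> arrays \<Rightarrow> arrays" where
  "run (SetN k e a) s = set_n k (an_val s e) (an_val s a) s"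
| "run (SetR k e a) s = set_r k (an_val s e) (ar_val s a) s"
| "run (P ;; Q) s = run Q (run P s)"
| "run (IfElse b P Q) s = (if ab_val s b then run P s else run Q s)"
| "run (For k b P) s = iterate (\<lambda>i s. run P (set_n k 0 i s)) (par m b) s"

end

section \<open>Compilation to machine programs\<close>

definition times32 :: "nexp \<Rightarrow> nexp" where
  "times32 e = (let d = (\<lambda>e. NAdd e e) in d (d (d (d (d e)))))"

lemma nval_times32 [simp]: "nval \<sigma> (times32 e) = 32 * nval \<sigma> e"
  by (simp add: times32_def)

definition nbase :: nexp where
  "nbase = NAdd (NAdd (NAdd (NMem (NConst 0)) (NMem (NConst 0))) (NAdd (NMem (NConst 0)) (NMem (NConst 0)))) (NConst 4)"

text \<open>Arrays of unbounded length are interleaved with stride 32, a factor obtained by five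
  doublings. Among the integer slots, slot 0 holds \<open>n * T\<close> at index 0 and
  \<open>n * (n * T)\<close> at index 1, slot 1 holds the loop counters, and the arrays of the
  language start at slot 2.\<close>

definition naddr :: "nat \<Rightarrow> nexp \<Rightarrow> nexp" where
  "naddr k e = NAdd nbase (NAdd (times32 e) (NConst k))"

definition par_exp :: "nat \<Rightarrow> nexp" where
  "par_exp i = (let n = NMem (NConst 0); H = NMem (naddr 0 (NConst 0)); Q = NMem (naddr 0 (NConst 1)) in
     [n, NMem (NConst 1), NMem (NConst 2), NMem (NConst 3), H, Q, NAdd (NAdd n H) (NConst 1), NConst 1000, nbase,
      NAdd (NAdd (NAdd (NConst 1) (NAdd n n)) H) Q] ! i)"

definition raddr :: "nat \<Rightarrow> nexp \<Rightarrow> nexp" where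
  "raddr k e = NAdd (par_exp par_rbase) (NAdd (times32 e) (NConst k))"

definition cutoff :: "nexp \<Rightarrow> nexp \<Rightarrow> nexp" where
  "cutoff e b = NSub e (NSub e (NSub b (NConst 1)))"

lemma nval_cutoff [simp]: "nval \<sigma> (cutoff e b) = min (nval \<sigma> e) (nval \<sigma> b - 1)"
  by (simp add: cutoff_def)

primrec an_code :: "an \<Rightarrow> nexp" where
  "an_code (NCon c) = NConst c"
| "an_code (NPar i) = par_exp i"
| "an_code (NInp e) = NMem (cutoff (an_code e) (par_exp par_nbase))"
| "an_code (NArr k e) = NMem (naddr (k + 2) (an_code e))"
| "an_code (NPlus a b) = NAdd (an_code a) (an_code b)"
| "an_code (NMinus a b) = NSub (an_code a) (an_code b)"

primrec ar_code :: "ar \<Rightarrow> rexp" where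
  "ar_code (RNat a) = ROfNat (an_code a)"
| "ar_code (RInp e) = RMem (cutoff (an_code e) (par_exp par_rbase))"
| "ar_code (RRnd e) = Rand (an_code e)"
| "ar_code (RArr k e) = RMem (raddr k (an_code e))"
| "ar_code (RPlus a b) = RAdd (ar_code a) (ar_code b)"
| "ar_code (RMinus a b) = RSub (ar_code a) (ar_code b)"
| "ar_code (RTimes a b) = RMul (ar_code a) (ar_code b)"
| "ar_code (ROver a b) = RDiv (ar_code a) (ar_code b)"

primrec ab_code :: "ab \<Rightarrow> bexp" where
  "ab_code (BNat a b) = NLess (an_code a) (an_code b)"
| "ab_code (BReal a b) = RLess (ar_code a) (ar_code b)"
| "ab_code (BNeg a) = BNot (ab_code a)"
| "ab_code (BConj a b) = BAnd (ab_code a) (ab_code b)"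

definition counter :: "nat \<Rightarrow> nexp" where "counter d = naddr 1 (NConst d)"

text \<open>\<open>d\<close> is the nesting depth; each depth has its own loop counter.\<close>

primrec code :: "nat \<Rightarrow> stmt \<Rightarrow> prog" where
  "code d (SetN k e a) = NStore (naddr (k + 2) (an_code e)) (an_code a)"
| "code d (SetR k e a) = RStore (raddr k (an_code e)) (ar_code a)"
| "code d (P ;; Q) = Seq (code d P) (code d Q)"
| "code d (IfElse b P Q) = Cond (ab_code b) (code d P) (code d Q)"
| "code d (For k b P) = Seq (NStore (counter d) (NConst 0))
     (While (NLess (NMem (counter d)) (par_exp b))
       (Seq (NStore (naddr (k + 2) (NConst 0)) (NMem (counter d)))
         (Seq (code (Suc d) P) (NStore (counter d) (NAdd (NMem (counter d)) (NConst 1))))))"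

primrec an_ok :: "an \<Rightarrow> bool" where
  "an_ok (NCon c) = True"
| "an_ok (NPar i) = (i < 10)"
| "an_ok (NInp e) = an_ok e"
| "an_ok (NArr k e) = (k < 30 \<and> an_ok e)"
| "an_ok (NPlus a b) = (an_ok a \<and> an_ok b)"
| "an_ok (NMinus a b) = (an_ok a \<and> an_ok b)"

primrec ar_ok :: "ar \<Rightarrow> bool" where
  "ar_ok (RNat a) = an_ok a"
| "ar_ok (RInp e) = an_ok e"
| "ar_ok (RRnd e) = an_ok e"
| "ar_ok (RArr k e) = (k < 32 \<and> an_ok e)"
| "ar_ok (RPlus a b) = (ar_ok a \<and> ar_ok b)"
| "ar_ok (RMinus a b) = (ar_ok a \<and> ar_ok b)"
| "ar_ok (RTimes a b) = (ar_ok a \<and> ar_ok b)"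
| "ar_ok (ROver a b) = (ar_ok a \<and> ar_ok b)"

primrec ab_ok :: "ab \<Rightarrow> bool" where
  "ab_ok (BNat a b) = (an_ok a \<and> an_ok b)"
| "ab_ok (BReal a b) = (ar_ok a \<and> ar_ok b)"
| "ab_ok (BNeg a) = ab_ok a"
| "ab_ok (BConj a b) = (ab_ok a \<and> ab_ok b)"

primrec stmt_ok :: "stmt \<Rightarrow> bool" where
  "stmt_ok (SetN k e a) = (k < 30 \<and> an_ok e \<and> an_ok a)"
| "stmt_ok (SetR k e a) = (k < 32 \<and> an_ok e \<and> ar_ok a)"
| "stmt_ok (P ;; Q) = (stmt_ok P \<and> stmt_ok Q)"
| "stmt_ok (IfElse b P Q) = (ab_ok b \<and> stmt_ok P \<and> stmt_ok Q)"
| "stmt_ok (For k b P) = (k < 30 \<and> b < 10 \<and> stmt_ok P)"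

text \<open>\<open>IfElse\<close> is charged for both branches, so that the bound depends on the
  loop bounds only and not on the data.\<close>

primrec cost :: "(nat \<Rightarrow> nat) \<Rightarrow> nat \<Rightarrow> stmt \<Rightarrow> nat" where
  "cost p d (SetN k e a) = ncost (naddr (k + 2) (an_code e)) + ncost (an_code a) + 1"
| "cost p d (SetR k e a) = ncost (raddr k (an_code e)) + rcost (ar_code a) + 1"
| "cost p d (P ;; Q) = cost p d P + cost p d Q"
| "cost p d (IfElse b P Q) = bcost (ab_code b) + cost p d P + cost p d Q"
| "cost p d (For k b P) = ncost (counter d) + 2 + bcost (NLess (NMem (counter d)) (par_exp b)) +
     p b * (bcost (NLess (NMem (counter d)) (par_exp b)) + ncost (naddr (k + 2) (NConst 0)) +
       4 * ncost (counter d) + 8 + cost p (Suc d) P)"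

text \<open>Sequencing adds polynomials and a loop contributes one more factor \<open>X + 1\<close>,
  so constant and degree depend on the text of the program alone.\<close>

lemma cost_polynomial: "\<exists>K D. \<forall>p X. (\<forall>i. p i \<le> X) \<longrightarrow> cost p d P \<le> K * (X + 1) ^ D"
proof (induction P arbitrary: d)
  case (SetN k e a)
  show ?case by (rule exI[of _ "cost (\<lambda>_. 0) d (SetN k e a)"], rule exI[of _ 0]) simp
next
  case (SetR k e a)
  show ?case by (rule exI[of _ "cost (\<lambda>_. 0) d (SetR k e a)"], rule exI[of _ 0]) simp
next
  case (Then P Q)
  obtain K1 D1 where 1: "\<And>p X. (\<forall>i. p i \<le> X) \<Longrightarrow> cost p d P \<le> K1 * (X + 1) ^ D1" using Then(1)[of d] by blast
  obtain K2 D2 where 2: "\<And>p X. (\<forall>i. p i \<le> X) \<Longrightarrow> cost p d Q \<le> K2 * (X + 1) ^ D2" using Then(2)[of d] by blast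
  have "cost p d (P ;; Q) \<le> (K1 + K2) * (X + 1) ^ (D1 + D2)" if "\<forall>i. p i \<le> X" for p X
  proof -
    have "(X + 1) ^ D1 \<le> (X + 1) ^ (D1 + D2)" "(X + 1) ^ D2 \<le> (X + 1) ^ (D1 + D2)" by (simp_all add: power_increasing)
    then have "K1 * (X + 1) ^ D1 + K2 * (X + 1) ^ D2 \<le> K1 * (X + 1) ^ (D1 + D2) + K2 * (X + 1) ^ (D1 + D2)"
      by (intro add_mono mult_left_mono) auto
    then show ?thesis using 1[OF that] 2[OF that] by (simp add: algebra_simps)
  qed
  then show ?case by blast
next
  case (IfElse b P Q)
  obtain K1 D1 where 1: "\<And>p X. (\<forall>i. p i \<le> X) \<Longrightarrow> cost p d P \<le> K1 * (X + 1) ^ D1" using IfElse(1)[of d] by blast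
  obtain K2 D2 where 2: "\<And>p X. (\<forall>i. p i \<le> X) \<Longrightarrow> cost p d Q \<le> K2 * (X + 1) ^ D2" using IfElse(2)[of d] by blast
  have "cost p d (IfElse b P Q) \<le> (bcost (ab_code b) + K1 + K2) * (X + 1) ^ (D1 + D2)" if "\<forall>i. p i \<le> X" for p X
  proof -
    have "(X + 1) ^ D1 \<le> (X + 1) ^ (D1 + D2)" "(X + 1) ^ D2 \<le> (X + 1) ^ (D1 + D2)" "1 \<le> (X + 1) ^ (D1 + D2)"
      by (simp_all add: power_increasing)
    then have "bcost (ab_code b) * 1 + K1 * (X + 1) ^ D1 + K2 * (X + 1) ^ D2
      \<le> bcost (ab_code b) * (X + 1) ^ (D1 + D2) + K1 * (X + 1) ^ (D1 + D2) + K2 * (X + 1) ^ (D1 + D2)"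
      by (intro add_mono mult_left_mono) auto
    then show ?thesis using 1[OF that] 2[OF that] by (simp add: algebra_simps)
  qed
  then show ?case by blast
next
  case (For k b P)
  obtain K1 D1 where 1: "\<And>p X. (\<forall>i. p i \<le> X) \<Longrightarrow> cost p (Suc d) P \<le> K1 * (X + 1) ^ D1" using For(1)[of "Suc d"] by blast
  define A where "A = ncost (counter d) + 2 + bcost (NLess (NMem (counter d)) (par_exp b))"
  define B where "B = bcost (NLess (NMem (counter d)) (par_exp b)) + ncost (naddr (k + 2) (NConst 0)) + 4 * ncost (counter d) + 8"
  have "cost p d (For k b P) \<le> (A + B + K1) * (X + 1) ^ Suc D1" if p: "\<forall>i. p i \<le> X" for p X
  proof -
    have 2: "1 \<le> (X + 1) ^ D1" by simp
    have "cost p d (For k b P) = A + p b * (B + cost p (Suc d) P)" by (simp add: A_def B_def algebra_simps)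
    also have "\<dots> \<le> A + (X + 1) * (B * (X + 1) ^ D1 + K1 * (X + 1) ^ D1)"
      using p 1[OF p] 2 by (intro add_mono mult_mono) (auto intro: le_SucI order_trans[of _ "B * 1"])
    also have "\<dots> \<le> A * (X + 1) ^ Suc D1 + (X + 1) * (B * (X + 1) ^ D1 + K1 * (X + 1) ^ D1)"
      by (intro add_mono) (auto simp del: power_Suc)
    finally show ?thesis by (simp add: algebra_simps)
  qed
  then show ?case by blast
qed

context
  fixes u :: "nat \<Rightarrow> real" and m :: "nat \<Rightarrow> nat" and r :: "nat \<Rightarrow> real"
begin

private abbreviation (input) "NB \<equiv> par m par_nbase"
private abbreviation (input) "RB \<equiv> par m par_rbase"

definition represents :: "store \<Rightarrow> arrays \<Rightarrow> bool" where
  "represents \<sigma> s \<longleftrightarrow> (\<forall>a<NB. fst \<sigma> a = m a) \<and> (\<forall>a<RB. snd \<sigma> a = r a) \<and>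
     fst \<sigma> NB = par m par_H \<and> fst \<sigma> (NB + 32) = par m par_Q \<and>
     (\<forall>k<30. \<forall>i. fst \<sigma> (NB + (32 * i + (k + 2))) = fst s k i) \<and>
     (\<forall>k<32. \<forall>i. snd \<sigma> (RB + (32 * i + k)) = snd s k i)"

lemma NB_eq: "NB = 4 * m 0 + 4" by (simp add: par_def Let_def)

lemma represents_par:
  assumes rep: "represents \<sigma> s" and i: "i < 10"
  shows "nval \<sigma> (par_exp i) = par m i"
proof -
  have inp: "fst \<sigma> 0 = m 0" "fst \<sigma> (Suc 0) = m (Suc 0)" "fst \<sigma> 2 = m 2" "fst \<sigma> 3 = m 3"
    using rep by (auto simp: represents_def NB_eq)
  have nb: "nval \<sigma> nbase = NB" by (simp add: nbase_def inp NB_eq)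
  have H: "nval \<sigma> (NMem (naddr 0 (NConst 0))) = m 0 * m 1" "nval \<sigma> (NMem (naddr 0 (NConst 1))) = m 0 * (m 0 * m 1)"
    using rep by (auto simp: represents_def naddr_def nb par_def Let_def)
  have "i = 0 \<or> i = 1 \<or> i = 2 \<or> i = 3 \<or> i = 4 \<or> i = 5 \<or> i = 6 \<or> i = 7 \<or> i = 8 \<or> i = 9"
    using i by presburger
  then show ?thesis
    by (elim disjE) (use inp nb H in \<open>simp_all add: par_exp_def par_def Let_def NB_eq\<close>)
qed

lemma represents_nbase: "represents \<sigma> s \<Longrightarrow> nval \<sigma> nbase = NB"
  using represents_par[of \<sigma> s par_nbase] by (simp add: par_exp_def Let_def)

lemma represents_naddr: "represents \<sigma> s \<Longrightarrow> nval \<sigma> (naddr k e) = NB + (32 * nval \<sigma> e + k)"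
  by (simp add: naddr_def represents_nbase)

lemma represents_raddr: "represents \<sigma> s \<Longrightarrow> nval \<sigma> (raddr k e) = RB + (32 * nval \<sigma> e + k)"
  by (simp add: raddr_def represents_par)

lemma an_code: "represents \<sigma> s \<Longrightarrow> an_ok e \<Longrightarrow> nval \<sigma> (an_code e) = an_val m s e"
proof (induction e)
  case (NInp e)
  have "NB - 1 < NB" by (simp add: NB_eq)
  then have "fst \<sigma> (min a (NB - 1)) = m (min a (NB - 1))" for a
    using NInp.prems(1) by (auto simp: represents_def min_def)
  then show ?case using NInp by (simp add: represents_par)
next
  case (NArr k e)
  then have "fst \<sigma> (NB + (32 * an_val m s e + (k + 2))) = fst s k (an_val m s e)"
    by (simp only: represents_def an_ok.simps)
  then show ?case using NArr by (simp add: represents_naddr)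
qed (auto simp: represents_par)

lemma ar_code: "represents \<sigma> s \<Longrightarrow> ar_ok e \<Longrightarrow> rval u \<sigma> (ar_code e) = ar_val u m r s e"
proof (induction e)
  case (RInp e)
  have "RB - 1 < RB" by (simp add: par_def Let_def)
  then have "snd \<sigma> (min a (RB - 1)) = r (min a (RB - 1))" for a
    using RInp.prems(1) by (auto simp: represents_def min_def)
  then show ?case using RInp by (simp add: represents_par an_code)
next
  case (RArr k e)
  then have "snd \<sigma> (RB + (32 * an_val m s e + k)) = snd s k (an_val m s e)"
    by (simp only: represents_def ar_ok.simps)
  then show ?case using RArr by (simp add: represents_raddr an_code)
qed (auto simp: an_code)

lemma ab_code: "represents \<sigma> s \<Longrightarrow> ab_ok e \<Longrightarrow> bval u \<sigma> (ab_code e) = ab_val u m r s e"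
  by (induction e) (auto simp: an_code ar_code)

lemma slot_eq: "k < 32 \<Longrightarrow> k' < 32 \<Longrightarrow> a + (32 * i' + k') = a + (32 * i + k) \<longleftrightarrow> i' = i \<and> k' = k"
  for a i i' k k' :: nat
proof -
  assume k: "k < 32" "k' < 32"
  have "32 * i + k = 32 * i' + k' \<Longrightarrow> i = i'"
    using arg_cong[of "32 * i + k" "32 * i' + k'" "\<lambda>x. x div 32"] k by simp
  then show ?thesis by auto
qed

lemma represents_set_n:
  assumes "represents \<sigma> s" "k < 30"
  shows "represents ((fst \<sigma>)(NB + (32 * i + (k + 2)) := v), snd \<sigma>) (set_n k i v s)"
proof -
  let ?a = "NB + (32 * i + (k + 2))"
  have "NB + (32 * i' + (k' + 2)) = ?a \<longleftrightarrow> i' = i \<and> k' = k" if "k' < 30" for i' k'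
    using slot_eq[of "k + 2" "k' + 2" NB i' i] that assms(2) by simp
  moreover have "NB \<noteq> ?a" by simp
  moreover have "NB + 32 \<noteq> ?a"
    using slot_eq[of "k + 2" 0 NB 1 i] assms(2) by simp
  moreover have "a \<noteq> ?a" if "a < NB" for a using that by linarith
  ultimately show ?thesis using assms unfolding represents_def set_n_def fst_conv snd_conv fun_upd_apply
    by (simp only: simp_thms if_False if_cancel) (simp split: if_split)
qed

lemma represents_set_r:
  assumes "represents \<sigma> s" "k < 32"
  shows "represents (fst \<sigma>, (snd \<sigma>)(RB + (32 * i + k) := v)) (set_r k i v s)"
proof -
  let ?a = "RB + (32 * i + k)"
  have "RB + (32 * i' + k') = ?a \<longleftrightarrow> i' = i \<and> k' = k" if "k' < 32" for i' k'
    using slot_eq[of k k' RB i' i] that assms(2) by simp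
  moreover have "a \<noteq> ?a" if "a < RB" for a using that by linarith
  ultimately show ?thesis using assms unfolding represents_def set_r_def fst_conv snd_conv fun_upd_apply
    by (simp split: if_split)
qed

lemma represents_counter:
  assumes "represents \<sigma> s"
  shows "represents ((fst \<sigma>)(NB + (32 * d + 1) := v), snd \<sigma>) s"
proof -
  let ?a = "NB + (32 * d + 1)"
  have "NB + (32 * i + (k + 2)) \<noteq> ?a" if "k < 30" for i k
    using slot_eq[of 1 "k + 2" NB i d] that by simp
  moreover have "NB \<noteq> ?a" by simp
  moreover have "NB + 32 \<noteq> ?a"
    using slot_eq[of 1 0 NB 1 d] by simp
  moreover have "a \<noteq> ?a" if "a < NB" for a using that by linarith
  ultimately show ?thesis using assms unfolding represents_def fst_conv snd_conv fun_upd_apply by simp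
qed

text \<open>The last conjunct says that the counters of the enclosing loops, at depths below
  \<open>d\<close>, survive; the loop case relies on it.\<close>

lemma code_correct:
  assumes "stmt_ok P" "represents \<sigma> s"
  shows "\<exists>k \<tau>. exec u (code d P) \<sigma> k \<tau> \<and> k \<le> cost (par m) d P \<and> represents \<tau> (run u m r P s) \<and>
    (\<forall>i<d. fst \<tau> (NB + (32 * i + 1)) = fst \<sigma> (NB + (32 * i + 1)))"
  using assms
proof (induction P arbitrary: d \<sigma> s)
  case (SetN k e a)
  let ?\<tau> = "((fst \<sigma>)(NB + (32 * an_val m s e + (k + 2)) := an_val m s a), snd \<sigma>)"
  have "exec u (code d (SetN k e a)) \<sigma> (cost (par m) d (SetN k e a)) ?\<tau>"
    using exec.NStore[of u "naddr (k + 2) (an_code e)" "an_code a" \<sigma>] SetN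
    by (simp add: represents_naddr an_code)
  moreover have "NB + (32 * i + 1) \<noteq> NB + (32 * an_val m s e + (k + 2))" for i
  proof -
    have "32 * i + 1 \<noteq> 32 * x + (k + 2)" if "k < 30" for x :: nat using that by presburger
    then show ?thesis using SetN(1) by simp
  qed
  ultimately show ?case using SetN represents_set_n[of \<sigma> s k] by (intro exI[of _ "cost (par m) d (SetN k e a)"] exI[of _ "?\<tau>"] conjI) auto
next
  case (SetR k e a)
  let ?\<tau> = "(fst \<sigma>, (snd \<sigma>)(RB + (32 * an_val m s e + k) := ar_val u m r s a))"
  have "exec u (code d (SetR k e a)) \<sigma> (cost (par m) d (SetR k e a)) ?\<tau>"
    using exec.RStore[of u "raddr k (an_code e)" "ar_code a" \<sigma>] SetR
    by (simp add: represents_raddr an_code ar_code)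
  then show ?case using SetR represents_set_r[of \<sigma> s k] by (intro exI[of _ "cost (par m) d (SetR k e a)"] exI[of _ "?\<tau>"] conjI) auto
next
  case (Then P Q)
  obtain k1 \<rho> where 1: "exec u (code d P) \<sigma> k1 \<rho>" "k1 \<le> cost (par m) d P" "represents \<rho> (run u m r P s)"
    "\<forall>i<d. fst \<rho> (NB + (32 * i + 1)) = fst \<sigma> (NB + (32 * i + 1))"
    using Then.IH(1)[of \<sigma> s d] Then.prems by auto
  obtain k2 \<tau> where 2: "exec u (code d Q) \<rho> k2 \<tau>" "k2 \<le> cost (par m) d Q" "represents \<tau> (run u m r Q (run u m r P s))"
    "\<forall>i<d. fst \<tau> (NB + (32 * i + 1)) = fst \<rho> (NB + (32 * i + 1))"
    using Then.IH(2)[of \<rho> "run u m r P s" d] Then.prems 1 by auto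
  have "exec u (code d (P ;; Q)) \<sigma> (k1 + k2) \<tau>" using exec.Seq[OF 1(1) 2(1)] by simp
  then show ?case using 1 2 by (intro exI[of _ "k1 + k2"] exI[of _ "\<tau>"] conjI) auto
next
  case (IfElse b P Q)
  show ?case
  proof (cases "ab_val u m r s b")
    case True
    then obtain k \<tau> where 1: "exec u (code d P) \<sigma> k \<tau>" "k \<le> cost (par m) d P" "represents \<tau> (run u m r P s)"
      "\<forall>i<d. fst \<tau> (NB + (32 * i + 1)) = fst \<sigma> (NB + (32 * i + 1))"
      using IfElse.IH(1)[of \<sigma> s d] IfElse.prems by auto
    have "exec u (code d (IfElse b P Q)) \<sigma> (bcost (ab_code b) + k) \<tau>"
      using exec.CondTrue[OF _ 1(1)] True IfElse.prems by (simp add: ab_code)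
    then show ?thesis using 1 True by (intro exI[of _ "bcost (ab_code b) + k"] exI[of _ "\<tau>"] conjI) auto
  next
    case False
    then obtain k \<tau> where 1: "exec u (code d Q) \<sigma> k \<tau>" "k \<le> cost (par m) d Q" "represents \<tau> (run u m r Q s)"
      "\<forall>i<d. fst \<tau> (NB + (32 * i + 1)) = fst \<sigma> (NB + (32 * i + 1))"
      using IfElse.IH(2)[of \<sigma> s d] IfElse.prems by auto
    have "exec u (code d (IfElse b P Q)) \<sigma> (bcost (ab_code b) + k) \<tau>"
      using exec.CondFalse[OF _ 1(1)] False IfElse.prems by (simp add: ab_code)
    then show ?thesis using 1 False by (intro exI[of _ "bcost (ab_code b) + k"] exI[of _ "\<tau>"] conjI) auto
  qed
next
  case (For k b P)
  let ?f = "\<lambda>i s. run u m r P (set_n k 0 i s)"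
  let ?cd = "NB + (32 * d + 1)"
  let ?W = "While (NLess (NMem (counter d)) (par_exp b))
       (Seq (NStore (naddr (k + 2) (NConst 0)) (NMem (counter d)))
         (Seq (code (Suc d) P) (NStore (counter d) (NAdd (NMem (counter d)) (NConst 1)))))"
  define g where "g = bcost (NLess (NMem (counter d)) (par_exp b))"
  define B where "B = g + ncost (naddr (k + 2) (NConst 0)) + 4 * ncost (counter d) + 8 + cost (par m) (Suc d) P"
  have ok: "k < 30" "b < 10" "stmt_ok P" using For.prems by auto
  \<comment> \<open>Induction on the iterations left, because \<open>exec\<close> unfolds a loop at
    the front while \<open>iterate\<close> grows at the end.\<close>
  have loop: "\<exists>c \<tau>. exec u ?W \<rho> c \<tau> \<and> c \<le> g + (par m b - i) * B \<and> represents \<tau> (iterate ?f (par m b) s) \<and>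
     (\<forall>i<d. fst \<tau> (NB + (32 * i + 1)) = fst \<rho> (NB + (32 * i + 1)))"
    if "represents \<rho> (iterate ?f i s)" "fst \<rho> ?cd = i" "i \<le> par m b" for i \<rho>
    using that
  proof (induction "par m b - i" arbitrary: i \<rho>)
    case 0
    then have i: "i = par m b" by simp
    have "\<not> bval u \<rho> (NLess (NMem (counter d)) (par_exp b))"
      using 0 ok i by (simp add: counter_def represents_naddr[OF 0(2)] represents_par[OF 0(2)])
    then have "exec u ?W \<rho> g \<rho>" unfolding g_def by (rule exec.WhileFalse)
    then show ?case using 0 i by (intro exI[of _ "g"] exI[of _ "\<rho>"] conjI) auto
  next
    case (Suc x)
    let ?s = "iterate ?f i s"
    have i: "i < par m b" using Suc.hyps(2) by simp
    have guard: "bval u \<rho> (NLess (NMem (counter d)) (par_exp b))"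
      using Suc.prems ok i by (simp add: counter_def represents_naddr[OF Suc.prems(1)] represents_par[OF Suc.prems(1)])
    define \<rho>1 where "\<rho>1 = ((fst \<rho>)(NB + (32 * 0 + (k + 2)) := i), snd \<rho>)"
    have e1: "exec u (NStore (naddr (k + 2) (NConst 0)) (NMem (counter d))) \<rho>
        (ncost (naddr (k + 2) (NConst 0)) + ncost (NMem (counter d)) + 1) \<rho>1"
      using exec.NStore[of u "naddr (k + 2) (NConst 0)" "NMem (counter d)" \<rho>] Suc.prems
      by (simp add: represents_naddr[OF Suc.prems(1)] counter_def \<rho>1_def)
    have r1: "represents \<rho>1 (set_n k 0 i ?s)"
      unfolding \<rho>1_def using Suc.prems(1) ok(1) by (rule represents_set_n)
    have c1: "fst \<rho>1 (NB + (32 * j + 1)) = fst \<rho> (NB + (32 * j + 1))" for j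
    proof -
      have "NB + (32 * j + 1) \<noteq> NB + (32 * 0 + (k + 2))" using ok(1) by presburger
      then show ?thesis unfolding \<rho>1_def by (simp only: fst_conv fun_upd_apply if_False)
    qed
    obtain k2 \<rho>2 where 2: "exec u (code (Suc d) P) \<rho>1 k2 \<rho>2" "k2 \<le> cost (par m) (Suc d) P" "represents \<rho>2 (iterate ?f (Suc i) s)"
      "\<forall>j<Suc d. fst \<rho>2 (NB + (32 * j + 1)) = fst \<rho>1 (NB + (32 * j + 1))"
      using For.IH[OF ok(3) r1, of "Suc d"] by auto
    have cd: "fst \<rho>2 ?cd = i" using 2(4) c1 Suc.prems(2) by simp
    define \<rho>3 where "\<rho>3 = ((fst \<rho>2)(?cd := Suc i), snd \<rho>2)"
    have e3: "exec u (NStore (counter d) (NAdd (NMem (counter d)) (NConst 1))) \<rho>2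
        (ncost (counter d) + ncost (NAdd (NMem (counter d)) (NConst 1)) + 1) \<rho>3"
      using exec.NStore[of u "counter d" "NAdd (NMem (counter d)) (NConst 1)" \<rho>2] cd
      by (simp add: represents_naddr[OF 2(3)] counter_def \<rho>3_def)
    have r3: "represents \<rho>3 (iterate ?f (Suc i) s)"
      unfolding \<rho>3_def using 2(3) by (rule represents_counter)
    have c3: "fst \<rho>3 (NB + (32 * j + 1)) = fst \<rho> (NB + (32 * j + 1))" if "j < d" for j
    proof -
      have "NB + (32 * j + 1) \<noteq> ?cd" using that by presburger
      then show ?thesis using 2(4) c1[of j] that unfolding \<rho>3_def by (simp only: fst_conv fun_upd_apply if_False)
    qed
    obtain c \<tau> where 4: "exec u ?W \<rho>3 c \<tau>" "c \<le> g + (par m b - Suc i) * B" "represents \<tau> (iterate ?f (par m b) s)"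
      "\<forall>i<d. fst \<tau> (NB + (32 * i + 1)) = fst \<rho>3 (NB + (32 * i + 1))"
    proof -
      have "x = par m b - Suc i" "Suc i \<le> par m b" using Suc.hyps(2) i by linarith+
      moreover have "fst \<rho>3 ?cd = Suc i" unfolding \<rho>3_def by simp
      ultimately show thesis using Suc.hyps(1)[OF _ r3] that by blast
    qed
    let ?kb = "(ncost (naddr (k + 2) (NConst 0)) + ncost (NMem (counter d)) + 1) + (k2 + (ncost (counter d) + ncost (NAdd (NMem (counter d)) (NConst 1)) + 1))"
    have "exec u ?W \<rho> (g + ?kb + c) \<tau>"
      unfolding g_def by (rule exec.WhileTrue[OF guard exec.Seq[OF e1 exec.Seq[OF 2(1) e3]] 4(1)])
    moreover have "g + ?kb + c \<le> g + (par m b - i) * B"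
    proof -
      have "g + ?kb \<le> B" using 2(2) by (simp add: B_def)
      moreover have "(par m b - i) * B = B + (par m b - Suc i) * B" using i by (metis Suc_diff_Suc mult_Suc)
      ultimately show ?thesis using 4(2) by linarith
    qed
    ultimately show ?case using 4(3,4) c3 by (intro exI[of _ "g + ?kb + c"] exI[of _ "\<tau>"] conjI) auto
  qed
  define \<rho>0 where "\<rho>0 = ((fst \<sigma>)(?cd := 0), snd \<sigma>)"
  have e0: "exec u (NStore (counter d) (NConst 0)) \<sigma> (ncost (counter d) + ncost (NConst 0) + 1) \<rho>0"
    using exec.NStore[of u "counter d" "NConst 0" \<sigma>] For.prems(2)
    by (simp add: represents_naddr counter_def \<rho>0_def)
  have r0: "represents \<rho>0 (iterate ?f 0 s)" unfolding \<rho>0_def using represents_counter[OF For.prems(2)] by simp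
  obtain c \<tau> where 5: "exec u ?W \<rho>0 c \<tau>" "c \<le> g + (par m b - 0) * B" "represents \<tau> (iterate ?f (par m b) s)"
      "\<forall>i<d. fst \<tau> (NB + (32 * i + 1)) = fst \<rho>0 (NB + (32 * i + 1))"
  proof -
    have "fst \<rho>0 ?cd = 0" unfolding \<rho>0_def by simp
    then show thesis using loop[OF r0] that by blast
  qed
  have c0: "fst \<rho>0 (NB + (32 * j + 1)) = fst \<sigma> (NB + (32 * j + 1))" if "j < d" for j
  proof -
    have "NB + (32 * j + 1) \<noteq> ?cd" using that by presburger
    then show ?thesis unfolding \<rho>0_def by (simp only: fst_conv fun_upd_apply if_False)
  qed
  have "exec u (code d (For k b P)) \<sigma> (ncost (counter d) + ncost (NConst 0) + 1 + c) \<tau>"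
    unfolding code.simps by (rule exec.Seq[OF e0 5(1)])
  moreover have "ncost (counter d) + ncost (NConst 0) + 1 + c \<le> cost (par m) d (For k b P)"
    using 5(2) by (simp add: g_def B_def)
  ultimately show ?case using 5(3,4) c0 by (intro exI[of _ "ncost (counter d) + ncost (NConst 0) + 1 + c"] exI[of _ "\<tau>"] conjI) auto
qed

end

section \<open>The program of the policy\<close>

primrec written_n :: "stmt \<Rightarrow> nat set" where
  "written_n (SetN k e a) = {k}"
| "written_n (SetR k e a) = {}"
| "written_n (P ;; Q) = written_n P \<union> written_n Q"
| "written_n (IfElse b P Q) = written_n P \<union> written_n Q"
| "written_n (For k b P) = insert k (written_n P)"

primrec written_r :: "stmt \<Rightarrow> nat set" where
  "written_r (SetN k e a) = {}"
| "written_r (SetR k e a) = {k}"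
| "written_r (P ;; Q) = written_r P \<union> written_r Q"
| "written_r (IfElse b P Q) = written_r P \<union> written_r Q"
| "written_r (For k b P) = written_r P"

lemma set_n_simps [simp]:
  "fst (set_n k i v s) = (fst s)(k := (fst s k)(i := v))" "snd (set_n k i v s) = snd s"
  by (simp_all add: set_n_def)

lemma set_r_simps [simp]:
  "snd (set_r k i v s) = (snd s)(k := (snd s k)(i := v))" "fst (set_r k i v s) = fst s"
  by (simp_all add: set_r_def)

text \<open>A frame rule: tables computed in one phase stay available in later ones without
  analysing what happens in between.\<close>

lemma run_unwritten:
  "k \<notin> written_n P \<Longrightarrow> fst (run u m r P s) k = fst s k"
  "l \<notin> written_r P \<Longrightarrow> snd (run u m r P s) l = snd s l"
proof -
  have "(k \<notin> written_n P \<longrightarrow> fst (run u m r P s) k = fst s k) \<and> (l \<notin> written_r P \<longrightarrow> snd (run u m r P s) l = snd s l)"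
  proof (induction P arbitrary: s)
    case (For i b P)
    have "(k \<notin> insert i (written_n P) \<longrightarrow> fst (iterate (\<lambda>j s. run u m r P (set_n i 0 j s)) B s) k = fst s k) \<and>
      (l \<notin> written_r P \<longrightarrow> snd (iterate (\<lambda>j s. run u m r P (set_n i 0 j s)) B s) l = snd s l)" for B
      by (induction B) (use For in auto)
    then show ?case by simp
  qed auto
  then show "k \<notin> written_n P \<Longrightarrow> fst (run u m r P s) k = fst s k"
    "l \<notin> written_r P \<Longrightarrow> snd (run u m r P s) l = snd s l" by auto
qed

lemma run_For_rule:
  assumes "J 0 s" "\<And>i s. i < par m b \<Longrightarrow> J i s \<Longrightarrow> J (Suc i) (run u m r P (set_n k 0 i s))"
  shows "J (par m b) (run u m r (For k b P) s)"
proof -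
  have "i \<le> par m b \<Longrightarrow> J i (iterate (\<lambda>i s. run u m r P (set_n k 0 i s)) i s)" for i
    by (induction i) (use assms in auto)
  then show ?thesis by simp
qed

declare run.simps(5) [simp del]

abbreviation (input) "vJ \<equiv> 0::nat"
abbreviation (input) "vT \<equiv> 17::nat"
abbreviation (input) "vC \<equiv> 2::nat"
abbreviation (input) "vK \<equiv> 3::nat"
abbreviation (input) "vX \<equiv> 4::nat"
abbreviation (input) "vQ \<equiv> 5::nat"
abbreviation (input) "vPick \<equiv> 6::nat"
abbreviation (input) "vPickA \<equiv> 7::nat"
abbreviation (input) "vA \<equiv> 8::nat"
abbreviation (input) "vTau \<equiv> 9::nat"
abbreviation (input) "vSim \<equiv> 10::nat"
abbreviation (input) "vSel \<equiv> 11::nat"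
abbreviation (input) "vOut \<equiv> 12::nat"
abbreviation (input) "vOffT \<equiv> 13::nat"
abbreviation (input) "vOffH \<equiv> 14::nat"
abbreviation (input) "vBlock \<equiv> 15::nat"
abbreviation (input) "vFlag \<equiv> 16::nat"

abbreviation (input) "rF \<equiv> 0::nat"
abbreviation (input) "rA \<equiv> 13::nat"
abbreviation (input) "rB \<equiv> 2::nat"
abbreviation (input) "rY \<equiv> 3::nat"
abbreviation (input) "rN \<equiv> 4::nat"
abbreviation (input) "rL \<equiv> 5::nat"
abbreviation (input) "rAcc \<equiv> 6::nat"
abbreviation (input) "rBest \<equiv> 7::nat"
abbreviation (input) "rP \<equiv> 8::nat"
abbreviation (input) "rMax \<equiv> 9::nat"
abbreviation (input) "rMass \<equiv> 10::nat"
abbreviation (input) "rCum \<equiv> 11::nat"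
abbreviation (input) "rW \<equiv> 12::nat"

definition sv :: "nat \<Rightarrow> an" where "sv k = NArr k (NCon 0)"
definition rv :: "nat \<Rightarrow> ar" where "rv k = RArr k (NCon 0)"

text \<open>Array 29 is a scratch array that no other statement of the program touches.\<close>

definition nop :: stmt where "nop = SetN 29 (NCon 0) (NCon 0)"

section \<open>The phases of the program\<close>

definition in_tail :: "an \<Rightarrow> ar" where
  "in_tail q = RInp (NPlus (NPlus (NCon 1) (NPlus (NPar par_n) (NPar par_n))) (NPlus (NPar par_H) q))"
definition in_pmf :: "an \<Rightarrow> ar" where
  "in_pmf k = RInp (NPlus (NPlus (NCon 1) (NPlus (NPar par_n) (NPar par_n))) k)"
definition in_val :: ar where "in_val = RInp (NPlus (NCon 1) (sv vJ))"
definition in_wgt :: ar where "in_wgt = RInp (NPlus (NPlus (NCon 1) (NPar par_n)) (sv vJ))"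
definition in_cap :: ar where "in_cap = RInp (NCon 0)"

text \<open>The running index \<open>vK\<close> and the stored offsets \<open>vOffT\<close> stand in
  for the products \<open>j * T\<close>; \<open>vQ\<close>, \<open>vA\<close> and
  \<open>vOffH\<close> play the same role in \<open>matrix_prog\<close>.\<close>

definition tails_prog :: stmt where
  "tails_prog = SetN vK (NCon 0) (NCon 0) ;;
     For vJ par_n (SetN vOffT (sv vJ) (sv vK) ;; SetR rAcc (NCon 0) (RNat (NCon 1)) ;;
       For vT par_T (SetR rF (sv vK) (rv rAcc) ;;
         SetR rAcc (NCon 0) (RMinus (rv rAcc) (in_pmf (sv vK))) ;;
         SetN vK (NCon 0) (NPlus (sv vK) (NCon 1))))"

text \<open>Evaluation tails are tabulated for delays below T only. For longer delays the entry is
  0, which is the true value there.\<close>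

definition entry_prog :: stmt where
  "entry_prog =
     IfElse (BNat (sv vC) (NPar par_n))
       (IfElse (BConj (BNeg (BNat (sv vC) (sv vJ))) (BNeg (BNat (sv vJ) (sv vC))))
          (SetR rA (sv vA) (RNat (NCon 1))) (SetR rA (sv vA) (RNat (NCon 0))))
       (IfElse (BNat (sv vC) (NPlus (NPar par_n) (NPar par_H)))
          (IfElse (BConj (BNeg (BNat (NMinus (sv vC) (NPar par_n)) (sv vT)))
               (BNat (NMinus (NMinus (sv vC) (NPar par_n)) (sv vT)) (NPar par_T)))
             (SetR rA (sv vA) (RTimes (rv rP) (RArr rF (NPlus (NArr vOffT (sv vJ))
                  (NMinus (NMinus (sv vC) (NPar par_n)) (sv vT))))))
             (SetR rA (sv vA) (RNat (NCon 0))))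
          (SetR rA (sv vA) (ROver (RTimes (rv rP) in_wgt) in_cap))) ;;
     SetN vA (NCon 0) (NPlus (sv vA) (NCon 1))"

definition column_prog :: stmt where
  "column_prog = SetR rP (NCon 0) (in_tail (sv vQ)) ;; SetR rB (sv vQ) (RTimes in_val (rv rP)) ;;
     For vC par_m entry_prog ;; SetN vQ (NCon 0) (NPlus (sv vQ) (NCon 1))"

definition matrix_prog :: stmt where
  "matrix_prog = SetN vQ (NCon 0) (NCon 0) ;; SetN vA (NCon 0) (NCon 0) ;;
     For vJ par_n (SetN vOffH (sv vJ) (sv vQ) ;; For vT par_H column_prog)"

definition length_prog :: stmt where
  "length_prog = SetR rAcc (NCon 0) (RNat (NCon 0)) ;;
     For vC par_m (SetR rAcc (NCon 0)
       (RPlus (rv rAcc) (RTimes (RArr rY (sv vC)) (RArr rA (NPlus (sv vA) (sv vC))))))"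

definition pick_prog :: stmt where
  "pick_prog = SetR rBest (NCon 0) (RNat (NCon 0)) ;; SetN vPick (NCon 0) (NCon 0) ;;
     SetN vPickA (NCon 0) (NCon 0) ;; SetN vA (NCon 0) (NCon 0) ;;
     For vQ par_Q (length_prog ;;
       IfElse (BReal (rv rBest) (ROver (RArr rB (sv vQ)) (rv rAcc)))
         (SetR rBest (NCon 0) (ROver (RArr rB (sv vQ)) (rv rAcc)) ;;
          SetN vPick (NCon 0) (sv vQ) ;; SetN vPickA (NCon 0) (sv vA))
         nop ;;
       SetN vA (NCon 0) (NPlus (sv vA) (NPar par_m)))"

definition step_prog :: stmt where
  "step_prog = pick_prog ;;
     For vC par_m (
       SetR rY (sv vC) (RTimes (RArr rY (sv vC))
         (RPlus (RNat (NCon 1)) (ROver (RArr rA (NPlus (sv vPickA) (sv vC))) (RNat (NCon 20))))) ;;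
       SetR rL (sv vC) (RPlus (RArr rL (sv vC)) (RArr rA (NPlus (sv vPickA) (sv vC))))) ;;
     SetR rN (sv vPick) (RPlus (RArr rN (sv vPick)) (RNat (NCon 1)))"

text \<open>The three nested loops perform \<open>1000 * (m * m)\<close> steps without any
  multiplication.\<close>

definition pack_prog :: stmt where
  "pack_prog = For vC par_m (SetR rY (sv vC) (RNat (NCon 1))) ;;
     For vX par_rep (For vK par_m (For vT par_m step_prog)) ;;
     SetR rMax (NCon 0) (RNat (NCon 0)) ;;
     For vC par_m (IfElse (BReal (rv rMax) (RArr rL (sv vC))) (SetR rMax (NCon 0) (RArr rL (sv vC))) nop)"

definition mass_prog :: stmt where
  "mass_prog = SetR rMass (NCon 0) (RNat (NCon 0)) ;;
     For vC par_H (IfElse (BConj (BNeg (BNat (sv vT) (sv vC))) (BNat (NMinus (sv vT) (sv vC)) (NPar par_T)))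
       (SetR rMass (NCon 0) (RPlus (rv rMass) (RTimes (RTimes (RTimes (ROver (RNat (NCon 4)) (RNat (NCon 5)))
          (ROver (RArr rN (NPlus (NArr vOffH (sv vJ)) (sv vC))) (rv rMax)))
          (in_tail (NPlus (NArr vOffH (sv vJ)) (sv vC))))
          (RArr rF (NPlus (NArr vOffT (sv vJ)) (NMinus (sv vT) (sv vC)))))))
       nop)"

definition thin_code :: ar where
  "thin_code = RMinus (RNat (NCon 1)) (RTimes (rv rMass) (RMinus (RNat (NCon 1))
     (RTimes (ROver (rv rMass) (RNat (NCon 2))) (RMinus (RNat (NCon 1)) (ROver (rv rMass) (RNat (NCon 3)))))))"

text \<open>Evaluates \<open>quantile\<close> by a scan: \<open>H + 1\<close> marks that the sum has
  not yet passed the seed coordinate, and it remains as the result if this never happens.\<close>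

definition plan_prog :: stmt where
  "plan_prog = For vJ par_n (SetR rCum (NCon 0) (RNat (NCon 0)) ;;
     SetN vTau (sv vJ) (NPlus (NPar par_H) (NCon 1)) ;;
     For vT par_H (mass_prog ;;
       SetR rCum (NCon 0) (RPlus (rv rCum) (RTimes (RTimes (ROver (RNat (NCon 4)) (RNat (NCon 5)))
          (ROver (RArr rN (NPlus (NArr vOffH (sv vJ)) (sv vT))) (rv rMax))) thin_code)) ;;
       IfElse (BConj (BNat (NPar par_H) (NArr vTau (sv vJ))) (BReal (RRnd (NPlus (sv vJ) (NCon 1))) (rv rCum)))
         (SetN vTau (sv vJ) (NPlus (sv vT) (NCon 1))) nop))"

definition sim_prog :: stmt where
  "sim_prog = For vJ par_n (SetR rCum (NCon 0) (RNat (NCon 0)) ;;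
     SetN vSim (sv vJ) (NPlus (NPar par_T) (NCon 1)) ;;
     For vT par_T (SetR rCum (NCon 0) (RPlus (rv rCum) (in_pmf (NPlus (NArr vOffT (sv vJ)) (sv vT)))) ;;
       IfElse (BConj (BNat (NPar par_T) (NArr vSim (sv vJ)))
           (BReal (RRnd (NPlus (NPar par_n) (NPlus (sv vJ) (NCon 1)))) (rv rCum)))
         (SetN vSim (sv vJ) (NPlus (sv vT) (NCon 1))) nop))"

definition in_exp :: an where
  "in_exp = NInp (NPlus (NPlus (NCon 4) (NPlus (NPar par_len) (NPlus (NPar par_len) (NPar par_len)))) (sv vJ))"

definition choose_prog :: stmt where
  "choose_prog =
     For vX par_len (SetN vSel (NInp (NPlus (NCon 4) (NPlus (sv vX) (NPlus (sv vX) (sv vX))))) (NCon 1)) ;;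
     SetR rW (NCon 0) (RNat (NCon 0)) ;; SetN vBlock (NCon 0) (NCon 0) ;;
     For vJ par_n (IfElse (BConj (BNeg (BNat (NPar par_now) (NArr vTau (sv vJ))))
          (BNeg (BConj (BNat (NCon 0) in_exp) (BNeg (BNat (NArr vTau (sv vJ)) in_exp)))))
        (SetR rW (NCon 0) (RPlus (rv rW) in_wgt) ;;
         IfElse (BConj (BNat (NArr vSel (NPlus (sv vJ) (NCon 1))) (NCon 1))
             (BNat (NPar par_now) (NPlus (NArr vTau (sv vJ)) (NArr vSim (sv vJ)))))
           (SetN vBlock (NCon 0) (NPlus (sv vBlock) (NCon 1))) nop)
        nop) ;;
     SetN vOut (NCon 0) (NCon 0) ;;
     For vJ par_n (IfElse (BConj (BConj (BConj (BNeg (BNat (NPar par_now) (NArr vTau (sv vJ))))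
              (BNeg (BNat (NArr vTau (sv vJ)) (NPar par_now))))
            (BConj (BNeg (BNat (NPar par_H) (NPar par_now))) (BNat (NArr vSel (NPlus (sv vJ) (NCon 1))) (NCon 1))))
          (BConj (BNat in_exp (NCon 1)) (BConj (BNat (sv vBlock) (NCon 2)) (BNeg (BReal in_cap (rv rW))))))
        (SetN vOut (NCon 0) (NPlus (sv vJ) (NCon 1))) nop)"

definition large_prog :: stmt where
  "large_prog = SetN vFlag (NCon 0) (NCon 0) ;;
     For vJ par_n (IfElse (BReal in_cap (RTimes (RNat (NCon 10)) in_wgt)) (SetN vFlag (NCon 0) (NCon 1)) nop) ;;
     IfElse (BNat (NCon 0) (sv vFlag))
       (SetN vOut (NCon 0) (NCon 0) ;; SetR rBest (NCon 0) (RNat (NCon 0)) ;;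
        For vJ par_n (IfElse (BConj (BNeg (BReal in_cap in_wgt)) (BReal (rv rBest) in_val))
          (SetR rBest (NCon 0) in_val ;; SetN vOut (NCon 0) (NPlus (sv vJ) (NCon 1))) nop) ;;
        IfElse (BNat (NPar par_now) (NCon 2)) nop (SetN vOut (NCon 0) (NCon 0)))
       nop"

definition main_prog :: stmt where
  "main_prog = tails_prog ;; matrix_prog ;; pack_prog ;; plan_prog ;; sim_prog ;; choose_prog ;; large_prog"

lemmas prog_defs = tails_prog_def entry_prog_def column_prog_def matrix_prog_def length_prog_def pick_prog_def
  mass_prog_def thin_code_def step_prog_def pack_prog_def plan_prog_def sim_prog_def
  choose_prog_def large_prog_def main_prog_def nop_def in_tail_def in_pmf_def in_val_def in_wgt_def
  in_cap_def in_exp_def sv_def rv_def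

lemma main_prog_ok: "stmt_ok main_prog"
  by (simp add: prog_defs)

text \<open>What correctness of the program needs to know about a history; all reachable histories
  qualify (\<open>policy_run_reachable\<close>). As expiration times are positive, 0 is a safe code
  for not expired.\<close>

locale policy_run =
  fixes I :: sse_instance and h :: history and u :: "nat \<Rightarrow> real"
  assumes valid: "valid_instance I"
    and past_opts: "fst ` set (past h) \<subseteq> opts I" and past_length: "length (past h) \<le> num_opts I"
    and expired_length: "length (expired h) = num_opts I"
    and expired_pos: "\<And>x. Some x \<in> set (expired h) \<Longrightarrow> 0 < x"
begin

definition m :: "nat \<Rightarrow> nat" where "m = fst (initial_store I h)"
definition r :: "nat \<Rightarrow> real" where "r = snd (initial_store I h)"

abbreviation "n \<equiv> num_opts I"
abbreviation "T \<equiv> max_eval I"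
abbreviation "H \<equiv> horizon I"
abbreviation "go \<equiv> run u m r"
abbreviation "vn \<equiv> an_val m"
abbreviation "vr \<equiv> ar_val u m r"
abbreviation "vb \<equiv> ab_val u m r"

lemma m_input:
  "m 0 = n" "m 1 = T" "m 2 = now h" "m 3 = length (past h)"
  by (simp_all add: m_def initial_store_def nat_input_def numeral_eq_Suc)

lemma par_simps [simp]:
  "par m 0 = n" "par m 1 = T" "par m (Suc 0) = T" "par m 2 = now h" "par m 3 = length (past h)" "par m 4 = H"
  "par m 5 = n * H" "par m 6 = lp_rows I" "par m 7 = 1000" "par m 8 = 4 * n + 4"
  "par m 9 = 1 + 2 * n + H + n * H"
  using m_input by (simp_all add: par_def Let_def lp_rows_def)

lemma nth_concat_triples:
  "i < length xs \<Longrightarrow> concat (map (\<lambda>(j, r, f). [j, r, f]) xs) ! (3 * i) = fst (xs ! i)"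
proof (induction xs arbitrary: i)
  case (Cons x xs)
  obtain a b c where x: "x = (a, b, c)" by (cases x)
  show ?case
  proof (cases i)
    case (Suc k)
    then have "3 * i = Suc (Suc (Suc (3 * k)))" by simp
    then show ?thesis using Cons Suc x by simp
  qed (simp add: x)
qed simp

lemma length_concat_triples: "length (concat (map (\<lambda>(j, r, f). [j, r, f]) xs)) = 3 * length xs"
  by (induction xs) auto

lemma m_past: "i < length (past h) \<Longrightarrow> m (4 + 3 * i) = fst (past h ! i)"
  using nth_concat_triples[of i "past h"]
  by (simp add: m_def initial_store_def nat_input_def nth_append length_concat_triples)

lemma m_expired: "j < n \<Longrightarrow> m (4 + 3 * length (past h) + j) = (case expired h ! j of None \<Rightarrow> 0 | Some t \<Rightarrow> t)"
  using expired_length by (simp add: m_def initial_store_def nat_input_def nth_append length_concat_triples)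

lemma length_blocks: "length (concat (map (\<lambda>j. map (f j) [a..<b]) [c..<d])) = (d - c) * (b - a)"
  by (induction d) (auto simp: Suc_diff_le)

lemma nth_blocks:
  "j < N \<Longrightarrow> d < L \<Longrightarrow> concat (map (\<lambda>j. map (f j) [1..<Suc L]) [1..<Suc N]) ! (j * L + d) = f (Suc j) (Suc d)"
proof (induction N)
  case (Suc N)
  define l where "l N = concat (map (\<lambda>j. map (f j) [1..<Suc L]) [1..<Suc N])" for N
  have len: "length (l N) = N * L" unfolding l_def length_blocks by simp
  have split: "l (Suc N) = l N @ map (f (Suc N)) [1..<Suc L]" by (simp add: l_def)
  have "l (Suc N) ! (j * L + d) = f (Suc j) (Suc d)"
  proof (cases "j < N")
    case True
    have "j * L + d < Suc j * L" using Suc.prems by simp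
    also have "\<dots> \<le> N * L" using True by (intro mult_le_mono1) simp
    finally have "j * L + d < length (l N)" by (simp only: len)
    then show ?thesis unfolding split using Suc.IH[OF True Suc.prems(2)] by (simp only: nth_append if_True l_def)
  next
    case False
    then have "j = N" using Suc.prems by simp
    then show ?thesis unfolding split using Suc.prems by (simp add: nth_append len del: upt_Suc)
  qed
  then show ?case by (simp only: l_def)
qed simp

lemma r_input:
  "r 0 = capacity I"
  "j < n \<Longrightarrow> r (1 + j) = val I (Suc j)"
  "j < n \<Longrightarrow> r (1 + n + j) = wgt I (Suc j)"
  "j < n \<Longrightarrow> d < T \<Longrightarrow> r (1 + (n + n) + (j * T + d)) = pmf (eval_dist I (Suc j)) (Suc d)"
  "j < n \<Longrightarrow> t < H \<Longrightarrow> r (1 + (n + n) + (H + (j * H + t))) = tail (exp_dist I (Suc j)) (Suc t)"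
proof -
  define E where "E = concat (map (\<lambda>j. map (pmf (eval_dist I j)) [1..<Suc T]) [1..<Suc n])"
  define X where "X = concat (map (\<lambda>j. map (tail (exp_dist I j)) [1..<Suc H]) [1..<Suc n])"
  have input: "real_input I = [capacity I] @ map (val I) [1..<Suc n] @ map (wgt I) [1..<Suc n] @ E @ X"
    unfolding real_input_def Let_def E_def X_def ..
  have lens: "length E = n * T" "length X = n * H"
    unfolding E_def X_def length_blocks by simp_all
  have len: "length (real_input I) = 1 + n + n + n * T + n * H" unfolding input by (simp add: lens del: upt_Suc)
  have r: "r i = real_input I ! i" if "i < 1 + n + n + n * T + n * H" for i
    using that by (simp add: r_def initial_store_def len)
  show "r 0 = capacity I" by (subst r) (simp_all add: input)
  show "r (1 + j) = val I (Suc j)" if "j < n"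
    using that by (subst r) (simp_all add: input nth_append del: upt_Suc)
  show "r (1 + n + j) = wgt I (Suc j)" if "j < n"
    using that by (subst r) (simp_all add: input nth_append del: upt_Suc)
  show "r (1 + (n + n) + (j * T + d)) = pmf (eval_dist I (Suc j)) (Suc d)" if j: "j < n" and d: "d < T"
  proof -
    have "j * T + d < Suc j * T" using d by simp
    also have "\<dots> \<le> n * T" using j by (intro mult_le_mono1) simp
    finally have lt: "j * T + d < n * T" .
    have "r (1 + (n + n) + (j * T + d)) = E ! (j * T + d)"
      using lt by (subst r) (simp_all add: input nth_append lens del: upt_Suc)
    then show ?thesis unfolding E_def using nth_blocks[OF j d, of "\<lambda>j. pmf (eval_dist I j)"] by (simp only:)
  qed
  show "r (1 + (n + n) + (H + (j * H + t))) = tail (exp_dist I (Suc j)) (Suc t)" if j: "j < n" and t: "t < H"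
  proof -
    have "j * H + t < Suc j * H" using t by simp
    also have "\<dots> \<le> n * H" using j by (intro mult_le_mono1) simp
    finally have lt: "j * H + t < n * H" .
    have "r (1 + (n + n) + (H + (j * H + t))) = X ! (j * H + t)"
      using lt by (subst r) (simp_all add: input nth_append lens del: upt_Suc)
    then show ?thesis unfolding X_def using nth_blocks[OF j t, of "\<lambda>j. tail (exp_dist I j)"] by (simp only:)
  qed
qed

lemma vn_sv [simp]: "vn s (sv k) = fst s k 0" by (simp add: sv_def)
lemma vr_rv [simp]: "vr s (rv k) = snd s k 0" by (simp add: rv_def)
lemma go_nop [simp]: "k \<noteq> 29 \<Longrightarrow> fst (go nop s) k = fst s k" "snd (go nop s) = snd s"
  by (simp_all add: nop_def)

lemma vr_in_cap [simp]: "vr s in_cap = capacity I"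
  by (simp add: in_cap_def r_input)

lemma vr_in_val: "fst s vJ 0 < n \<Longrightarrow> vr s in_val = val I (Suc (fst s vJ 0))"
  using r_input(2)[of "fst s vJ 0"] by (simp add: in_val_def min_def)

lemma vr_in_wgt: "fst s vJ 0 < n \<Longrightarrow> vr s in_wgt = wgt I (Suc (fst s vJ 0))"
  using r_input(3)[of "fst s vJ 0"] by (simp add: in_wgt_def min_def)

lemma block_index: "j < (a::nat) \<Longrightarrow> d < b \<Longrightarrow> j * b + d < a * b"
proof -
  assume "j < a" "d < b"
  then have "j * b + d < Suc j * b" by simp
  also have "\<dots> \<le> a * b" using \<open>j < a\<close> by (intro mult_le_mono1) simp
  finally show ?thesis .
qed

lemma vr_in_pmf: "vn s e = j * T + d \<Longrightarrow> j < n \<Longrightarrow> d < T \<Longrightarrow> vr s (in_pmf e) = pmf (eval_dist I (Suc j)) (Suc d)"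
  using r_input(4)[of j d] block_index[of j n d T] by (simp add: in_pmf_def min_def)

lemma vr_in_tail: "vn s e = j * H + t \<Longrightarrow> j < n \<Longrightarrow> t < H \<Longrightarrow> vr s (in_tail e) = tail (exp_dist I (Suc j)) (Suc t)"
  using r_input(5)[of j t] block_index[of j n t H] by (simp add: in_tail_def min_def)

lemma vn_in_exp: "fst s vJ 0 < n \<Longrightarrow> vn s in_exp = (case expired h ! (fst s vJ 0) of None \<Rightarrow> 0 | Some t \<Rightarrow> t)"
proof -
  assume j: "fst s vJ 0 < n"
  have "min (4 + (length (past h) + (length (past h) + length (past h))) + fst s vJ 0) (4 * n + 4 - 1) =
     4 + 3 * length (past h) + fst s vJ 0"
    using j past_length by linarith
  then show ?thesis using m_expired[OF j] by (simp only: in_exp_def an_val.simps vn_sv par_simps)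
qed

lemma tail_Suc: "tail D (Suc d) = tail D d - pmf D (Suc d)"
proof -
  have "{x. x > d} = {x. x > Suc d} \<union> {Suc d}" by auto
  then have "tail D d = measure_pmf.prob D ({x. x > Suc d} \<union> {Suc d})" by (simp only: tail_def)
  also have "\<dots> = tail D (Suc d) + pmf D (Suc d)"
    unfolding tail_def by (subst measure_pmf.finite_measure_Union) (auto simp: measure_pmf_single)
  finally show ?thesis by simp
qed

lemma tail_0: "j < n \<Longrightarrow> tail (eval_dist I (Suc j)) 0 = 1"
  unfolding tail_def using eval_range[OF valid, of "Suc j"]
  by (subst measure_pmf.prob_eq_1) (auto simp: AE_measure_pmf_iff Suc_le_eq)

lemma tail_large: "j < n \<Longrightarrow> T \<le> d \<Longrightarrow> tail (eval_dist I (Suc j)) d = 0"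
  unfolding tail_def using eval_range[OF valid, of "Suc j"]
  by (subst measure_pmf.prob_eq_0) (fastforce simp: AE_measure_pmf_iff)+

definition tails_done :: "arrays \<Rightarrow> bool" where
  "tails_done s \<longleftrightarrow> (\<forall>j<n. fst s vOffT j = j * T \<and> (\<forall>d<T. snd s rF (j * T + d) = tail (eval_dist I (Suc j)) d))"

lemma tails_prog: "tails_done (go tails_prog s)"
proof -
  let ?J = "\<lambda>i s. fst s vK 0 = i * T \<and> (\<forall>j<i. fst s vOffT j = j * T \<and> (\<forall>d<T. snd s rF (j * T + d) = tail (eval_dist I (Suc j)) d))"
  have "?J (par m par_n) (go tails_prog s)"
    unfolding tails_prog_def run.simps(3)
  proof (rule run_For_rule)
    fix i s assume i: "i < par m par_n" and J: "?J i s"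
    let ?s0 = "run u m r (SetR rAcc (NCon 0) (RNat (NCon 1))) (run u m r (SetN vOffT (sv vJ) (sv vK)) (set_n vJ 0 i s))"
    let ?P = "SetR rF (sv vK) (rv rAcc) ;; SetR rAcc (NCon 0) (RMinus (rv rAcc) (in_pmf (sv vK))) ;;
         SetN vK (NCon 0) (NPlus (sv vK) (NCon 1))"
    let ?K = "\<lambda>d s. fst s vK 0 = i * T + d \<and> snd s rAcc 0 = tail (eval_dist I (Suc i)) d \<and>
      (\<forall>j\<le>i. fst s vOffT j = j * T) \<and>
      (\<forall>j<i. \<forall>d<T. snd s rF (j * T + d) = tail (eval_dist I (Suc j)) d) \<and>
      (\<forall>d'<d. snd s rF (i * T + d') = tail (eval_dist I (Suc i)) d')"
    have "?K (par m par_T) (go (For vT par_T ?P) ?s0)"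
    proof (rule run_For_rule)
      show "?K 0 ?s0" using J i tail_0[of i] by (auto simp: le_less)
    next
      fix d s assume d: "d < par m par_T" and K: "?K d s"
      have *: "j * T + d' \<noteq> i * T + d" if "j < i" "d' < T" for j d'
        using block_index[of j i d' T] that by simp
      show "?K (Suc d) (go ?P (set_n vT 0 d s))"
        using K d i * vr_in_pmf[of _ _ i d] by (auto simp: less_Suc_eq tail_Suc)
    qed
    then show "?J (Suc i) (go (SetN vOffT (sv vJ) (sv vK) ;; SetR rAcc (NCon 0) (RNat (NCon 1)) ;; For vT par_T ?P) (set_n vJ 0 i s))"
      by (auto simp: less_Suc_eq)
  qed simp
  then show ?thesis by (simp add: tails_done_def)
qed

end

lemma div_mod_block: "t < b \<Longrightarrow> (j * b + t) div b = j" "t < b \<Longrightarrow> (j * b + t) mod b = t" for b :: nat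
  by simp_all

context policy_run
begin

abbreviation "M \<equiv> lp_rows I"

definition columns_done :: "arrays \<Rightarrow> nat \<Rightarrow> bool" where
  "columns_done s Q \<longleftrightarrow> (\<forall>q<Q. snd s rB q = lp_obj I q \<and> (\<forall>c<M. snd s rA (q * M + c) = lp_coeff I q c))"

lemma entry_prog:
  assumes td: "tails_done s" and j: "fst s vJ 0 = j" "j < n" and t: "fst s vT 0 = t" "t < H"
    and p: "snd s rP 0 = tail (exp_dist I (Suc j)) (Suc t)"
  shows "go entry_prog s = set_n vA 0 (Suc (fst s vA 0)) (set_r rA (fst s vA 0) (lp_coeff I (j * H + t) (fst s vC 0)) s)"
proof -
  have q: "(j * H + t) div H = j" "(j * H + t) mod H = t" using t(2) by (rule div_mod_block)+
  have "snd s rF (j * T + d) = tail (eval_dist I (Suc j)) d" if "d < T" for d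
    using td j that by (simp add: tails_done_def)
  moreover have "fst s vOffT j = j * T" using td j by (simp add: tails_done_def)
  moreover have "tail (eval_dist I (Suc j)) d = 0" if "\<not> d < T" for d
    using tail_large[OF j(2)] that by simp
  ultimately show ?thesis
    using j t p vr_in_wgt[of s] unfolding entry_prog_def lp_coeff_def Let_def q by simp
qed

lemma column_prog:
  assumes td: "tails_done s" and j: "fst s vJ 0 = j" "j < n" and t: "fst s vT 0 = t" "t < H"
    and q: "fst s vQ 0 = j * H + t" and A: "fst s vA 0 = (j * H + t) * M" and cd: "columns_done s (j * H + t)"
  defines "s' \<equiv> go column_prog s"
  shows "tails_done s'" "fst s' vJ 0 = j" "fst s' vQ 0 = Suc (j * H + t)" "fst s' vA 0 = Suc (j * H + t) * M"
    "columns_done s' (Suc (j * H + t))" "fst s' vOffH = fst s vOffH"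
proof -
  let ?q = "j * H + t"
  let ?s0 = "go (SetR rB (sv vQ) (RTimes in_val (rv rP))) (go (SetR rP (NCon 0) (in_tail (sv vQ))) s)"
  let ?G = "\<lambda>c (s' :: arrays). tails_done s' \<and> fst s' vJ 0 = j \<and> fst s' vT 0 = t \<and> fst s' vQ 0 = ?q \<and> fst s' vA 0 = ?q * M + c \<and>
    snd s' rP 0 = tail (exp_dist I (Suc j)) (Suc t) \<and> columns_done s' ?q \<and> snd s' rB ?q = lp_obj I ?q \<and>
    (\<forall>c'<c. snd s' rA (?q * M + c') = lp_coeff I ?q c') \<and> fst s' vOffH = fst s vOffH"
  have qdiv: "?q div H = j" "?q mod H = t" using t(2) by (rule div_mod_block)+
  have "?G (par m par_m) (go (For vC par_m entry_prog) ?s0)"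
  proof (rule run_For_rule)
    have "vr s (in_tail (sv vQ)) = tail (exp_dist I (Suc j)) (Suc t)"
      using j t q by (intro vr_in_tail) simp_all
    then show "?G 0 ?s0"
      using td j t q A cd vr_in_val[of "set_r rP 0 (tail (exp_dist I (Suc j)) (Suc t)) s"]
      by (simp add: tails_done_def columns_done_def lp_obj_def qdiv)
  next
    fix c s assume c: "c < par m par_m" and G: "?G c s"
    have td: "tails_done (set_n vC 0 c s)" using G by (simp add: tails_done_def)
    have e: "go entry_prog (set_n vC 0 c s) = set_n vA 0 (Suc (?q * M + c)) (set_r rA (?q * M + c) (lp_coeff I ?q c) (set_n vC 0 c s))"
      using entry_prog[OF td, of j t] G j(2) t(2) by simp
    have ne: "q' * M + c' \<noteq> ?q * M + c" if "q' < ?q" "c' < M" for q' c'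
      using block_index[of q' ?q c' M] that by simp
    show "?G (Suc c) (go entry_prog (set_n vC 0 c s))"
      unfolding e using G ne by (auto simp: tails_done_def columns_done_def less_Suc_eq)
  qed
  then show "tails_done s'" "fst s' vJ 0 = j" "fst s' vQ 0 = Suc (j * H + t)" "fst s' vA 0 = Suc (j * H + t) * M"
    "columns_done s' (Suc (j * H + t))" "fst s' vOffH = fst s vOffH"
    unfolding s'_def column_prog_def by (auto simp: tails_done_def columns_done_def less_Suc_eq)
qed

definition offsets_done :: "arrays \<Rightarrow> bool" where
  "offsets_done s \<longleftrightarrow> (\<forall>j<n. fst s vOffH j = j * H)"

lemma matrix_prog:
  assumes "tails_done s"
  shows "columns_done (go matrix_prog s) (n * H)" "offsets_done (go matrix_prog s)" "tails_done (go matrix_prog s)"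
proof -
  let ?J = "\<lambda>i s. fst s vQ 0 = i * H \<and> fst s vA 0 = i * H * M \<and> tails_done s \<and> (\<forall>j<i. fst s vOffH j = j * H) \<and> columns_done s (i * H)"
  have "?J (par m par_n) (go matrix_prog s)"
    unfolding matrix_prog_def run.simps(3)
  proof (rule run_For_rule)
    show "?J 0 (go (SetN vA (NCon 0) (NCon 0)) (go (SetN vQ (NCon 0) (NCon 0)) s))"
      using assms by (simp add: tails_done_def columns_done_def)
  next
    fix i s assume i: "i < par m par_n" and J: "?J i s"
    let ?s0 = "go (SetN vOffH (sv vJ) (sv vQ)) (set_n vJ 0 i s)"
    let ?K = "\<lambda>t s. fst s vJ 0 = i \<and> fst s vQ 0 = i * H + t \<and> fst s vA 0 = (i * H + t) * M \<and> tails_done s \<and>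
       (\<forall>j\<le>i. fst s vOffH j = j * H) \<and> columns_done s (i * H + t)"
    have "?K (par m par_H) (go (For vT par_H column_prog) ?s0)"
    proof (rule run_For_rule)
      show "?K 0 ?s0" using J by (auto simp: tails_done_def columns_done_def le_less)
    next
      fix t s assume t: "t < par m par_H" and K: "?K t s"
      have "tails_done (set_n vT 0 t s)" "columns_done (set_n vT 0 t s) (i * H + t)"
        using K by (auto simp: tails_done_def columns_done_def)
      from column_prog[OF this(1) _ _ _ _ _ _ this(2)] show "?K (Suc t) (go column_prog (set_n vT 0 t s))"
        using K t i by simp
    qed
    then show "?J (Suc i) (go (SetN vOffH (sv vJ) (sv vQ) ;; For vT par_H column_prog) (set_n vJ 0 i s))"
      by (auto simp: add.commute less_Suc_eq_le)
  qed
  then show "columns_done (go matrix_prog s) (n * H)" "offsets_done (go matrix_prog s)" "tails_done (go matrix_prog s)"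
    by (auto simp: offsets_done_def)
qed

lemma length_prog:
  assumes "columns_done s (n * H)" "q < n * H" "fst s vA 0 = q * M"
  shows "snd (go length_prog s) rAcc 0 = col_len M (lp_coeff I) (snd s rY) q"
proof -
  let ?J = "\<lambda>c (s' :: arrays). snd s' rAcc 0 = (\<Sum>c'<c. snd s rY c' * lp_coeff I q c') \<and> snd s' rY = snd s rY \<and>
    snd s' rA = snd s rA \<and> fst s' vA 0 = q * M"
  have "?J (par m par_m) (go length_prog s)"
    unfolding length_prog_def run.simps(3)
  proof (rule run_For_rule)
    fix c s' assume "c < par m par_m" "?J c s'"
    then show "?J (Suc c) (go (SetR rAcc (NCon 0) (RPlus (rv rAcc) (RTimes (RArr rY (sv vC)) (RArr rA (NPlus (sv vA) (sv vC))))))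
        (set_n vC 0 c s'))"
      using assms by (simp add: columns_done_def)
  qed (use assms in simp)
  then show ?thesis by (simp add: col_len_def)
qed

lemma pick_prog:
  assumes cd: "columns_done s (n * H)"
  defines "s' \<equiv> go pick_prog s"
  shows "fst s' vPick 0 = pack_col M (n * H) (lp_coeff I) (lp_obj I) (snd s rY)"
    "fst s' vPickA 0 = fst s' vPick 0 * M"
proof -
  let ?f = "\<lambda>q. lp_obj I q / col_len M (lp_coeff I) (snd s rY) q"
  let ?J = "\<lambda>q (s' :: arrays). snd s' rBest 0 = fst (best ?f q) \<and> fst s' vPick 0 = snd (best ?f q) \<and>
    fst s' vPickA 0 = fst s' vPick 0 * M \<and> fst s' vA 0 = q * M \<and> snd s' rY = snd s rY \<and> columns_done s' (n * H)"
  have "?J (par m par_Q) (go pick_prog s)"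
    unfolding pick_prog_def run.simps(3)
  proof (rule run_For_rule)
    show "?J 0 (go (SetN vA (NCon 0) (NCon 0)) (go (SetN vPickA (NCon 0) (NCon 0)) (go (SetN vPick (NCon 0) (NCon 0))
       (go (SetR rBest (NCon 0) (RNat (NCon 0))) s))))"
      using cd by (simp add: columns_done_def)
  next
    fix q s1 assume q: "q < par m par_Q" and J: "?J q s1"
    let ?s2 = "go length_prog (set_n vQ 0 q s1)"
    have "columns_done (set_n vQ 0 q s1) (n * H)" using J by (simp add: columns_done_def)
    from length_prog[OF this, of q] have acc: "snd ?s2 rAcc 0 = col_len M (lp_coeff I) (snd s rY) q"
      using J q by simp
    have same: "fst ?s2 vPick = fst s1 vPick" "fst ?s2 vPickA = fst s1 vPickA" "fst ?s2 vA = fst s1 vA" "fst ?s2 vQ 0 = q"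
      "snd ?s2 rY = snd s1 rY" "snd ?s2 rA = snd s1 rA" "snd ?s2 rB = snd s1 rB" "snd ?s2 rBest = snd s1 rBest"
      by (simp_all add: run_unwritten length_prog_def del: run.simps)
    show "?J (Suc q) (go (length_prog ;; IfElse (BReal (rv rBest) (ROver (RArr rB (sv vQ)) (rv rAcc)))
         (SetR rBest (NCon 0) (ROver (RArr rB (sv vQ)) (rv rAcc)) ;;
          SetN vPick (NCon 0) (sv vQ) ;; SetN vPickA (NCon 0) (sv vA))
         nop ;;
       SetN vA (NCon 0) (NPlus (sv vA) (NPar par_m))) (set_n vQ 0 q s1))"
      using J q acc same by (simp add: columns_done_def)
  qed
  then show "fst s' vPick 0 = pack_col M (n * H) (lp_coeff I) (lp_obj I) (snd s rY)"
    "fst s' vPickA 0 = fst s' vPick 0 * M"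
    unfolding s'_def by (simp_all add: pack_col_def)
qed

lemma step_prog:
  assumes cd: "columns_done s (n * H)" and nH: "0 < n * H"
  defines "s' \<equiv> go step_prog s"
  shows "(snd s' rY, snd s' rN, snd s' rL) = pack_step M (n * H) (lp_coeff I) (lp_obj I) (snd s rY, snd s rN, snd s rL)"
    "columns_done s' (n * H)"
proof -
  let ?s0 = "go pick_prog s"
  define q where "q = pack_col M (n * H) (lp_coeff I) (lp_obj I) (snd s rY)"
  have q: "fst ?s0 vPick 0 = q" "fst ?s0 vPickA 0 = q * M"
    using pick_prog[OF cd] by (simp_all add: q_def)
  have qn: "q < n * H" unfolding q_def pack_col_def using nH by (rule best_snd_bound)
  have same: "snd ?s0 rY = snd s rY" "snd ?s0 rN = snd s rN" "snd ?s0 rL = snd s rL" "snd ?s0 rA = snd s rA" "snd ?s0 rB = snd s rB"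
    by (simp_all add: run_unwritten pick_prog_def length_prog_def nop_def del: run.simps)
  have A: "snd s rA (q * M + c) = lp_coeff I q c" if "c < M" for c
    using cd qn that by (simp add: columns_done_def)
  let ?J = "\<lambda>c (s' :: arrays). snd s' rY = (\<lambda>c'. if c' < c then snd s rY c' * (1 + lp_coeff I q c' / 20) else snd s rY c') \<and>
     snd s' rL = (\<lambda>c'. if c' < c then snd s rL c' + lp_coeff I q c' else snd s rL c') \<and>
     snd s' rN = snd s rN \<and> snd s' rA = snd s rA \<and> snd s' rB = snd s rB \<and> fst s' vPick 0 = q \<and> fst s' vPickA 0 = q * M"
  let ?P = "SetR rY (sv vC) (RTimes (RArr rY (sv vC))
         (RPlus (RNat (NCon 1)) (ROver (RArr rA (NPlus (sv vPickA) (sv vC))) (RNat (NCon 20))))) ;;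
       SetR rL (sv vC) (RPlus (RArr rL (sv vC)) (RArr rA (NPlus (sv vPickA) (sv vC))))"
  have "?J (par m par_m) (go (For vC par_m ?P) ?s0)"
  proof (rule run_For_rule)
    fix c s' assume "c < par m par_m" "?J c s'"
    then show "?J (Suc c) (go ?P (set_n vC 0 c s'))"
      using A[of c] by (auto simp: fun_eq_iff less_Suc_eq)
  qed (simp add: same q)
  then show "(snd s' rY, snd s' rN, snd s' rL) = pack_step M (n * H) (lp_coeff I) (lp_obj I) (snd s rY, snd s rN, snd s rL)"
    "columns_done s' (n * H)"
    using cd unfolding s'_def step_prog_def pack_step_def Let_def prod.case q_def[symmetric]
    by (simp_all add: columns_done_def)
qed

definition packed :: "arrays \<Rightarrow> bool" where
  "packed s \<longleftrightarrow> snd s rN = fst (snd (lp_result I)) \<and> snd s rMax 0 = lp_scale I"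

lemma nH_pos: "0 < n * H"
  using valid max_eval_pos[OF valid] by (auto simp: valid_instance_def)

lemma pack_prog:
  assumes cd: "columns_done s (n * H)"
    and zero: "snd s rY = (\<lambda>_. 0)" "snd s rN = (\<lambda>_. 0)" "snd s rL = (\<lambda>_. 0)"
  shows "packed (go pack_prog s)"
proof -
  let ?pk = "pack M (n * H) (lp_coeff I) (lp_obj I)"
  let ?st = "\<lambda>k s. (snd s rY, snd s rN, snd s rL) = ?pk k \<and> columns_done s (n * H)"
  let ?Y = "\<lambda>c s. snd s rY = (\<lambda>c'. if c' < c then 1 else 0) \<and> snd s rN = (\<lambda>_. 0) \<and> snd s rL = (\<lambda>_. 0) \<and> columns_done s (n * H)"
  let ?s1 = "go (For vC par_m (SetR rY (sv vC) (RNat (NCon 1)))) s"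
  have "?Y (par m par_m) ?s1"
    by (rule run_For_rule) (use assms in \<open>auto simp: columns_done_def fun_eq_iff less_Suc_eq\<close>)
  then have s1: "?st (0 * (M * M)) ?s1" by simp
  let ?s2 = "go (For vX par_rep (For vK par_m (For vT par_m step_prog))) ?s1"
  have "?st (par m par_rep * (M * M)) ?s2"
  proof (rule run_For_rule[where J = "\<lambda>x s. ?st (x * (M * M)) s"])
    fix x s assume "x < par m par_rep" and x: "?st (x * (M * M)) s"
    have "?st (x * (M * M) + par m par_m * M) (go (For vK par_m (For vT par_m step_prog)) (set_n vX 0 x s))"
    proof (rule run_For_rule[where J = "\<lambda>k s. ?st (x * (M * M) + k * M) s"])
      fix k s assume "k < par m par_m" and k: "?st (x * (M * M) + k * M) s"
      have "?st (x * (M * M) + k * M + par m par_m) (go (For vT par_m step_prog) (set_n vK 0 k s))"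
      proof (rule run_For_rule[where J = "\<lambda>t s. ?st (x * (M * M) + k * M + t) s"])
        fix t s assume "t < par m par_m" and t: "?st (x * (M * M) + k * M + t) s"
        have "columns_done (set_n vT 0 t s) (n * H)" using t by (simp add: columns_done_def)
        from step_prog[OF this nH_pos] show "?st (x * (M * M) + k * M + Suc t) (go step_prog (set_n vT 0 t s))"
          using t by simp
      qed (use k in \<open>simp add: columns_done_def\<close>)
      then show "?st (x * (M * M) + Suc k * M) (go (For vT par_m step_prog) (set_n vK 0 k s))"
        by (simp add: ac_simps)
    qed (use x in \<open>simp add: columns_done_def\<close>)
    then show "?st (Suc x * (M * M)) (go (For vK par_m (For vT par_m step_prog)) (set_n vX 0 x s))"
      by (simp add: add.commute)
  qed (rule s1)
  then have s2: "snd ?s2 rN = fst (snd (lp_result I))" "snd ?s2 rL = snd (snd (lp_result I))"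
    unfolding lp_result_def lp_cols_def by (simp_all add: prod_eq_iff)
  let ?L = "\<lambda>c s. snd s rMax 0 = fst (best (snd (snd (lp_result I))) c) \<and> snd s rN = fst (snd (lp_result I)) \<and> snd s rL = snd (snd (lp_result I))"
  have "?L (par m par_m) (go (For vC par_m (IfElse (BReal (rv rMax) (RArr rL (sv vC))) (SetR rMax (NCon 0) (RArr rL (sv vC))) nop))
     (go (SetR rMax (NCon 0) (RNat (NCon 0))) ?s2))"
    by (rule run_For_rule) (use s2 in auto)
  then show ?thesis unfolding pack_prog_def packed_def lp_scale_def by simp
qed

end

text \<open>One step of the scan that computes a quantile while accumulating the sums.\<close>

lemma quantile_le_Suc:
  assumes "Suc t \<le> N"
  shows "quantile r N u \<le> Suc t \<longleftrightarrow> quantile r N u \<le> t \<or> u < (\<Sum>s=1..Suc t. r s)"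
proof
  assume le: "quantile r N u \<le> Suc t"
  show "quantile r N u \<le> t \<or> u < (\<Sum>s=1..Suc t. r s)"
  proof (cases "quantile r N u = Suc t")
    case True
    then show ?thesis using quantile_prop(2)[of N r u] assms by simp
  qed (use le in simp)
next
  assume *: "quantile r N u \<le> t \<or> u < (\<Sum>s=1..Suc t. r s)"
  show "quantile r N u \<le> Suc t"
  proof (rule ccontr)
    assume "\<not> quantile r N u \<le> Suc t"
    then show False using * quantile_before[of "Suc t" r N u] by simp
  qed
qed

definition single_choice :: "sse_instance \<Rightarrow> nat" where
  "single_choice I = (let b = best (\<lambda>i. if wgt I (Suc i) \<le> capacity I then val I (Suc i) else 0) (num_opts I)
     in if fst b > 0 then Suc (snd b) else 0)"

text \<open>The functional specification of the program, in its output code with 0 for none.\<close>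

definition decide :: "sse_instance \<Rightarrow> (nat \<Rightarrow> real) \<Rightarrow> history \<Rightarrow> nat" where
  "decide I u h = (if \<exists>j\<in>opts I. capacity I < 10 * wgt I j then if now h < 2 then single_choice I else 0
     else case lp_noise I (lp_y I) u of (\<tau>, g) \<Rightarrow> last_such (eligible I \<tau> g h) (num_opts I))"

context policy_run
begin

lemma mass_prog:
  assumes "tails_done s" "offsets_done s" "packed s" and j: "fst s vJ 0 = j" "j < n" and t: "fst s vT 0 = t" "t < H"
  shows "snd (go mass_prog s) rMass 0 = capped I (lp_y I) (Suc j) (Suc t)"
proof -
  let ?g = "\<lambda>c. if c \<le> t then 4 / 5 * lp_y I (Suc j) (Suc c) * tail (exp_dist I (Suc j)) (Suc c) * tail (eval_dist I (Suc j)) (t - c) else 0"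
  let ?P = "IfElse (BConj (BNeg (BNat (sv vT) (sv vC))) (BNat (NMinus (sv vT) (sv vC)) (NPar par_T)))
       (SetR rMass (NCon 0) (RPlus (rv rMass) (RTimes (RTimes (RTimes (ROver (RNat (NCon 4)) (RNat (NCon 5)))
          (ROver (RArr rN (NPlus (NArr vOffH (sv vJ)) (sv vC))) (rv rMax)))
          (in_tail (NPlus (NArr vOffH (sv vJ)) (sv vC))))
          (RArr rF (NPlus (NArr vOffT (sv vJ)) (NMinus (sv vT) (sv vC)))))))
       nop"
  let ?J = "\<lambda>c (s' :: arrays). snd s' rMass 0 = (\<Sum>c'<c. ?g c') \<and> tails_done s' \<and> offsets_done s' \<and> packed s' \<and>
     fst s' vJ 0 = j \<and> fst s' vT 0 = t"
  have "?J (par m par_H) (go mass_prog s)"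
    unfolding mass_prog_def run.simps(3)
  proof (rule run_For_rule)
    show "?J 0 (go (SetR rMass (NCon 0) (RNat (NCon 0))) s)"
      using assms by (simp add: tails_done_def offsets_done_def packed_def)
  next
    fix c s' assume c: "c < par m par_H" and J: "?J c s'"
    let ?s = "set_n vC 0 c s'"
    have F: "snd s' rF (j * T + d) = tail (eval_dist I (Suc j)) d" if "d < T" for d
      using J j that by (simp add: tails_done_def)
    have off: "fst s' vOffT j = j * T" "fst s' vOffH j = j * H"
      using J j by (simp_all add: tails_done_def offsets_done_def)
    have tl: "vr ?s (in_tail (NPlus (NArr vOffH (sv vJ)) (sv vC))) = tail (exp_dist I (Suc j)) (Suc c)"
      using c j J off by (intro vr_in_tail) simp_all
    have y: "snd s' rN (j * H + c) / snd s' rMax 0 = lp_y I (Suc j) (Suc c)"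
      using J by (simp add: lp_y_def packed_def)
    have inv: "tails_done (go ?P ?s) \<and> offsets_done (go ?P ?s) \<and> packed (go ?P ?s) \<and> fst (go ?P ?s) vJ 0 = j \<and> fst (go ?P ?s) vT 0 = t"
      using J by (simp add: tails_done_def offsets_done_def packed_def)
    have "snd (go ?P ?s) rMass 0 = (\<Sum>c'<c. ?g c') + ?g c"
    proof (cases "c \<le> t \<and> t - c < T")
      case True
      then show ?thesis using J off F[of "t - c"] tl y by (simp add: mult.assoc)
    next
      case False
      \<comment> \<open>The entries that the loop skips vanish: they are later than
        \<open>t\<close>, or the delay is at least T.\<close>
      then have "?g c = 0" using tail_large[OF j(2), of "t - c"] by auto
      then show ?thesis using False J by (auto simp: not_le)
    qed
    then show "?J (Suc c) (go ?P ?s)" using inv by simp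
  qed
  then have "snd (go mass_prog s) rMass 0 = (\<Sum>c<H. ?g c)" by simp
  also have "\<dots> = (\<Sum>c<Suc t. 4 / 5 * lp_y I (Suc j) (Suc c) * tail (exp_dist I (Suc j)) (Suc c) * tail (eval_dist I (Suc j)) (Suc t - Suc c))"
    using t by (intro sum.mono_neutral_cong_right) auto
  also have "\<dots> = capped I (lp_y I) (Suc j) (Suc t)"
    unfolding capped_def One_nat_def by (rule sum.atLeast1_atMost_eq[symmetric])
  finally show ?thesis .
qed

definition planned :: "arrays \<Rightarrow> nat \<Rightarrow> bool" where
  "planned s k \<longleftrightarrow> (\<forall>j<k. fst s vTau j = quantile (rate I (lp_y I) (Suc j)) H (u (Suc j)))"

lemma vr_thin_code: "vr s thin_code = thin (snd s rMass 0)"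
  by (simp add: thin_code_def thin_def)

lemma plan_prog:
  assumes "tails_done s" "offsets_done s" "packed s"
  shows "planned (go plan_prog s) n"
proof -
  let ?B = "mass_prog ;;
       SetR rCum (NCon 0) (RPlus (rv rCum) (RTimes (RTimes (ROver (RNat (NCon 4)) (RNat (NCon 5)))
          (ROver (RArr rN (NPlus (NArr vOffH (sv vJ)) (sv vT))) (rv rMax))) thin_code)) ;;
       IfElse (BConj (BNat (NPar par_H) (NArr vTau (sv vJ))) (BReal (RRnd (NPlus (sv vJ) (NCon 1))) (rv rCum)))
         (SetN vTau (sv vJ) (NPlus (sv vT) (NCon 1))) nop"
  let ?J = "\<lambda>j s. tails_done s \<and> offsets_done s \<and> packed s \<and> planned s j"
  have "?J (par m par_n) (go plan_prog s)"
    unfolding plan_prog_def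
  proof (rule run_For_rule)
    show "?J 0 s" using assms by (simp add: planned_def)
  next
    fix j s assume j: "j < par m par_n" and J: "?J j s"
    let ?s0 = "go (SetN vTau (sv vJ) (NPlus (NPar par_H) (NCon 1))) (go (SetR rCum (NCon 0) (RNat (NCon 0))) (set_n vJ 0 j s))"
    let ?r = "rate I (lp_y I) (Suc j)"
    let ?q = "quantile ?r H (u (Suc j))"
    let ?K = "\<lambda>t s. tails_done s \<and> offsets_done s \<and> packed s \<and> planned s j \<and> fst s vJ 0 = j \<and>
       snd s rCum 0 = (\<Sum>s=1..t. ?r s) \<and> fst s vTau j = (if ?q \<le> t then ?q else Suc H)"
    have "?K (par m par_H) (go (For vT par_H ?B) ?s0)"
    proof (rule run_For_rule)
      show "?K 0 ?s0"
        using J quantile_prop(1)[of ?r H "u (Suc j)"]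
        by (auto simp: tails_done_def offsets_done_def packed_def planned_def)
    next
      fix t s assume t: "t < par m par_H" and K: "?K t s"
      let ?s1 = "set_n vT 0 t s"
      let ?s2 = "go mass_prog ?s1"
      have "tails_done ?s1" "offsets_done ?s1" "packed ?s1"
        using K by (auto simp: tails_done_def offsets_done_def packed_def)
      from mass_prog[OF this, of j t] have mass: "snd ?s2 rMass 0 = capped I (lp_y I) (Suc j) (Suc t)"
        using K j t by simp
      have same: "fst ?s2 vTau = fst s vTau" "fst ?s2 vJ 0 = j" "fst ?s2 vT 0 = t" "fst ?s2 vOffH = fst s vOffH"
        "fst ?s2 vOffT = fst s vOffT" "snd ?s2 rN = snd s rN" "snd ?s2 rMax = snd s rMax" "snd ?s2 rCum = snd s rCum"
        "snd ?s2 rF = snd s rF"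
        using K by (simp_all add: run_unwritten mass_prog_def nop_def del: run.simps)
      have y: "snd s rN (fst s vOffH j + t) / snd s rMax 0 = lp_y I (Suc j) (Suc t)"
        using K j by (simp add: lp_y_def packed_def offsets_done_def)
      let ?s3 = "go (SetR rCum (NCon 0) (RPlus (rv rCum) (RTimes (RTimes (ROver (RNat (NCon 4)) (RNat (NCon 5)))
          (ROver (RArr rN (NPlus (NArr vOffH (sv vJ)) (sv vT))) (rv rMax))) thin_code))) ?s2"
      have cum: "snd ?s3 rCum 0 = (\<Sum>s=1..Suc t. ?r s)"
        using K y mass by (simp add: same vr_thin_code rate_def mult.assoc)
      have step: "?q \<le> Suc t \<longleftrightarrow> ?q \<le> t \<or> u (Suc j) < (\<Sum>s=1..Suc t. ?r s)"
        using t by (intro quantile_le_Suc) simp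
      have tau: "fst (go ?B ?s1) vTau j = (if ?q \<le> Suc t then ?q else Suc H)"
        using K t cum step by (auto simp: same)
      show "?K (Suc t) (go ?B ?s1)"
        using K cum tau by (simp add: same tails_done_def offsets_done_def packed_def planned_def)
    qed
    then have "?K H (go (For vT par_H ?B) ?s0)" by simp
    moreover have "?q \<le> Suc H" by (rule quantile_prop(3))
    ultimately show "?J (Suc j) (go (SetR rCum (NCon 0) (RNat (NCon 0)) ;; SetN vTau (sv vJ) (NPlus (NPar par_H) (NCon 1)) ;;
        For vT par_H ?B) (set_n vJ 0 j s))"
      by (auto simp: planned_def less_Suc_eq)
  qed
  then show ?thesis by simp
qed

definition simulated :: "arrays \<Rightarrow> nat \<Rightarrow> bool" where
  "simulated s k \<longleftrightarrow> (\<forall>j<k. fst s vSim j = quantile (pmf (eval_dist I (Suc j))) T (u (n + Suc j)))"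

lemma sim_prog:
  assumes "tails_done s"
  shows "simulated (go sim_prog s) n"
proof -
  let ?B = "SetR rCum (NCon 0) (RPlus (rv rCum) (in_pmf (NPlus (NArr vOffT (sv vJ)) (sv vT)))) ;;
       IfElse (BConj (BNat (NPar par_T) (NArr vSim (sv vJ)))
           (BReal (RRnd (NPlus (NPar par_n) (NPlus (sv vJ) (NCon 1)))) (rv rCum)))
         (SetN vSim (sv vJ) (NPlus (sv vT) (NCon 1))) nop"
  let ?J = "\<lambda>j s. tails_done s \<and> simulated s j"
  have "?J (par m par_n) (go sim_prog s)"
    unfolding sim_prog_def
  proof (rule run_For_rule)
    show "?J 0 s" using assms by (simp add: simulated_def)
  next
    fix j s assume j: "j < par m par_n" and J: "?J j s"
    let ?s0 = "go (SetN vSim (sv vJ) (NPlus (NPar par_T) (NCon 1))) (go (SetR rCum (NCon 0) (RNat (NCon 0))) (set_n vJ 0 j s))"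
    let ?r = "pmf (eval_dist I (Suc j))"
    let ?q = "quantile ?r T (u (n + Suc j))"
    let ?K = "\<lambda>t s. tails_done s \<and> simulated s j \<and> fst s vJ 0 = j \<and>
       snd s rCum 0 = (\<Sum>s=1..t. ?r s) \<and> fst s vSim j = (if ?q \<le> t then ?q else Suc T)"
    have "?K (par m par_T) (go (For vT par_T ?B) ?s0)"
    proof (rule run_For_rule)
      show "?K 0 ?s0"
        using J quantile_prop(1)[of ?r T "u (n + Suc j)"] by (auto simp: tails_done_def simulated_def)
    next
      fix t s assume t: "t < par m par_T" and K: "?K t s"
      let ?s1 = "set_n vT 0 t s"
      have "fst s vOffT j = j * T" using K j by (simp add: tails_done_def)
      then have p: "vr ?s1 (in_pmf (NPlus (NArr vOffT (sv vJ)) (sv vT))) = ?r (Suc t)"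
        using K j t by (intro vr_in_pmf) simp_all
      have step: "?q \<le> Suc t \<longleftrightarrow> ?q \<le> t \<or> u (n + Suc j) < (\<Sum>s=1..Suc t. ?r s)"
        using t by (intro quantile_le_Suc) simp
      show "?K (Suc t) (go ?B ?s1)"
        using K p t step by (auto simp: tails_done_def simulated_def)
    qed
    then have "?K T (go (For vT par_T ?B) ?s0)" by simp
    moreover have "?q \<le> Suc T" by (rule quantile_prop(3))
    ultimately show "?J (Suc j) (go (SetR rCum (NCon 0) (RNat (NCon 0)) ;; SetN vSim (sv vJ) (NPlus (NPar par_T) (NCon 1)) ;;
        For vT par_T ?B) (set_n vJ 0 j s))"
      by (auto simp: simulated_def less_Suc_eq)
  qed
  then show ?thesis by simp
qed

lemma choose_prog:
  assumes pl: "planned s n" and sim: "simulated s n" and sel: "fst s vSel = (\<lambda>_. 0)"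
  shows "fst (go choose_prog s) vOut 0 =
    (case lp_noise I (lp_y I) u of (\<tau>, g) \<Rightarrow> last_such (eligible I \<tau> g h) n)"
proof -
  obtain \<tau> g where noise: "lp_noise I (lp_y I) u = (\<tau>, g)" by (cases "lp_noise I (lp_y I) u")
  have \<tau>: "\<tau> (Suc j) = quantile (rate I (lp_y I) (Suc j)) H (u (Suc j))"
    and g: "g (Suc j) = quantile (pmf (eval_dist I (Suc j))) T (u (n + Suc j))" if "j < n" for j
    using noise that by (auto simp: lp_noise_def)
  let ?ps = "\<lambda>s. planned s n \<and> simulated s n"
  let ?mark = "\<lambda>i s. ?ps s \<and> fst s vSel = (\<lambda>j. if j \<in> fst ` set (take i (past h)) then 1 else 0)"
  let ?P1 = "SetN vSel (NInp (NPlus (NCon 4) (NPlus (sv vX) (NPlus (sv vX) (sv vX))))) (NCon 1)"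
  let ?s1 = "go (For vX par_len ?P1) s"
  have "?mark (par m par_len) ?s1"
  proof (rule run_For_rule)
    show "?mark 0 s" using assms by simp
  next
    fix i s assume i: "i < par m par_len" and J: "?mark i s"
    \<comment> \<open>The cut-off of input addresses does not take effect, as at most n selections
      are recorded.\<close>
    have "min (4 + (i + (i + i))) (4 * n + 4 - 1) = 4 + 3 * i"
      using i past_length by simp
    then have "vn (set_n vX 0 i s) (NInp (NPlus (NCon 4) (NPlus (sv vX) (NPlus (sv vX) (sv vX))))) = fst (past h ! i)"
      using m_past[of i] i by (simp only: an_val.simps vn_sv set_n_simps fun_upd_same par_simps)
    then have e: "go ?P1 (set_n vX 0 i s) = set_n vSel (fst (past h ! i)) 1 (set_n vX 0 i s)" by simp
    show "?mark (Suc i) (go ?P1 (set_n vX 0 i s))"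
      unfolding e using J i by (auto simp: planned_def simulated_def take_Suc_conv_app_nth fun_eq_iff)
  qed
  then have s1: "?ps ?s1" "fst ?s1 vSel = (\<lambda>j. if j \<in> fst ` set (past h) then 1 else 0)" by simp_all
  let ?x = "\<lambda>j. case expired h ! j of None \<Rightarrow> 0 | Some t \<Rightarrow> t"
  have xpos: "expired h ! j = None \<longleftrightarrow> ?x j = 0" if "j < n" for j
  proof (cases "expired h ! j")
    case (Some t)
    have "expired h ! j \<in> set (expired h)" using that expired_length by (intro nth_mem) simp
    then have "Some t \<in> set (expired h)" using Some by simp
    then show ?thesis using expired_pos[of t] Some by simp
  qed simp
  have cand: "candidate \<tau> h (Suc j) \<longleftrightarrow> \<not> now h < \<tau> (Suc j) \<and> \<not> (0 < ?x j \<and> \<not> \<tau> (Suc j) < ?x j)" if "j < n" for j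
  proof (cases "expired h ! j")
    case None then show ?thesis by (simp add: candidate_def not_less)
  next
    case (Some t)
    then have "0 < t" using xpos[OF that] by simp
    then show ?thesis using Some by (auto simp: candidate_def)
  qed
  let ?sel = "\<lambda>s. fst s vSel = (\<lambda>j. if j \<in> fst ` set (past h) then 1 else 0)"
  let ?P2 = "IfElse (BConj (BNeg (BNat (NPar par_now) (NArr vTau (sv vJ))))
          (BNeg (BConj (BNat (NCon 0) in_exp) (BNeg (BNat (NArr vTau (sv vJ)) in_exp)))))
        (SetR rW (NCon 0) (RPlus (rv rW) in_wgt) ;;
         IfElse (BConj (BNat (NArr vSel (NPlus (sv vJ) (NCon 1))) (NCon 1))
             (BNat (NPar par_now) (NPlus (NArr vTau (sv vJ)) (NArr vSim (sv vJ)))))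
           (SetN vBlock (NCon 0) (NPlus (sv vBlock) (NCon 1))) nop)
        nop"
  let ?W = "\<lambda>k s. ?ps s \<and> ?sel s \<and> snd s rW 0 = (\<Sum>i<k. if candidate \<tau> h (Suc i) then wgt I (Suc i) else 0) \<and>
     fst s vBlock 0 = card {i \<in> {1..k}. blocker \<tau> g h i}"
  let ?s2 = "go (For vJ par_n ?P2) (go (SetN vBlock (NCon 0) (NCon 0)) (go (SetR rW (NCon 0) (RNat (NCon 0))) ?s1))"
  have "?W (par m par_n) ?s2"
  proof (rule run_For_rule)
    show "?W 0 (go (SetN vBlock (NCon 0) (NCon 0)) (go (SetR rW (NCon 0) (RNat (NCon 0))) ?s1))"
      using s1 by (simp add: planned_def simulated_def)
  next
    fix j s assume j: "j < par m par_n" and J: "?W j s"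
    let ?s = "set_n vJ 0 j s"
    have vals: "fst s vTau j = \<tau> (Suc j)" "fst s vSim j = g (Suc j)"
      using J j \<tau>[of j] g[of j] by (simp_all add: planned_def simulated_def)
    have x: "vn ?s in_exp = ?x j" using j by (subst vn_in_exp) simp_all
    have w: "vr ?s in_wgt = wgt I (Suc j)" using j by (subst vr_in_wgt) simp_all
    have block: "blocker \<tau> g h (Suc j) \<longleftrightarrow> candidate \<tau> h (Suc j) \<and> Suc j \<notin> fst ` set (past h) \<and> now h < \<tau> (Suc j) + g (Suc j)"
      by (simp add: blocker_def)
    have split: "{i \<in> {1..Suc j}. blocker \<tau> g h i} =
      (if blocker \<tau> g h (Suc j) then insert (Suc j) {i \<in> {1..j}. blocker \<tau> g h i} else {i \<in> {1..j}. blocker \<tau> g h i})"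
      by (auto simp: le_Suc_eq)
    have crd: "card {i \<in> {1..Suc j}. blocker \<tau> g h i} = card {i \<in> {1..j}. blocker \<tau> g h i} + (if blocker \<tau> g h (Suc j) then 1 else 0)"
      unfolding split by (auto simp: card_insert_if)
    have ps: "?ps (go ?P2 ?s) \<and> ?sel (go ?P2 ?s)"
      using J by (simp add: planned_def simulated_def)
    have "snd (go ?P2 ?s) rW 0 = (\<Sum>i<Suc j. if candidate \<tau> h (Suc i) then wgt I (Suc i) else 0)"
      using J j cand[of j] by (simp add: vals x w)
    moreover have "fst (go ?P2 ?s) vBlock 0 = card {i \<in> {1..Suc j}. blocker \<tau> g h i}"
      unfolding crd block using J j cand[of j] by (simp add: vals x w)
    ultimately show "?W (Suc j) (go ?P2 ?s)" using ps by blast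
  qed
  then have s2: "?ps ?s2" "?sel ?s2" "snd ?s2 rW 0 = (\<Sum>i<n. if candidate \<tau> h (Suc i) then wgt I (Suc i) else 0)"
    "fst ?s2 vBlock 0 = card {i \<in> opts I. blocker \<tau> g h i}" by simp_all
  have weight: "snd ?s2 rW 0 = (\<Sum>i\<in>opts I. if candidate \<tau> h i then wgt I i else 0)"
  proof -
    have "(\<Sum>i\<in>opts I. if candidate \<tau> h i then wgt I i else 0) = (\<Sum>i<n. if candidate \<tau> h (Suc i) then wgt I (Suc i) else 0)"
      unfolding One_nat_def by (rule sum.atLeast1_atMost_eq)
    then show ?thesis using s2(3) by (simp only:)
  qed
  let ?P3 = "IfElse (BConj (BConj (BConj (BNeg (BNat (NPar par_now) (NArr vTau (sv vJ))))
              (BNeg (BNat (NArr vTau (sv vJ)) (NPar par_now))))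
            (BConj (BNeg (BNat (NPar par_H) (NPar par_now))) (BNat (NArr vSel (NPlus (sv vJ) (NCon 1))) (NCon 1))))
          (BConj (BNat in_exp (NCon 1)) (BConj (BNat (sv vBlock) (NCon 2)) (BNeg (BReal in_cap (rv rW))))))
        (SetN vOut (NCon 0) (NPlus (sv vJ) (NCon 1))) nop"
  let ?O = "\<lambda>k s. ?ps s \<and> ?sel s \<and> snd s rW 0 = (\<Sum>i\<in>opts I. if candidate \<tau> h i then wgt I i else 0) \<and>
     fst s vBlock 0 = card {i \<in> opts I. blocker \<tau> g h i} \<and> fst s vOut 0 = last_such (eligible I \<tau> g h) k"
  have "?O (par m par_n) (go (For vJ par_n ?P3) (go (SetN vOut (NCon 0) (NCon 0)) ?s2))"
  proof (rule run_For_rule)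
    show "?O 0 (go (SetN vOut (NCon 0) (NCon 0)) ?s2)"
      using s2 weight by (simp add: planned_def simulated_def)
  next
    fix j s assume j: "j < par m par_n" and J: "?O j s"
    let ?s = "set_n vJ 0 j s"
    have vals: "fst s vTau j = \<tau> (Suc j)" using J j \<tau>[of j] by (simp add: planned_def)
    have x: "vn ?s in_exp = ?x j" using j by (subst vn_in_exp) simp_all
    have el: "eligible I \<tau> g h (Suc j) \<longleftrightarrow> \<tau> (Suc j) = now h \<and> now h \<le> H \<and> Suc j \<notin> fst ` set (past h) \<and> ?x j = 0 \<and>
       card {i \<in> opts I. blocker \<tau> g h i} < 2 \<and> (\<Sum>i\<in>opts I. if candidate \<tau> h i then wgt I i else 0) \<le> capacity I"
      unfolding eligible_def using xpos[of j] j by simp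
    have ps: "?ps (go ?P3 ?s) \<and> ?sel (go ?P3 ?s)"
      using J by (simp add: planned_def simulated_def)
    have e: "eligible I \<tau> g h (Suc j) \<longleftrightarrow> vb ?s (BConj (BConj (BConj (BNeg (BNat (NPar par_now) (NArr vTau (sv vJ))))
              (BNeg (BNat (NArr vTau (sv vJ)) (NPar par_now))))
            (BConj (BNeg (BNat (NPar par_H) (NPar par_now))) (BNat (NArr vSel (NPlus (sv vJ) (NCon 1))) (NCon 1))))
          (BConj (BNat in_exp (NCon 1)) (BConj (BNat (sv vBlock) (NCon 2)) (BNeg (BReal in_cap (rv rW))))))"
      unfolding el using J by (auto simp: vals x not_less)
    have "fst (go ?P3 ?s) vOut 0 = last_such (eligible I \<tau> g h) (Suc j)"
      unfolding run.simps e[symmetric] last_such.simps using J by simp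
    moreover have "snd (go ?P3 ?s) rW 0 = snd s rW 0" "fst (go ?P3 ?s) vBlock 0 = fst s vBlock 0" by simp_all
    ultimately show "?O (Suc j) (go ?P3 ?s)" using ps J by simp
  qed
  then show ?thesis by (simp add: choose_prog_def noise)
qed

lemma large_prog:
  "fst (go large_prog s) vOut 0 = (if \<exists>j\<in>opts I. capacity I < 10 * wgt I j
     then if now h < 2 then single_choice I else 0 else fst s vOut 0)"
proof -
  let ?P1 = "IfElse (BReal in_cap (RTimes (RNat (NCon 10)) in_wgt)) (SetN vFlag (NCon 0) (NCon 1)) nop"
  let ?J = "\<lambda>k (s' :: arrays). fst s' vFlag 0 = (if \<exists>j<k. capacity I < 10 * wgt I (Suc j) then 1 else 0) \<and> fst s' vOut = fst s vOut"
  let ?s1 = "go (For vJ par_n ?P1) (go (SetN vFlag (NCon 0) (NCon 0)) s)"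
  have s1: "?J (par m par_n) ?s1"
  proof (rule run_For_rule)
    fix j s' assume j: "j < par m par_n" and J: "?J j s'"
    have w: "vr (set_n vJ 0 j s') in_wgt = wgt I (Suc j)" using j by (subst vr_in_wgt) simp_all
    show "?J (Suc j) (go ?P1 (set_n vJ 0 j s'))" using J by (auto simp: w less_Suc_eq)
  qed simp
  have ex: "(\<exists>j<n. capacity I < 10 * wgt I (Suc j)) \<longleftrightarrow> (\<exists>j\<in>opts I. capacity I < 10 * wgt I j)"
  proof
    assume "\<exists>j\<in>opts I. capacity I < 10 * wgt I j"
    then obtain j where "j \<in> opts I" "capacity I < 10 * wgt I j" by blast
    then show "\<exists>j<n. capacity I < 10 * wgt I (Suc j)" 
      by (intro exI[of _ "j - 1"]) auto
  qed (auto simp: Suc_le_eq)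
  let ?f = "\<lambda>i. if wgt I (Suc i) \<le> capacity I then val I (Suc i) else 0"
  let ?P2 = "IfElse (BConj (BNeg (BReal in_cap in_wgt)) (BReal (rv rBest) in_val))
          (SetR rBest (NCon 0) in_val ;; SetN vOut (NCon 0) (NPlus (sv vJ) (NCon 1))) nop"
  let ?s2 = "go (For vJ par_n ?P2) (go (SetR rBest (NCon 0) (RNat (NCon 0))) (go (SetN vOut (NCon 0) (NCon 0)) ?s1))"
  let ?K = "\<lambda>k (s' :: arrays). snd s' rBest 0 = fst (best ?f k) \<and> fst s' vOut 0 = (if fst (best ?f k) > 0 then Suc (snd (best ?f k)) else 0)"
  have "?K (par m par_n) ?s2"
  proof (rule run_For_rule)
    fix j s' assume j: "j < par m par_n" and J: "?K j s'"
    have w: "vr (set_n vJ 0 j s') in_wgt = wgt I (Suc j)" using j by (subst vr_in_wgt) simp_all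
    have v: "vr (set_n vJ 0 j s') in_val = val I (Suc j)" using j by (subst vr_in_val) simp_all
    have "0 \<le> fst (best ?f j)" by (rule best_nonneg)
    then show "?K (Suc j) (go ?P2 (set_n vJ 0 j s'))" using J by (auto simp: w v not_less)
  qed simp
  then have "fst ?s2 vOut 0 = single_choice I" by (simp add: single_choice_def)
  then show ?thesis using s1 unfolding large_prog_def by (simp add: ex)
qed

theorem main_prog: "fst (go main_prog (\<lambda>_ _. 0, \<lambda>_ _. 0)) vOut 0 = decide I u h"
proof -
  let ?s0 = "(\<lambda>_ _. 0, \<lambda>_ _. 0) :: arrays"
  define s1 where "s1 = go tails_prog ?s0"
  define s2 where "s2 = go matrix_prog s1"
  define s3 where "s3 = go pack_prog s2"
  define s4 where "s4 = go plan_prog s3"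
  define s5 where "s5 = go sim_prog s4"
  define s6 where "s6 = go choose_prog s5"
  have 1: "tails_done s1" unfolding s1_def by (rule tails_prog)
  note n2 = matrix_prog[OF 1, folded s2_def]
  have "snd s2 rY = (\<lambda>_. 0)" "snd s2 rN = (\<lambda>_. 0)" "snd s2 rL = (\<lambda>_. 0)"
    unfolding s2_def s1_def
    by (simp_all add: run_unwritten tails_prog_def matrix_prog_def column_prog_def entry_prog_def del: run.simps)
  note n3 = pack_prog[OF n2(1) this, folded s3_def]
  have same3: "fst s3 vOffT = fst s2 vOffT" "fst s3 vOffH = fst s2 vOffH" "snd s3 rF = snd s2 rF"
    unfolding s3_def
    by (simp_all add: run_unwritten pack_prog_def step_prog_def pick_prog_def length_prog_def nop_def del: run.simps)
  have done3: "tails_done s3" "offsets_done s3"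
    using n2 same3 by (simp_all add: tails_done_def offsets_done_def)
  note n4 = plan_prog[OF done3 n3, folded s4_def]
  have "fst s4 vOffT = fst s3 vOffT" "snd s4 rF = snd s3 rF"
    unfolding s4_def by (simp_all add: run_unwritten plan_prog_def mass_prog_def nop_def del: run.simps)
  then have "tails_done s4" using done3 by (simp add: tails_done_def)
  note n5 = sim_prog[OF this, folded s5_def]
  have "fst s5 vTau = fst s4 vTau"
    unfolding s5_def by (simp_all add: run_unwritten sim_prog_def nop_def del: run.simps)
  then have planned5: "planned s5 n" using n4 by (simp add: planned_def)
  have "fst s5 vSel = (\<lambda>_. 0)"
    unfolding s5_def s4_def s3_def s2_def s1_def
    by (simp_all add: run_unwritten tails_prog_def matrix_prog_def column_prog_def entry_prog_def pack_prog_def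
        step_prog_def pick_prog_def length_prog_def plan_prog_def mass_prog_def sim_prog_def nop_def del: run.simps)
  note n6 = choose_prog[OF planned5 n5 this, folded s6_def]
  have main: "go main_prog ?s0 = go large_prog s6"
    by (simp add: main_prog_def s6_def s5_def s4_def s3_def s2_def s1_def)
  show ?thesis unfolding main large_prog n6 decide_def by simp
qed

end

section \<open>The compiled program and its value\<close>

definition repeat_add :: "nexp \<Rightarrow> nexp \<Rightarrow> prog" where
  "repeat_add x y = Seq (NStore (counter 0) (NConst 0))
     (While (NLess (NMem (counter 0)) (NMem (NConst 0)))
       (Seq (NStore x (NAdd (NMem x) y)) (NStore (counter 0) (NAdd (NMem (counter 0)) (NConst 1)))))"

lemma nval_naddr: "fst \<sigma> 0 = n \<Longrightarrow> nval \<sigma> (naddr k e) = 4 * n + 4 + (32 * nval \<sigma> e + k)"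
  by (simp add: naddr_def nbase_def)

text \<open>A multiplication as n additions. The assumption on \<open>y\<close> lets it read memory
  as long as its value is unaffected by the two cells that the loop changes.\<close>

lemma repeat_add:
  fixes f :: "nat \<Rightarrow> nat" and g :: "nat \<Rightarrow> real"
  assumes n: "f 0 = n" and C: "C = 4 * n + 5" and X: "0 < X" "X \<noteq> C"
    and x: "\<And>\<sigma>. fst \<sigma> 0 = n \<Longrightarrow> nval \<sigma> x = X"
    and y: "\<And>a b. nval (f(X := a, C := b), g) y = w"
  shows "\<exists>k. exec u (repeat_add x y) (f, g) k (f(X := f X + n * w, C := n), g) \<and>
    k \<le> (n + 1) * (2 * ncost x + ncost y + 400)"
proof -
  let ?W = "While (NLess (NMem (counter 0)) (NMem (NConst 0)))
       (Seq (NStore x (NAdd (NMem x) y)) (NStore (counter 0) (NAdd (NMem (counter 0)) (NConst 1))))"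
  have C0: "C \<noteq> 0" using C by simp
  have ctr: "nval \<sigma> (counter 0) = C" if "fst \<sigma> 0 = n" for \<sigma>
    using that by (simp add: counter_def nval_naddr C)
  have cc: "ncost (counter 0) = 79"
    by (simp add: counter_def naddr_def nbase_def times32_def Let_def)
  define B where "B = 2 * ncost x + ncost y + 400"
  define st where "st i = (f(X := f X + i * w, C := i), g)" for i
  have st0: "fst (st i) 0 = n" "fst (st i) C = i" "fst (st i) X = f X + i * w" for i
    using n X C0 by (auto simp: st_def)
  have loop: "i \<le> n \<Longrightarrow> \<exists>k. exec u ?W (st i) k (st n) \<and> k \<le> 100 + (n - i) * (B - 100)" for i
  proof (induction "n - i" arbitrary: i)
    case 0
    then have "i = n" by simp
    then have "\<not> bval u (st i) (NLess (NMem (counter 0)) (NMem (NConst 0)))" by (simp add: ctr st0)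
    then have "exec u ?W (st i) (bcost (NLess (NMem (counter 0)) (NMem (NConst 0)))) (st i)"
      by (rule exec.WhileFalse)
    then have "exec u ?W (st i) 83 (st n)" using \<open>i = n\<close> by (simp add: cc)
    then show ?case by (intro exI[of _ 83]) simp
  next
    case (Suc d)
    then have i: "i < n" by simp
    have g1: "bval u (st i) (NLess (NMem (counter 0)) (NMem (NConst 0)))" using i by (simp add: ctr st0)
    let ?s1 = "((fst (st i))(X := f X + Suc i * w), snd (st i))"
    have e1: "exec u (NStore x (NAdd (NMem x) y)) (st i) (ncost x + ncost (NAdd (NMem x) y) + 1) ?s1"
    proof -
      have vx: "nval (st i) x = X" using st0 by (intro x)
      have "nval (st i) y = w" unfolding st_def by (rule y)
      then have vy: "nval (st i) (NAdd (NMem x) y) = f X + Suc i * w" using vx st0(3) by simp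
      show ?thesis using exec.NStore[of u x "NAdd (NMem x) y" "st i"] unfolding vx vy .
    qed
    have s1: "fst ?s1 0 = n" "fst ?s1 C = i" using st0[of i] X by auto
    have e2: "exec u (NStore (counter 0) (NAdd (NMem (counter 0)) (NConst 1))) ?s1
        (ncost (counter 0) + ncost (NAdd (NMem (counter 0)) (NConst 1)) + 1) (st (Suc i))"
    proof -
      have vx: "nval ?s1 (counter 0) = C" by (rule ctr[OF s1(1)])
      then have vy: "nval ?s1 (NAdd (NMem (counter 0)) (NConst 1)) = Suc i" using s1(2) by simp
      have "((fst ?s1)(C := Suc i), snd ?s1) = st (Suc i)"
        using X by (auto simp: st_def fun_eq_iff)
      then show ?thesis
        using exec.NStore[of u "counter 0" "NAdd (NMem (counter 0)) (NConst 1)" ?s1] unfolding vx vy by (simp only:)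
    qed
    obtain k where k: "exec u ?W (st (Suc i)) k (st n)" "k \<le> 100 + (n - Suc i) * (B - 100)"
      using Suc.hyps(1)[of "Suc i"] Suc.hyps(2) i by (metis Suc_diff_Suc Suc_inject Suc_leI)
    have "exec u ?W (st i) (bcost (NLess (NMem (counter 0)) (NMem (NConst 0))) + ((ncost x + ncost (NAdd (NMem x) y) + 1) +
       (ncost (counter 0) + ncost (NAdd (NMem (counter 0)) (NConst 1)) + 1)) + k) (st n)"
      by (rule exec.WhileTrue[OF g1 exec.Seq[OF e1 e2] k(1)])
    moreover have "bcost (NLess (NMem (counter 0)) (NMem (NConst 0))) + ((ncost x + ncost (NAdd (NMem x) y) + 1) +
       (ncost (counter 0) + ncost (NAdd (NMem (counter 0)) (NConst 1)) + 1)) + k \<le> 100 + (n - i) * (B - 100)"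
    proof -
      have "(n - i) * (B - 100) = (B - 100) + (n - Suc i) * (B - 100)" using i by (metis Suc_diff_Suc mult_Suc)
      then show ?thesis using k(2) by (simp add: cc B_def)
    qed
    ultimately show ?case by blast
  qed
  obtain k where k: "exec u ?W (st 0) k (st n)" "k \<le> 100 + n * (B - 100)" using loop[of 0] by auto
  have "exec u (NStore (counter 0) (NConst 0)) (f, g) (ncost (counter 0) + ncost (NConst 0) + 1) (st 0)"
    using exec.NStore[of u "counter 0" "NConst 0" "(f, g)"] ctr[of "(f, g)"] n by (simp add: st_def)
  from exec.Seq[OF this k(1)]
  have "exec u (repeat_add x y) (f, g) (ncost (counter 0) + ncost (NConst 0) + 1 + k) (f(X := f X + n * w, C := n), g)"
    by (simp add: repeat_add_def st_def)
  moreover have "n * (B - 100) \<le> n * B" by simp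
  then have "ncost (counter 0) + ncost (NConst 0) + 1 + k \<le> (n + 1) * B"
  proof -
    have "ncost (counter 0) + ncost (NConst 0) + 101 \<le> B" by (simp add: cc B_def)
    moreover have "(n + 1) * B = n * B + B" by simp
    ultimately show ?thesis using k(2) \<open>n * (B - 100) \<le> n * B\<close> by linarith
  qed
  ultimately show ?thesis unfolding B_def by blast
qed

text \<open>Provides the products \<open>n * T\<close> and \<open>n * (n * T)\<close>, on which loop
  bounds and addresses of compiled code rely.\<close>

definition setup_prog :: prog where
  "setup_prog = Seq (repeat_add (naddr 0 (NConst 0)) (NMem (NConst 1)))
     (repeat_add (naddr 0 (NConst 1)) (NMem (naddr 0 (NConst 0))))"

definition policy_prog :: prog where
  "policy_prog = Seq setup_prog (Seq (code 0 main_prog) (NStore (NConst 0) (NMem (naddr (vOut + 2) (NConst 0)))))"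

primrec bounds :: "stmt \<Rightarrow> nat set" where
  "bounds (SetN k e a) = {}"
| "bounds (SetR k e a) = {}"
| "bounds (P ;; Q) = bounds P \<union> bounds Q"
| "bounds (IfElse b P Q) = bounds P \<union> bounds Q"
| "bounds (For k b P) = insert b (bounds P)"

lemma cost_cong: "(\<And>i. i \<in> bounds P \<Longrightarrow> p i = q i) \<Longrightarrow> cost p d P = cost q d P"
  by (induction P arbitrary: d) auto

text \<open>Index 2, the current time, must be absent: the decision-maker may be free arbitrarily
  late, and a loop up to that time would not be polynomial.\<close>

lemma main_prog_bounds: "bounds main_prog \<subseteq> {0, 1, 3, 4, 5, 6, 7}"
  by (simp add: prog_defs)

context policy_run
begin

lemma setup_prog:
  "\<exists>k \<tau>. exec u setup_prog (initial_store I h) k \<tau> \<and> k \<le> 2000 * (n + 1) \<and> represents m r \<tau> (\<lambda>_ _. 0, \<lambda>_ _. 0)"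
proof -
  let ?NB = "4 * n + 4" let ?C = "4 * n + 5"
  have init: "initial_store I h = (m, r)" by (simp add: m_def r_def)
  have m0: "m 0 = n" "m 1 = T" using m_input by auto
  have beyond_m: "m a = 0" if "?NB \<le> a" for a
    using that past_length expired_length
    by (simp add: m_def initial_store_def nat_input_def length_concat_triples)
  have beyond_r: "r a = 0" if "1 + 2 * n + H + n * H \<le> a" for a
  proof -
    have "length (real_input I) = 1 + 2 * n + n * T + n * H"
      unfolding real_input_def Let_def length_append list.size length_map length_blocks by simp
    then show ?thesis using that by (simp add: r_def initial_store_def)
  qed
  have cost0: "ncost (naddr 0 (NConst k)) = 79" for k by (simp add: naddr_def nbase_def times32_def Let_def)
  let ?m1 = "m(?NB := m ?NB + n * T, ?C := n)"
  obtain k1 where k1: "exec u (repeat_add (naddr 0 (NConst 0)) (NMem (NConst 1))) (m, r) k1 (?m1, r)"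
    "k1 \<le> (n + 1) * (2 * ncost (naddr 0 (NConst 0)) + ncost (NMem (NConst 1)) + 400)"
    using repeat_add[of m n ?C ?NB "naddr 0 (NConst 0)" r "NMem (NConst 1)" T u] m0 by (auto simp: nval_naddr)
  let ?m2 = "?m1(?NB + 32 := ?m1 (?NB + 32) + n * (n * T), ?C := n)"
  obtain k2 where k2: "exec u (repeat_add (naddr 0 (NConst 1)) (NMem (naddr 0 (NConst 0)))) (?m1, r) k2 (?m2, r)"
    "k2 \<le> (n + 1) * (2 * ncost (naddr 0 (NConst 1)) + ncost (NMem (naddr 0 (NConst 0))) + 400)"
    using repeat_add[of ?m1 n ?C "?NB + 32" "naddr 0 (NConst 1)" r "NMem (naddr 0 (NConst 0))" "n * T" u] m0 beyond_m[of ?NB]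
    by (auto simp: nval_naddr)
  have "exec u setup_prog (initial_store I h) (k1 + k2) (?m2, r)"
    unfolding setup_prog_def init by (rule exec.Seq[OF k1(1) k2(1)])
  moreover have "k1 + k2 \<le> 2000 * (n + 1)" using k1(2) k2(2) by (simp add: cost0)
  moreover have "represents m r (?m2, r) (\<lambda>_ _. 0, \<lambda>_ _. 0)"
  proof -
    have "?NB + (32 * i + (k + 2)) \<noteq> ?NB" "?NB + (32 * i + (k + 2)) \<noteq> ?C" for i k by auto
    moreover have "?NB + (32 * i + (k + 2)) \<noteq> ?NB + 32" if "k < 30" for i k
      using slot_eq[of "0" "k + 2" ?NB i 1] that by simp
    ultimately show ?thesis
      unfolding represents_def par_simps fst_conv snd_conv
      using beyond_m beyond_r by auto
  qed
  ultimately show ?thesis by blast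
qed

lemma policy_prog:
  "\<exists>k \<tau>. exec u policy_prog (initial_store I h) k \<tau> \<and> k \<le> 2000 * (n + 1) + cost (par m) 0 main_prog + 100 \<and>
    fst \<tau> 0 = decide I u h"
proof -
  obtain k1 \<sigma> where 1: "exec u setup_prog (initial_store I h) k1 \<sigma>" "k1 \<le> 2000 * (n + 1)"
    "represents m r \<sigma> (\<lambda>_ _. 0, \<lambda>_ _. 0)" using setup_prog by blast
  obtain k2 \<tau> where 2: "exec u (code 0 main_prog) \<sigma> k2 \<tau>" "k2 \<le> cost (par m) 0 main_prog"
    "represents m r \<tau> (go main_prog (\<lambda>_ _. 0, \<lambda>_ _. 0))"
    using code_correct[OF main_prog_ok 1(3), of u 0] by blast
  have v: "nval \<tau> (NMem (naddr (vOut + 2) (NConst 0))) = decide I u h"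
  proof -
    have "fst \<tau> (par m 8 + (32 * 0 + (vOut + 2))) = fst (go main_prog (\<lambda>_ _. 0, \<lambda>_ _. 0)) vOut 0"
    proof -
      have "\<forall>k<30. \<forall>i. fst \<tau> (par m 8 + (32 * i + (k + 2))) = fst (go main_prog (\<lambda>_ _. 0, \<lambda>_ _. 0)) k i"
        using 2(3) unfolding represents_def by blast
      from this[rule_format, of vOut 0] show ?thesis by simp
    qed
    then show ?thesis using main_prog represents_naddr[OF 2(3), of "vOut + 2" "NConst 0"] by simp
  qed
  have 3: "exec u (NStore (NConst 0) (NMem (naddr (vOut + 2) (NConst 0)))) \<tau>
    (ncost (NConst 0) + ncost (NMem (naddr (vOut + 2) (NConst 0))) + 1) ((fst \<tau>)(0 := decide I u h), snd \<tau>)"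
    using exec.NStore[of u "NConst 0" "NMem (naddr (vOut + 2) (NConst 0))" \<tau>] v by simp
  have "exec u policy_prog (initial_store I h)
    (k1 + (k2 + (ncost (NConst 0) + ncost (NMem (naddr (vOut + 2) (NConst 0))) + 1))) ((fst \<tau>)(0 := decide I u h), snd \<tau>)"
    unfolding policy_prog_def by (rule exec.Seq[OF 1(1) exec.Seq[OF 2(1) 3]])
  moreover have "k1 + (k2 + (ncost (NConst 0) + ncost (NMem (naddr (vOut + 2) (NConst 0))) + 1)) \<le>
     2000 * (n + 1) + cost (par m) 0 main_prog + 100"
    using 1(2) 2(2) by (simp add: naddr_def nbase_def times32_def Let_def)
  ultimately show ?thesis by (metis fst_conv fun_upd_same)
qed

lemma par_bound:
  assumes i: "i \<in> {0, 1, 3, 4, 5, 6, 7}"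
  shows "par m i \<le> 1000 * (n + T) ^ 3"
proof -
  have nT: "1 \<le> n" "1 \<le> T" using valid max_eval_pos[OF valid] by (auto simp: valid_instance_def)
  define S where "S = n + T"
  have S: "2 \<le> S" "n \<le> S" "T \<le> S" using nT by (auto simp: S_def)
  define A B where "A = S * S" and "B = S ^ 3"
  have nT2: "n * T \<le> A" using S unfolding A_def by (intro mult_mono) auto
  have nnT: "n * (n * T) \<le> B"
    using mult_mono[OF S(2) nT2] by (simp add: A_def B_def power3_eq_cube mult.assoc)
  have S1: "S \<le> A" using S by (simp add: A_def)
  have S2: "A \<le> B" using S by (simp add: A_def B_def power3_eq_cube)
  have par: "par m 0 = n" "par m 1 = T" "par m 3 = length (past h)" "par m 4 = n * T" "par m 5 = n * (n * T)"
    "par m 6 = n + n * T + 1" "par m 7 = 1000" by (simp_all add: lp_rows_def)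
  have "i = 0 \<or> i = 1 \<or> i = 3 \<or> i = 4 \<or> i = 5 \<or> i = 6 \<or> i = 7" using i by blast
  then have "par m i \<le> 1000 * B"
    using S S1 S2 nT2 nnT past_length by (elim disjE; simp only: par; linarith)
  then show ?thesis by (simp only: B_def S_def)
qed

end

theorem policy_prog_polynomial:
  "\<exists>(C::real) d. \<forall>I h u. policy_run I h \<longrightarrow>
     (\<exists>k \<tau>. exec u policy_prog (initial_store I h) k \<tau> \<and> real k \<le> C * (real (num_opts I) + real (max_eval I)) ^ d \<and>
       fst \<tau> 0 = decide I u h)"
proof -
  obtain K D where KD: "\<And>p X. (\<forall>i. p i \<le> X) \<Longrightarrow> cost p 0 main_prog \<le> K * (X + 1) ^ D"
    using cost_polynomial[of 0 main_prog] by blast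
  define C where "C = 2100 + K * 1001 ^ D"
  have "\<exists>k \<tau>. exec u policy_prog (initial_store I h) k \<tau> \<and> real k \<le> real C * (real (num_opts I) + real (max_eval I)) ^ (3 * D + 1) \<and>
       fst \<tau> 0 = decide I u h" if run: "policy_run I h" for I h u
  proof -
    interpret policy_run I h u by (rule run)
    let ?S = "n + T"
    have nT: "1 \<le> n" "1 \<le> T" using valid max_eval_pos[OF valid] by (auto simp: valid_instance_def)
    \<comment> \<open>\<open>cost_polynomial\<close> asks for a bound on all parameters, so those
      that bound no loop are set to 0.\<close>
    define p where "p i = (if i \<in> {0, 1, 3, 4, 5, 6, 7} then par m i else 0)" for i
    have "cost (par m) 0 main_prog = cost p 0 main_prog"
      using main_prog_bounds by (intro cost_cong) (auto simp: p_def)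
    also have "\<dots> \<le> K * (1000 * ?S ^ 3 + 1) ^ D"
      using par_bound by (intro KD) (simp add: p_def)
    also have "\<dots> \<le> K * (1001 * ?S ^ 3) ^ D"
    proof -
      have "1 \<le> ?S ^ 3" using nT by simp
      then show ?thesis by (intro mult_left_mono power_mono) auto
    qed
    also have "\<dots> = K * 1001 ^ D * ?S ^ (3 * D)" by (simp add: power_mult_distrib power_mult)
    also have "\<dots> \<le> K * 1001 ^ D * ?S ^ (3 * D + 1)"
      using nT by (intro mult_left_mono power_increasing) auto
    finally have c: "cost (par m) 0 main_prog \<le> K * 1001 ^ D * ?S ^ (3 * D + 1)" .
    obtain k \<tau> where k: "exec u policy_prog (initial_store I h) k \<tau>" "k \<le> 2000 * (n + 1) + cost (par m) 0 main_prog + 100"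
      "fst \<tau> 0 = decide I u h" using policy_prog by blast
    have "2000 * (n + 1) + 100 \<le> 2100 * ?S" using nT by simp
    also have "\<dots> \<le> 2100 * ?S ^ (3 * D + 1)"
      using nT by (intro mult_left_mono self_le_power) auto
    finally have "k \<le> C * ?S ^ (3 * D + 1)" using k(2) c by (simp add: C_def algebra_simps)
    then have "real k \<le> real (C * ?S ^ (3 * D + 1))" by (rule of_nat_mono)
    then have "real k \<le> real C * (real n + real T) ^ (3 * D + 1)" by simp
    then show ?thesis using k(1,3) by blast
  qed
  then show ?thesis by blast
qed

section \<open>Value and running time of the implemented policy\<close>

definition sse_policy :: "sse_instance \<Rightarrow> policy" where
  "sse_policy I u h = as_option (decide I u h)"

lemma sse_policy_lp:
  "\<not> (\<exists>j\<in>opts I. capacity I < 10 * wgt I j) \<Longrightarrow> sse_policy I = lp_policy I (lp_y I)"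
  by (auto simp: fun_eq_iff sse_policy_def decide_def lp_policy_def plan_rule_def split: prod.splits)

lemma sse_policy_single:
  "\<exists>j\<in>opts I. capacity I < 10 * wgt I j \<Longrightarrow>
    sse_policy I = (\<lambda>u h. as_option (if now h < 2 then single_choice I else 0))"
  by (auto simp: fun_eq_iff sse_policy_def decide_def)

lemma expected_value_nonneg: "valid_instance I \<Longrightarrow> 0 \<le> expected_value I \<pi>"
proof -
  assume valid: "valid_instance I"
  have "0 \<le> (\<Sum>j\<in>selected I d s e. val I j)" for d s e
    using valid by (intro sum_nonneg) (auto simp: selected_def valid_instance_def intro: less_imp_le)
  then show ?thesis unfolding expected_value_def by (intro Bochner_Integration.integral_nonneg) auto
qed

text \<open>The common bound makes the supremum one of a bounded set; nonnegativity is inherited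
  from the given policy.\<close>

lemma online_opt_bounds:
  assumes valid: "valid_instance I" and \<pi>: "online_policy I \<pi>"
    and B: "\<And>\<pi>. online_policy I \<pi> \<Longrightarrow> expected_value I \<pi> \<le> B"
  shows "0 \<le> online_opt I" "online_opt I \<le> B"
proof -
  have "expected_value I \<pi> \<le> online_opt I"
    unfolding online_opt_def using \<pi> B by (intro cSUP_upper bdd_aboveI2) auto
  then show "0 \<le> online_opt I" using expected_value_nonneg[OF valid, of \<pi>] by linarith
  show "online_opt I \<le> B" unfolding online_opt_def using \<pi> B by (intro cSUP_least) auto
qed

lemma scenario_exp_gt_1:
  assumes valid: "valid_instance I" and sup: "(s, e) \<in> set_pmf (scenarios I)" and j: "j \<in> opts I"
  shows "1 < e j"
proof -
  have "e j \<in> set_pmf (exp_dist I j)" using sup j by (auto simp: set_scenarios[OF valid] PiE_dflt_def)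
  moreover have "AE x in measure_pmf (exp_dist I j). x \<in> {x. x > 1}"
    using valid j by (subst measure_pmf.prob_eq_1[symmetric]) (auto simp: valid_instance_def tail_def)
  ultimately show ?thesis by (auto simp: AE_measure_pmf_iff)
qed

lemma single_choice_props:
  fixes I
  defines "f \<equiv> \<lambda>i. if wgt I (Suc i) \<le> capacity I then val I (Suc i) else 0"
  assumes "single_choice I \<noteq> 0"
  shows "single_choice I \<in> opts I" "wgt I (single_choice I) \<le> capacity I"
    "val I (single_choice I) = fst (best f (num_opts I))"
proof -
  have pos: "0 < fst (best f (num_opts I))" and k: "single_choice I = Suc (snd (best f (num_opts I)))"
    using assms(2) by (auto simp: single_choice_def Let_def f_def split: if_splits)
  have "snd (best f (num_opts I)) < num_opts I" "f (snd (best f (num_opts I))) = fst (best f (num_opts I))"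
    using best_attained[OF pos] by auto
  with pos show "single_choice I \<in> opts I" "wgt I (single_choice I) \<le> capacity I"
    "val I (single_choice I) = fst (best f (num_opts I))"
    unfolding k by (auto simp: f_def split: if_splits)
qed

lemma selections_single:
  fixes k s e
  defines "d \<equiv> \<lambda>h. as_option (if now h < 2 then k else 0)"
  shows "selections I d s e t = (if t = 0 \<or> k = 0 then [] else [(k, 1)])"
proof (induction t)
  case (Suc t)
  then show ?case by (auto simp: Let_def d_def as_option_def observe_simps(1) free_def split: option.splits)
qed simp

text \<open>No option has expired at time 1, so any option that fits may be selected then.\<close>

lemma online_policy_single:
  assumes valid: "valid_instance I"
  shows "online_policy I (\<lambda>u h. as_option (if now h < 2 then single_choice I else 0))"
  unfolding online_policy_def
proof (intro conjI allI ballI, simp)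
  fix u x
  assume "u \<in> space seed" and x: "x \<in> set_pmf (scenarios I)"
  obtain s e where [simp]: "x = (s, e)" by (cases x)
  let ?d = "\<lambda>h. as_option (if now h < 2 then single_choice I else 0)"
  show "case x of (s, e) \<Rightarrow> \<forall>t. let L = selections I ?d s e t in free s L (Suc t) \<longrightarrow>
        (\<forall>j. ?d (observe I s e L (Suc t)) = Some j \<longrightarrow> selectable I e L (Suc t) j)"
  proof (simp only: \<open>x = (s, e)\<close> prod.case Let_def, intro allI impI)
    fix t j assume "?d (observe I s e (selections I ?d s e t) (Suc t)) = Some j"
    then have t: "t = 0" and j: "j = single_choice I" "single_choice I \<noteq> 0"
      by (auto simp: observe_simps(1) as_option_def split: if_splits)
    have "1 < e j" using scenario_exp_gt_1[OF valid _ single_choice_props(1)[OF j(2)]] x j by auto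
    then show "selectable I e (selections I ?d s e t) (Suc t) j"
      using single_choice_props[OF j(2)] unfolding t j by (simp add: selectable_def)
  qed
qed

lemma expected_value_single:
  assumes valid: "valid_instance I"
  shows "expected_value I (\<lambda>u h. as_option (if now h < 2 then single_choice I else 0)) =
    fst (best (\<lambda>i. if wgt I (Suc i) \<le> capacity I then val I (Suc i) else 0) (num_opts I))"
proof -
  let ?d = "\<lambda>h. as_option (if now h < 2 then single_choice I else 0)"
  let ?f = "\<lambda>i. if wgt I (Suc i) \<le> capacity I then val I (Suc i) else 0"
  interpret S: prob_space seed by (rule prob_space_seed)
  interpret P: pair_prob_space "measure_pmf (scenarios I)" seed ..
  have "(\<Sum>j\<in>selected I ?d s e. val I j) = fst (best ?f (num_opts I))" for s e
  proof (cases "single_choice I = 0")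
    case True
    then have "fst (best ?f (num_opts I)) = 0"
      using best_nonneg[of ?f "num_opts I"] by (auto simp: single_choice_def Let_def split: if_splits)
    moreover have "selected I ?d s e = {}" unfolding selected_def selections_single using True by simp
    ultimately show ?thesis by simp
  next
    case False
    have "selected I ?d s e = {single_choice I}"
      unfolding selected_def selections_single using False single_choice_props(1)[OF False] by auto
    then show ?thesis using single_choice_props(3)[OF False] by simp
  qed
  then show ?thesis unfolding expected_value_def by (simp add: case_prod_unfold P.prob_space)
qed

text \<open>Every selected option fits on its own. Besides treating large weights, this bound shows
  that \<open>online_opt\<close> is a supremum of a bounded set.\<close>

lemma expected_value_le_sum:
  assumes valid: "valid_instance I" and \<pi>: "online_policy I \<pi>"
  shows "expected_value I \<pi> \<le> (\<Sum>j\<in>opts I. if wgt I j \<le> capacity I then val I j else 0)"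
proof (rule expected_value_le_pointwise)
  let ?B = "\<Sum>j\<in>opts I. if wgt I j \<le> capacity I then val I j else 0"
  have v: "0 < val I j \<and> 0 \<le> wgt I j" if "j \<in> opts I" for j using valid that by (auto simp: valid_instance_def)
  then show "0 \<le> ?B" by (intro sum_nonneg) (auto intro: less_imp_le)
  fix u assume u: "u \<in> space seed"
  let ?g = "\<lambda>(s, e). \<Sum>j\<in>selected I (\<pi> u) s e. val I j"
  have sub: "selected I (\<pi> u) s e \<subseteq> {j \<in> opts I. wgt I j \<le> capacity I}" if sup: "(s, e) \<in> set_pmf (scenarios I)" for s e
  proof
    fix j assume "j \<in> selected I (\<pi> u) s e"
    then obtain t where j: "j \<in> opts I" "j \<in> fst ` set (selections I (\<pi> u) s e t)" by (auto simp: selected_def)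
    let ?L = "selections I (\<pi> u) s e t"
    have leg: "fst ` set ?L \<subseteq> opts I \<and> distinct (map fst ?L) \<and> (\<Sum>(i, r)\<leftarrow>?L. wgt I i) \<le> capacity I"
      using online_policy_legal[OF \<pi> u] by (intro L_legal[OF valid _ sup]) blast
    have "wgt I j \<le> (\<Sum>i\<in>fst ` set ?L. wgt I i)"
      using j leg v by (intro member_le_sum) auto
    also have "\<dots> = sum_list (map (wgt I) (map fst ?L))"
      using leg by (simp only: sum_list_distinct_conv_sum_set set_map)
    also have "\<dots> = (\<Sum>(i, r)\<leftarrow>?L. wgt I i)" by (simp add: case_prod_unfold comp_def)
    finally show "j \<in> {j \<in> opts I. wgt I j \<le> capacity I}" using leg j by simp
  qed
  have le: "?g x \<le> ?B" if "x \<in> set_pmf (scenarios I)" for x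
  proof -
    obtain s e where x: "x = (s, e)" by (cases x)
    have "(\<Sum>j\<in>selected I (\<pi> u) s e. val I j) \<le> (\<Sum>j\<in>{j \<in> opts I. wgt I j \<le> capacity I}. val I j)"
      using sub[of s e] that x v by (intro sum_mono2) (auto intro: less_imp_le)
    also have "\<dots> = ?B" by (rule sum.inter_filter) simp
    finally show ?thesis by (simp add: x)
  qed
  have ge: "0 \<le> ?g x" for x
  proof -
    obtain s e where x: "x = (s, e)" by (cases x)
    have "0 \<le> val I j" if "j \<in> selected I (\<pi> u) s e" for j
      using that v[of j] by (simp add: selected_def less_imp_le)
    then show ?thesis unfolding x prod.case by (rule sum_nonneg)
  qed
  show "measure_pmf.expectation (scenarios I) ?g \<le> ?B"
  proof (rule measure_pmf.integral_le_const)
    show "integrable (measure_pmf (scenarios I)) ?g"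
      by (rule measure_pmf.integrable_const_bound[where B = ?B]) (use le ge in \<open>auto simp: AE_measure_pmf_iff\<close>)
    show "AE x in measure_pmf (scenarios I). ?g x \<le> ?B" using le by (auto simp: AE_measure_pmf_iff)
  qed
qed

lemma online_policy_sse:
  assumes valid: "valid_instance I"
  shows "online_policy I (sse_policy I)"
proof (cases "\<exists>j\<in>opts I. capacity I < 10 * wgt I j")
  case True
  then show ?thesis using online_policy_single[OF valid] by (simp only: sse_policy_single)
next
  case False
  then have small: "10 * wgt I j \<le> capacity I" if "j \<in> opts I" for j using that by force
  have feas: "lp_feasible I (lp_y I)" by (rule lp_y_near_optimal(1)[OF valid small])
  show ?thesis
    unfolding sse_policy_lp[OF False] online_policy_def
  proof (intro conjI allI ballI)
    show "(\<lambda>u. lp_policy I (lp_y I) u h) \<in> measurable seed (count_space UNIV)" for h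
      by (rule measurable_lp_policy[OF valid feas])
  next
    fix u and x :: "(nat \<Rightarrow> nat) \<times> (nat \<Rightarrow> nat)"
    obtain \<tau> g where noise: "lp_noise I (lp_y I) u = (\<tau>, g)" by (cases "lp_noise I (lp_y I) u")
    have pol: "lp_policy I (lp_y I) u = plan_rule I \<tau> g" by (simp add: lp_policy_def noise)
    show "case x of (s, e) \<Rightarrow> \<forall>t. let L = selections I (lp_policy I (lp_y I) u) s e t in free s L (Suc t) \<longrightarrow>
        (\<forall>j. lp_policy I (lp_y I) u (observe I s e L (Suc t)) = Some j \<longrightarrow> selectable I e L (Suc t) j)"
      unfolding pol Let_def using plan_rule_selectable[OF valid] by auto
  qed
qed

lemma knapsack_factor_mono: "a \<le> b \<Longrightarrow> knapsack_factor a I \<le> knapsack_factor b I"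
  unfolding knapsack_factor_def by (auto intro!: divide_right_mono mult_right_mono)

text \<open>The constant 1/100 is the smaller of two: small weights allow 1/50, while a weight above
  W/10 allows only 1/100, through \<open>1 - exp (- x) <= x\<close> with
  \<open>x <= 1/n\<close>.\<close>

lemma sse_policy_value:
  assumes valid: "valid_instance I"
  shows "0.316 * knapsack_factor (1 / 100) I * online_opt I \<le> expected_value I (sse_policy I)"
proof (cases "\<exists>j\<in>opts I. capacity I < 10 * wgt I j")
  case True
  let ?f = "\<lambda>i. if wgt I (Suc i) \<le> capacity I then val I (Suc i) else 0"
  define n W w b where "n = real (num_opts I)" and "W = capacity I" and "w = w_max I" and "b = fst (best ?f (num_opts I))"
  have val_eq: "expected_value I (sse_policy I) = b"
    unfolding sse_policy_single[OF True] b_def by (rule expected_value_single[OF valid])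
  have b0: "0 \<le> b" unfolding b_def by (rule best_nonneg)
  have "(\<Sum>j\<in>opts I. if wgt I j \<le> capacity I then val I j else 0) = (\<Sum>i<num_opts I. ?f i)"
    unfolding One_nat_def by (rule sum.atLeast1_atMost_eq)
  also have "\<dots> \<le> (\<Sum>i<num_opts I. b)" unfolding b_def by (intro sum_mono best_upper) simp
  finally have sum: "(\<Sum>j\<in>opts I. if wgt I j \<le> capacity I then val I j else 0) \<le> n * b" by (simp add: n_def)
  have opt: "0 \<le> online_opt I" "online_opt I \<le> n * b"
    using online_opt_bounds[OF valid online_policy_sse[OF valid], of "n * b"] expected_value_le_sum[OF valid] sum
    by (auto intro: order_trans)
  obtain j where j: "j \<in> opts I" "W < 10 * wgt I j" using True by (auto simp: W_def)
  have "wgt I j \<le> w" unfolding w_def w_max_def using j by (intro Max_ge) auto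
  then have Ww: "W < 10 * w" using j by simp
  have W0: "0 \<le> W" using valid by (simp add: W_def valid_instance_def)
  have w0: "0 < w" using Ww W0 by simp
  have n0: "1 \<le> n" using valid by (auto simp: n_def valid_instance_def)
  have "W\<^sup>2 \<le> (10 * w)\<^sup>2" using Ww W0 by (intro power_mono) auto
  then have "(1 / 100) * W\<^sup>2 / (n * w\<^sup>2) \<le> 1 / n"
    using n0 w0 by (simp add: field_simps power_mult_distrib)
  moreover have "knapsack_factor (1 / 100) I \<le> (1 / 100) * W\<^sup>2 / (n * w\<^sup>2)"
    using exp_ge_add_one_self[of "- (1 / 100) * W\<^sup>2 / (n * w\<^sup>2)"] w0
    unfolding knapsack_factor_def w_def W_def n_def by simp
  ultimately have k: "knapsack_factor (1 / 100) I \<le> 1 / n" by linarith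
  have k0: "0 \<le> knapsack_factor (1 / 100) I" by (auto simp: knapsack_factor_def)
  have "0.316 * knapsack_factor (1 / 100) I * online_opt I \<le> 1 * (1 / n) * (n * b)"
    using k k0 opt n0 by (intro mult_mono) auto
  then show ?thesis using n0 by (simp add: val_eq)
next
  case False
  then have small: "10 * wgt I j \<le> capacity I" if "j \<in> opts I" for j using that by force
  let ?V = "lp_value I (lp_y I)"
  have lp1: "lp_feasible I (lp_y I)" by (rule lp_y_near_optimal(1)[OF valid small])
  have "lp_value I y \<le> 100 / 93 * ?V" if "lp_feasible I y" for y
    using lp_y_near_optimal(2)[OF valid small that] by simp
  then have opt: "0 \<le> online_opt I" "online_opt I \<le> 100 / 93 * ?V"
    using online_opt_bounds[OF valid online_policy_sse[OF valid], of "100 / 93 * ?V"]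
      expected_value_le_lp[OF valid, of _ "100 / 93 * ?V"] by blast+
  have k: "knapsack_factor (1 / 100) I \<le> knapsack_factor (1 / 50) I" "0 \<le> knapsack_factor (1 / 100) I"
    by (rule knapsack_factor_mono) (auto simp: knapsack_factor_def)
  have "0.316 * knapsack_factor (1 / 100) I * online_opt I \<le> 0.316 * knapsack_factor (1 / 50) I * (100 / 93 * ?V)"
    using k opt by (intro mult_mono) auto
  \<comment> \<open>\<open>0.316 * 100 / 93\<close> is about 0.3398.\<close>
  also have "\<dots> \<le> 0.3477 * knapsack_factor (1 / 50) I * ?V"
    using k opt by (simp add: mult_right_mono mult_nonneg_nonneg)
  also have "\<dots> \<le> expected_value I (sse_policy I)"
    unfolding sse_policy_lp[OF False] expected_value_lp_policy_eq[OF valid lp1]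
    using small by (rule expected_chosen[OF valid lp1])
  finally show ?thesis .
qed

lemma policy_run_reachable:
  assumes valid: "valid_instance I" and u: "u \<in> space seed" and sup: "(s, e) \<in> set_pmf (scenarios I)"
  shows "policy_run I (observe I s e (selections I (sse_policy I u) s e t) (Suc t))"
proof
  let ?L = "selections I (sse_policy I u) s e t"
  have leg: "fst ` set ?L \<subseteq> opts I \<and> distinct (map fst ?L) \<and> (\<Sum>(i, r)\<leftarrow>?L. wgt I i) \<le> capacity I"
    using online_policy_legal[OF online_policy_sse[OF valid] u] by (intro L_legal[OF valid _ sup]) blast
  show "valid_instance I" by (rule valid)
  show "fst ` set (past (observe I s e ?L (Suc t))) \<subseteq> opts I" using leg by (simp add: observe_simps(2))
  have "length ?L = card (fst ` set ?L)" using leg by (metis distinct_card length_map set_map)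
  also have "\<dots> \<le> num_opts I" using leg card_mono[of "opts I"] by fastforce
  finally show "length (past (observe I s e ?L (Suc t))) \<le> num_opts I" by (simp add: observe_def)
  show "length (expired (observe I s e ?L (Suc t))) = num_opts I" by (simp add: observe_def)
  fix x assume "Some x \<in> set (expired (observe I s e ?L (Suc t)))"
  then obtain j where "j \<in> set [1..<Suc (num_opts I)]" "Some x = (if j \<in> fst ` set ?L \<or> Suc t < e j then None else Some (e j))"
    unfolding observe_def history.sel set_map by blast
  then have "j \<in> opts I" "x = e j" by (auto split: if_splits)
  then show "0 < x" using scenario_exp_gt_1[OF valid sup, of j] by simp
qed

text \<open>The plan selects within the horizon \<open>n * T\<close>, the single option is taken at
  time 1, and the square of \<open>n + T\<close> dominates both.\<close>

lemma sse_policy_time: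
  assumes "valid_instance I" "sse_policy I u h \<noteq> None"
  shows "real (now h) \<le> (real (num_opts I) + real (max_eval I)) ^ 2"
proof -
  have nT: "1 \<le> num_opts I" "1 \<le> max_eval I"
    using assms(1) max_eval_pos[OF assms(1)] by (auto simp: valid_instance_def)
  have sq: "num_opts I * max_eval I \<le> (num_opts I + max_eval I) ^ 2" "2 \<le> num_opts I + max_eval I"
    using nT by (auto simp: power2_eq_square algebra_simps)
  then have "2 \<le> (num_opts I + max_eval I) ^ 2" by (meson le_trans self_le_power zero_less_numeral le_trans one_le_numeral)
  note sq = sq this
  have "now h \<le> (num_opts I + max_eval I) ^ 2"
  proof (cases "\<exists>j\<in>opts I. capacity I < 10 * wgt I j")
    case True
    then have "now h < 2" using assms(2) by (auto simp: sse_policy_single as_option_def split: if_splits)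
    then show ?thesis using sq by linarith
  next
    case False
    then obtain \<tau> g j where "plan_rule I \<tau> g h = Some j"
      using assms(2) unfolding sse_policy_lp[OF False] lp_policy_def by (auto split: prod.splits)
    from plan_rule_Some[OF this] have "now h \<le> horizon I" by (simp add: eligible_def)
    then show ?thesis using sq by linarith
  qed
  then have "real (now h) \<le> real ((num_opts I + max_eval I) ^ 2)" by (rule of_nat_mono)
  then show ?thesis by simp
qed

theorem theorem1p4:
  shows "\<exists>c>0. \<exists>(C::real) (d::nat). \<forall>\<epsilon>>0. \<exists>P. \<forall>I. valid_instance I \<longrightarrow>
    (\<exists>\<pi>. online_policy I \<pi> \<and>
       implements_within I P \<pi> (C * (real (num_opts I) + real (max_eval I) + 1 / \<epsilon>) ^ d) \<and>
       expected_value I \<pi> \<ge> (knapsack_factor c I * 0.316 - \<epsilon>) * online_opt I)"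
proof -
  obtain C0 :: real and d0 where prog: "\<And>I h u. policy_run I h \<Longrightarrow>
     (\<exists>k \<tau>. exec u policy_prog (initial_store I h) k \<tau> \<and> real k \<le> C0 * (real (num_opts I) + real (max_eval I)) ^ d0 \<and>
       fst \<tau> 0 = decide I u h)"
    using policy_prog_polynomial by blast
  \<comment> \<open>\<open>C\<close> and \<open>d\<close> dominate both the running time, of degree
    \<open>d0\<close>, and the bound on the latest selection time, of degree 2.\<close>
  define C where "C = 1 + \<bar>C0\<bar>"
  define d where "d = d0 + 2"
  have main: "online_policy I (sse_policy I) \<and>
       implements_within I policy_prog (sse_policy I) (C * (real (num_opts I) + real (max_eval I) + 1 / \<epsilon>) ^ d) \<and>
       expected_value I (sse_policy I) \<ge> (knapsack_factor (1 / 100) I * 0.316 - \<epsilon>) * online_opt I"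
    if \<epsilon>: "0 < \<epsilon>" and valid: "valid_instance I" for \<epsilon> :: real and I
  proof (intro conjI)
    show pol: "online_policy I (sse_policy I)" by (rule online_policy_sse[OF valid])
    let ?S = "real (num_opts I) + real (max_eval I)" and ?B = "C * (real (num_opts I) + real (max_eval I) + 1 / \<epsilon>) ^ d"
    have S: "1 \<le> ?S" using valid by (auto simp: valid_instance_def)
    have bound: "x \<le> ?B" if "x \<le> C1 * ?S ^ d1" "C1 \<le> C" "d1 \<le> d" for x C1 d1
    proof -
      have "C1 * ?S ^ d1 \<le> C * ?S ^ d1" using that S by (intro mult_right_mono) auto
      also have "\<dots> \<le> C * ?S ^ d" using S that by (intro mult_left_mono power_increasing) (auto simp: C_def)
      also have "\<dots> \<le> ?B" using S \<epsilon> by (intro mult_left_mono power_mono) (auto simp: C_def)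
      finally show ?thesis using that(1) by linarith
    qed
    show "implements_within I policy_prog (sse_policy I) ?B"
      unfolding implements_within_def Let_def
    proof (intro ballI, clarify)
      fix u s e t assume u: "u \<in> space seed" and sup: "(s, e) \<in> set_pmf (scenarios I)"
      let ?h = "observe I s e (selections I (sse_policy I u) s e t) (Suc t)"
      obtain k \<tau> where k: "exec u policy_prog (initial_store I ?h) k \<tau>" "real k \<le> C0 * ?S ^ d0" "fst \<tau> 0 = decide I u ?h"
        using prog[OF policy_run_reachable[OF valid u sup], of u] by blast
      have "real k \<le> ?B" using k(2) by (rule bound) (auto simp: C_def d_def)
      moreover have "sse_policy I u ?h = (if fst \<tau> 0 = 0 then None else Some (fst \<tau> 0))"
        by (simp add: sse_policy_def as_option_def k(3))
      ultimately have "\<exists>k m r. exec u policy_prog (initial_store I ?h) k (m, r) \<and> real k \<le> ?B \<and>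
           sse_policy I u ?h = (if m 0 = 0 then None else Some (m 0))"
        using k(1) by (metis prod.collapse)
      moreover have "real (Suc t) \<le> ?B" if "sse_policy I u ?h \<noteq> None"
        using sse_policy_time[OF valid that]
        by (intro bound[of _ 1 2]) (auto simp: C_def d_def observe_simps(1))
      ultimately show "(\<exists>k m r. exec u policy_prog (initial_store I ?h) k (m, r) \<and> real k \<le> ?B \<and>
           sse_policy I u ?h = (if m 0 = 0 then None else Some (m 0))) \<and>
        (sse_policy I u ?h \<noteq> None \<longrightarrow> real (Suc t) \<le> ?B)" by blast
    qed
    have opt0: "0 \<le> online_opt I"
      using online_opt_bounds(1)[OF valid pol] expected_value_le_sum[OF valid] by blast
    have "(knapsack_factor (1 / 100) I * 0.316 - \<epsilon>) * online_opt I \<le> 0.316 * knapsack_factor (1 / 100) I * online_opt I"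
      using opt0 \<epsilon> by (intro mult_right_mono) auto
    with sse_policy_value[OF valid] show "(knapsack_factor (1 / 100) I * 0.316 - \<epsilon>) * online_opt I \<le> expected_value I (sse_policy I)"
      by linarith
  qed
  show ?thesis
  proof (rule exI[of _ "1 / 100"], intro conjI exI[of _ C] exI[of _ d] allI impI)
    fix \<epsilon> :: real assume \<epsilon>: "0 < \<epsilon>"
    show "\<exists>P. \<forall>I. valid_instance I \<longrightarrow>
      (\<exists>\<pi>. online_policy I \<pi> \<and>
         implements_within I P \<pi> (C * (real (num_opts I) + real (max_eval I) + 1 / \<epsilon>) ^ d) \<and>
         expected_value I \<pi> \<ge> (knapsack_factor (1 / 100) I * 0.316 - \<epsilon>) * online_opt I)"
      using main[OF \<epsilon>] by blast
  qed simp
qed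

end
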